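(* Let $k$ be a non-negative integer. There are only finitely many doubled path equivalence classes of reduced alternating decomposition graphs $G$ with $g_T(G)=k$.
   Context: Graphs are finite and may have multiple edges. A link diagram $D$ is viewed as a $4$-valent graph on the sphere $S^2$ with over/under information at the vertices (crossings). An edge of $D$ is non-alternating if both of its ends are over-strands or both are under-strands at the crossings they meet; otherwise it is alternating. A diagram is alternating if all its edges are alternating. Alternating decomposition graph of $D$: for a connected diagram $D$, mark two distinct points on every non-alternating edge, and inside each face join by disjoint arcs those pairs of marked points that are adjacent along the boundary of the face but do not lie on the same edge of $D$; the arcs form disjoint simple closed curves $\gamma_1,\dots,\gamma_m$. If $D$ is connected and alternating, its alternating decomposition graph is a single vertex. If $D$ is connected and not alternating, the graph has vertices $v_1,\dots,v_m$ corresponding to the curves and one edge for each non-alternating edge of $D$, joining $v_i$ and $v_j$ where $\gamma_i,\gamma_j$ are the curves through the two marked points. For disconnected $D$ take the disjoint union over connected components. An alternating decomposition graph is a graph arising in this way from some link diagram. For a link diagram $D$, $g_T(D)=\frac12\bigl(2k(D)+c(D)-s_A(D)-s_B(D)\bigr)$ is the genus of its Turaev surface, where $k(D)$ is the number of connected components of $D$ as a graph, $c(D)$ the number of crossings, and $s_A(D),s_B(D)$ the numbers of curves in the all-$A$ and all-$B$ states. For an alternating decomposition graph $G$, $g_T(G):=g_T(D)$ for any diagram $D$ with alternating decomposition graph $G$ (this is independent of $D$). A graph is $k$-edge connected if it remains connected whenever fewer than $k$ edges are removed. An alternating decomposition graph $G$ is reduced if $G$ is a single vertex or every component of $G$ is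 $3$-edge connected; here an isolated vertex component is not counted as $3$-edge connected. A doubled path of length $\ell$ in $G$ consists of distinct vertices $v_0,\dots,v_\ell$ such that for each $i=1,\dots,\ell$ there are two distinct edges $e_{i,1},e_{i,2}$ joining $v_{i-1}$ and $v_i$, and $\deg v_i=4$ for $1\le i\le \ell-1$. A doubled path contraction of $G$ replaces $G$ by $G/\{e_{i,1},e_{i,2}\}$ (identify $v_{i-1}$ and $v_i$ and delete $e_{i,1},e_{i,2}$) for some $i$ and some doubled path of length $\ell\ge 2$, so that the doubled path is shortened but not destroyed; the inverse operation is a doubled path extension. Two alternating decomposition graphs are doubled path equivalent if some finite sequence of doubled path contractions and extensions transforms one into the other (up to isomorphism); intermediate graphs need not be bipartite. *)

theory Defs
  imports Complex_Main
begin

section \<open>Finite multigraphs\<close>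

record ('v, 'e) multigraph =
  verts :: "'v set"
  edges :: "'e set"
  ends :: "'e \<Rightarrow> 'v set"

text \<open>An edge is a loop iff its set of ends is a singleton. The values of \<open>ends\<close> outside
  \<open>edges\<close> are irrelevant, and are ignored by the notion of isomorphism below.\<close>

definition multigraph :: "('v, 'e) multigraph \<Rightarrow> bool" where
  "multigraph G \<longleftrightarrow> finite (verts G) \<and> finite (edges G) \<and>
     (\<forall>e\<in>edges G. ends G e \<subseteq> verts G \<and> card (ends G e) \<in> {1, 2})"

definition graph_iso :: "('v, 'e) multigraph \<Rightarrow> ('w, 'f) multigraph \<Rightarrow> bool" where
  "graph_iso G H \<longleftrightarrow> (\<exists>f g. bij_betw f (verts G) (verts H) \<and> bij_betw g (edges G) (edges H) \<and>
     (\<forall>e\<in>edges G. ends H (g e) = f ` ends G e))"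

definition degree :: "('v, 'e) multigraph \<Rightarrow> 'v \<Rightarrow> nat" where
  "degree G v = card {e \<in> edges G. v \<in> ends G e} + card {e \<in> edges G. ends G e = {v}}"

definition reachable :: "('v, 'e) multigraph \<Rightarrow> 'v \<Rightarrow> 'v \<Rightarrow> bool" where
  "reachable G = (\<lambda>u v. \<exists>e\<in>edges G. ends G e = {u, v})\<^sup>*\<^sup>*"

definition connected_graph :: "('v, 'e) multigraph \<Rightarrow> bool" where
  "connected_graph G \<longleftrightarrow> verts G \<noteq> {} \<and> (\<forall>u\<in>verts G. \<forall>v\<in>verts G. reachable G u v)"

definition delete_edges :: "('v, 'e) multigraph \<Rightarrow> 'e set \<Rightarrow> ('v, 'e) multigraph" where
  "delete_edges G F = G\<lparr>edges := edges G - F\<rparr>"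

definition k_edge_connected :: "nat \<Rightarrow> ('v, 'e) multigraph \<Rightarrow> bool" where
  "k_edge_connected k G \<longleftrightarrow>
     (\<forall>F \<subseteq> edges G. finite F \<and> card F < k \<longrightarrow> connected_graph (delete_edges G F))"

definition component_of :: "('v, 'e) multigraph \<Rightarrow> 'v \<Rightarrow> ('v, 'e) multigraph" where
  "component_of G v =
     (let W = {w \<in> verts G. reachable G v w}
      in G\<lparr>verts := W, edges := {e \<in> edges G. ends G e \<subseteq> W}\<rparr>)"

definition single_vertex :: "('v, 'e) multigraph \<Rightarrow> bool" where
  "single_vertex G \<longleftrightarrow> (\<exists>v. verts G = {v}) \<and> edges G = {}"

definition reduced :: "('v, 'e) multigraph \<Rightarrow> bool" where
  "reduced G \<longleftrightarrow> single_vertex G \<or>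
     (\<forall>v\<in>verts G. k_edge_connected 3 (component_of G v) \<and> \<not> single_vertex (component_of G v))"


section \<open>Doubled path equivalence\<close>

text \<open>The path has vertices \<open>vs ! 0, \<dots>, vs ! l\<close>, where \<open>l = length es\<close>; the pair
  \<open>es ! i\<close> consists of the two edges joining \<open>vs ! i\<close> and \<open>vs ! Suc i\<close>.\<close>

definition doubled_path :: "('v, 'e) multigraph \<Rightarrow> 'v list \<Rightarrow> ('e \<times> 'e) list \<Rightarrow> bool" where
  "doubled_path G vs es \<longleftrightarrow>
     length vs = Suc (length es) \<and> distinct vs \<and> set vs \<subseteq> verts G \<and>
     (\<forall>i<length es. fst (es ! i) \<noteq> snd (es ! i) \<and>
        (\<forall>e\<in>{fst (es ! i), snd (es ! i)}. e \<in> edges G \<and> ends G e = {vs ! i, vs ! Suc i})) \<and>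
     (\<forall>i. 0 < i \<and> i < length es \<longrightarrow> degree G (vs ! i) = 4)"

text \<open>Identify \<open>w\<close> with \<open>u\<close>, keeping the name \<open>u\<close>, and delete the edges in \<open>F\<close>.\<close>

definition contract :: "('v, 'e) multigraph \<Rightarrow> 'v \<Rightarrow> 'v \<Rightarrow> 'e set \<Rightarrow> ('v, 'e) multigraph" where
  "contract G u w F =
     \<lparr>verts = verts G - {w}, edges = edges G - F,
      ends = (\<lambda>e. (\<lambda>x. if x = w then u else x) ` ends G e)\<rparr>"

definition doubled_path_contraction ::
    "('v, 'e) multigraph \<Rightarrow> ('v, 'e) multigraph \<Rightarrow> bool" where
  "doubled_path_contraction G H \<longleftrightarrow>
     (\<exists>vs es i. doubled_path G vs es \<and> 2 \<le> length es \<and> i < length es \<and>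
        H = contract G (vs ! i) (vs ! Suc i) {fst (es ! i), snd (es ! i)})"

definition doubled_path_equiv :: "(('v, 'e) multigraph \<times> ('v, 'e) multigraph) set" where
  "doubled_path_equiv = {(G, H).
     equivclp (\<lambda>G H. multigraph G \<and> multigraph H \<and>
       (graph_iso G H \<or> doubled_path_contraction G H)) G H}"

lemma equiv_doubled_path_equiv: "equiv UNIV doubled_path_equiv"
  unfolding doubled_path_equiv_def equiv_def refl_on_def sym_def trans_def
  by (auto intro: equivclp_sym equivclp_trans)


section \<open>Link diagrams\<close>

text \<open>
  A link diagram on the oriented sphere is given by a combinatorial map. The 4-valent graph is
  cut into half-edges (darts), each attached to one crossing: \<open>rot\<close> sends a dart to the
  counterclockwise next dart at the same crossing, \<open>opp\<close> sends it to the other half of its edge,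
  and \<open>over\<close> tells whether it belongs to the over-strand at its crossing. Connected components
  without crossings (simple closed curves) are counted by \<open>circles\<close>.

  The connected components of a disconnected diagram are recorded as separate maps on the sphere;
  their relative position is not recorded. Neither the alternating decomposition graph nor the
  Turaev genus depends on it.
\<close>

record 'd diagram =
  darts :: "'d set"
  rot :: "'d \<Rightarrow> 'd"
  opp :: "'d \<Rightarrow> 'd"
  over :: "'d \<Rightarrow> bool"
  circles :: nat

definition classes_generated :: "'a set \<Rightarrow> ('a \<Rightarrow> 'a \<Rightarrow> bool) \<Rightarrow> 'a set set" where
  "classes_generated X r = X // {(x, y) \<in> X \<times> X. equivclp (\<lambda>a b. a \<in> X \<and> b \<in> X \<and> r a b) x y}"

definition crossings :: "'d diagram \<Rightarrow> 'd set set" where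
  "crossings D = classes_generated (darts D) (\<lambda>x y. y = rot D x)"

definition diagram_edges :: "'d diagram \<Rightarrow> 'd set set" where
  "diagram_edges D = (\<lambda>x. {x, opp D x}) ` darts D"

text \<open>The successor of a side of an edge on the boundary of a face: a dart \<open>x\<close> stands for the
  side of its edge lying to the right when travelling from \<open>x\<close> to \<open>opp D x\<close>.\<close>

definition face_succ :: "'d diagram \<Rightarrow> 'd \<Rightarrow> 'd" where
  "face_succ D x = rot D (opp D x)"

definition faces :: "'d diagram \<Rightarrow> 'd set set" where
  "faces D = classes_generated (darts D) (\<lambda>x y. y = face_succ D x)"

definition crossing_components :: "'d diagram \<Rightarrow> 'd set set" where
  "crossing_components D = classes_generated (darts D) (\<lambda>x y. y = rot D x \<or> y = opp D x)"

text \<open>The last condition says that the components have genus 0: each component satisfies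
  \<open>V - E + F \<le> 2\<close>, so equality of the sums forces equality for every component.\<close>

definition link_diagram :: "'d diagram \<Rightarrow> bool" where
  "link_diagram D \<longleftrightarrow> finite (darts D) \<and>
     bij_betw (rot D) (darts D) (darts D) \<and>
     (\<forall>X\<in>crossings D. card X = 4) \<and>
     (\<forall>x\<in>darts D. opp D x \<in> darts D \<and> opp D x \<noteq> x \<and> opp D (opp D x) = x) \<and>
     (\<forall>x\<in>darts D. over D (rot D x) \<longleftrightarrow> \<not> over D x) \<and>
     card (crossings D) + card (faces D)
       = card (diagram_edges D) + 2 * card (crossing_components D)"


section \<open>Turaev genus\<close>

text \<open>The \<open>A\<close>-regions at a crossing are those swept out by turning the over-strand
  counterclockwise, i.e. those between \<open>x\<close> and \<open>rot D x\<close> for an over-dart \<open>x\<close>. The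
  \<open>A\<close>-smoothing merges them, hence joins each under-dart \<open>x\<close> to \<open>rot D x\<close>; the
  \<open>B\<close>-smoothing joins each over-dart \<open>x\<close> to \<open>rot D x\<close>.\<close>

definition A_state_curves :: "'d diagram \<Rightarrow> 'd set set" where
  "A_state_curves D = classes_generated (darts D)
     (\<lambda>x y. y = opp D x \<or> (\<not> over D x \<and> y = rot D x))"

definition B_state_curves :: "'d diagram \<Rightarrow> 'd set set" where
  "B_state_curves D = classes_generated (darts D)
     (\<lambda>x y. y = opp D x \<or> (over D x \<and> y = rot D x))"

definition num_components :: "'d diagram \<Rightarrow> nat" where
  "num_components D = card (crossing_components D) + circles D"

definition s_A :: "'d diagram \<Rightarrow> nat" where
  "s_A D = card (A_state_curves D) + circles D"

definition s_B :: "'d diagram \<Rightarrow> nat" where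
  "s_B D = card (B_state_curves D) + circles D"

definition turaev_genus :: "'d diagram \<Rightarrow> real" where
  "turaev_genus D =
     (2 * real (num_components D) + real (card (crossings D)) - real (s_A D) - real (s_B D)) / 2"


section \<open>Alternating decomposition graphs\<close>

definition non_alternating :: "'d diagram \<Rightarrow> 'd \<Rightarrow> bool" where
  "non_alternating D x \<longleftrightarrow> (over D x \<longleftrightarrow> over D (opp D x))"

text \<open>The two marked points on a non-alternating edge are identified with its two darts: \<open>x\<close>
  stands for the point closer to the crossing at which \<open>x\<close> is attached.\<close>

definition marked_points :: "'d diagram \<Rightarrow> 'd set" where
  "marked_points D = {x \<in> darts D. non_alternating D x}"

text \<open>\<open>y\<close> is the first non-alternating edge side strictly after \<open>x\<close> on the boundary of the
  face containing \<open>x\<close> (possibly \<open>x\<close> itself, after a full turn).\<close>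

definition next_non_alternating :: "'d diagram \<Rightarrow> 'd \<Rightarrow> 'd \<Rightarrow> bool" where
  "next_non_alternating D x y \<longleftrightarrow>
     (\<exists>n>0. y = (face_succ D ^^ n) x \<and> non_alternating D y \<and>
        (\<forall>i. 0 < i \<and> i < n \<longrightarrow> \<not> non_alternating D ((face_succ D ^^ i) x)))"

text \<open>A non-alternating side \<open>x\<close> passes the marked points \<open>x\<close>, \<open>opp D x\<close> in this order. So,
  apart from pairs on one edge, the adjacent pairs on the boundary of a face are
  \<open>opp D x\<close>, \<open>y\<close> for consecutive non-alternating sides \<open>x\<close>, \<open>y\<close>.\<close>

definition arc_joins :: "'d diagram \<Rightarrow> 'd \<Rightarrow> 'd \<Rightarrow> bool" where
  "arc_joins D p q \<longleftrightarrow>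
     (\<exists>x\<in>marked_points D. p = opp D x \<and> next_non_alternating D x q) \<and> q \<notin> {p, opp D p}"

definition decomposition_curves :: "'d diagram \<Rightarrow> 'd set set" where
  "decomposition_curves D = classes_generated (marked_points D) (arc_joins D)"

definition alternating_components :: "'d diagram \<Rightarrow> 'd set set" where
  "alternating_components D = {C \<in> crossing_components D. \<forall>x\<in>C. \<not> non_alternating D x}"

datatype 'd adg_vertex = Curve "'d set" | Alternating_Component "'d set" | Circle nat

text \<open>For all components of the diagram at once: curves for the non-alternating components, and
  one isolated vertex for each alternating component (with or without crossings).\<close>

definition adg :: "'d diagram \<Rightarrow> ('d adg_vertex, 'd set) multigraph" where
  "adg D =
     \<lparr>verts = Curve ` decomposition_curves D \<union>
              Alternating_Component ` alternating_components D \<union>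
              Circle ` {..<circles D},
      edges = {{x, opp D x} | x. x \<in> marked_points D},
      ends = (\<lambda>e. Curve ` {C \<in> decomposition_curves D. C \<inter> e \<noteq> {}})\<rparr>"

text \<open>Diagrams are finite, so there is no loss in taking natural numbers as darts.\<close>

definition alternating_decomposition_graph :: "('v, 'e) multigraph \<Rightarrow> bool" where
  "alternating_decomposition_graph G \<longleftrightarrow>
     (\<exists>D :: nat diagram. link_diagram D \<and> graph_iso (adg D) G)"

text \<open>Well defined, since the Turaev genus of \<open>D\<close> depends only on \<open>adg D\<close> up to isomorphism.\<close>

definition graph_turaev_genus :: "('v, 'e) multigraph \<Rightarrow> real" where
  "graph_turaev_genus G =
     turaev_genus (SOME D :: nat diagram. link_diagram D \<and> graph_iso (adg D) G)"

end

theory Submission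
  imports Defs
begin

text \<open>
  Let \<open>G\<close> be a reduced alternating decomposition graph of a diagram \<open>D\<close> of Turaev genus \<open>k\<close>. The
  curves make \<open>G\<close> a map on the sphere. Along each curve the edges alternate between two signs, since
  both ends of a non-alternating edge are over- or both are under-strands, and the state curves of
  \<open>D\<close> that meet non-alternating edges trace out \<open>A\<close>-cycles and \<open>B\<close>-cycles in \<open>G\<close>, each family
  partitioning the edges. Planarity of \<open>D\<close> gives \<open>2k \<ge> 2K + E - V - f\<^sub>A - f\<^sub>B\<close>, where \<open>K\<close> is the
  number of components of \<open>G\<close>, that is,
  \<open>2k \<ge> 2K + \<Sum>\<^sub>v (deg v - 4)/4 + \<Sum>\<^sub>C (\<bar>C\<bar> - 4)/4\<close> with \<open>C\<close> ranging over the \<open>A\<close>- and \<open>B\<close>-cycles.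

  Every \<open>A\<close>- or \<open>B\<close>-cycle has an even intersection with each face, hence it is an edge cut because
  the first cohomology of the sphere vanishes. By 3-edge connectivity and parity it has at least four
  edges, and all degrees are at least four. So all terms above are non-negative, and only boundedly
  many edges touch a vertex of degree other than 4 or lie on a cycle of length other than 4. Any
  other edge has a parallel twin, since its \<open>A\<close>- and \<open>B\<close>-cycle, being cuts and closed walks, meet
  evenly. Hence all but boundedly many vertices are interior vertices of doubled paths, and
  contracting these leaves a graph of bounded size.
\<close>

section \<open>Generated equivalence classes\<close>

text \<open>The sphere is present only as an equation between numbers of orbits, so both global
  facts come from one counting principle: deleting edges of a map does not raise its genus. For the
  cut property the principle is applied to a double cover of \<open>D\<close>. For the genus bound,
  Euler's formula gives a 4-valent plane diagram \<open>c + 2 K\<close> faces if it has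
  \<open>c\<close> crossings and \<open>K\<close> components with crossings; hence twice the Turaev
  genus is the number of faces minus the number of state curves, both counted without circles. A
  state curve with alternating edges only follows a face whose sides are all alternating, and
  different such curves, also of different states, use different faces. These faces therefore pay
  for those curves. The remaining faces are estimated in the dual map of \<open>D\<close>, from
  which the duals of the alternating edges are deleted: apart from isolated vertices, the faces of
  what is left are the decomposition curves.\<close>

definition conn :: "'a set \<Rightarrow> ('a \<Rightarrow> 'a \<Rightarrow> bool) \<Rightarrow> 'a \<Rightarrow> 'a \<Rightarrow> bool" where
  "conn X r = equivclp (\<lambda>a b. a \<in> X \<and> b \<in> X \<and> r a b)"

definition cls :: "'a set \<Rightarrow> ('a \<Rightarrow> 'a \<Rightarrow> bool) \<Rightarrow> 'a \<Rightarrow> 'a set" where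
  "cls X r x = {y \<in> X. conn X r x y}"

abbreviation ncl :: "'a set \<Rightarrow> ('a \<Rightarrow> 'a \<Rightarrow> bool) \<Rightarrow> nat" where
  "ncl X r \<equiv> card (classes_generated X r)"

lemma conn_refl [simp]: "conn X r x x"
  by (simp add: conn_def)

lemma conn_sym: "conn X r x y \<Longrightarrow> conn X r y x"
  unfolding conn_def by (rule equivclp_sym)

lemma conn_trans [trans]: "conn X r x y \<Longrightarrow> conn X r y z \<Longrightarrow> conn X r x z"
  unfolding conn_def by (rule equivclp_trans)

lemma conn_step: "x \<in> X \<Longrightarrow> y \<in> X \<Longrightarrow> r x y \<Longrightarrow> conn X r x y"
  unfolding conn_def by (rule r_into_equivclp) simp

text \<open>Invariants replace paths: most later arguments choose a function \<open>P\<close> that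
  is constant along the relation, often membership in a set.\<close>

lemma conn_inv:
  assumes "conn X r x y" and "\<And>a b. a \<in> X \<Longrightarrow> b \<in> X \<Longrightarrow> r a b \<Longrightarrow> P a = P b"
  shows "P x = P y"
  using assms(1) unfolding conn_def
proof (induction rule: equivclp_induct)
  case (step y z)
  then show ?case using assms(2)[of y z] assms(2)[of z y] by auto
qed simp

lemma conn_mono:
  assumes "conn X r x y" and "\<And>a b. a \<in> X \<Longrightarrow> b \<in> X \<Longrightarrow> r a b \<Longrightarrow> conn Y s a b"
  shows "conn Y s x y"
proof -
  have "conn Y s x x = conn Y s x y"
    by (rule conn_inv[OF assms(1), where P = "conn Y s x"]) (meson assms(2) conn_sym conn_trans)
  then show ?thesis by simp
qed

lemma conn_cong:
  assumes "\<And>a b. a \<in> X \<Longrightarrow> b \<in> X \<Longrightarrow> r a b = s a b"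
  shows "conn X r = conn X s"
proof -
  have "(\<lambda>a b. a \<in> X \<and> b \<in> X \<and> r a b) = (\<lambda>a b. a \<in> X \<and> b \<in> X \<and> s a b)"
    using assms by (intro ext) auto
  then show ?thesis by (simp add: conn_def)
qed

lemma conn_in: "conn X r x y \<Longrightarrow> x \<in> X \<longleftrightarrow> y \<in> X"
  by (erule conn_inv[where P = "\<lambda>z. z \<in> X"]) auto

lemma in_cls: "y \<in> cls X r x \<longleftrightarrow> y \<in> X \<and> conn X r x y"
  by (simp add: cls_def)

lemma cls_self: "x \<in> X \<Longrightarrow> x \<in> cls X r x"
  by (simp add: in_cls)

lemma cls_subset: "cls X r x \<subseteq> X"
  by (auto simp: in_cls)

lemma cls_eq_iff: "x \<in> X \<Longrightarrow> y \<in> X \<Longrightarrow> cls X r x = cls X r y \<longleftrightarrow> conn X r x y"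
  unfolding cls_def by (blast intro: conn_sym conn_trans conn_refl)

lemma cls_step: "x \<in> X \<Longrightarrow> y \<in> X \<Longrightarrow> conn X r x y \<Longrightarrow> y \<in> cls X r p \<longleftrightarrow> x \<in> cls X r p"
  unfolding in_cls by (blast intro: conn_trans conn_sym)

lemma classes_generated_eq: "classes_generated X r = cls X r ` X"
  unfolding classes_generated_def quotient_def cls_def conn_def by auto

lemma classes_generated_cong:
  assumes "\<And>a b. a \<in> X \<Longrightarrow> b \<in> X \<Longrightarrow> conn X r a b = conn X s a b"
  shows "classes_generated X r = classes_generated X s"
proof -
  have "cls X r x = cls X s x" if "x \<in> X" for x
    using assms that by (auto simp: in_cls)
  then show ?thesis by (simp add: classes_generated_eq)
qed

lemma finite_classes_generated: "finite X \<Longrightarrow> finite (classes_generated X r)"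
  by (simp add: classes_generated_eq)

lemma classes_generated_disjoint:
  assumes "C \<in> classes_generated X r" "C' \<in> classes_generated X r" "x \<in> C" "x \<in> C'"
  shows "C = C'"
proof -
  obtain c c' where c: "c \<in> X" "C = cls X r c" "c' \<in> X" "C' = cls X r c'"
    using assms(1,2) by (auto simp: classes_generated_eq)
  then have "conn X r c c'" using assms(3,4) by (auto simp: in_cls intro: conn_sym conn_trans)
  then show ?thesis using c by (simp add: cls_eq_iff)
qed

lemma class_eq_cls:
  assumes "C \<in> classes_generated X r" "x \<in> C"
  shows "C = cls X r x"
proof -
  have "x \<in> X" using assms by (auto simp: classes_generated_eq in_cls)
  then show ?thesis
    using classes_generated_disjoint[OF assms(1) _ assms(2), of "cls X r x"]
    by (simp add: cls_self classes_generated_eq)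
qed

lemma class_subset: "C \<in> classes_generated X r \<Longrightarrow> C \<subseteq> X"
  by (auto simp: classes_generated_eq in_cls)

lemma class_nonempty: "C \<in> classes_generated X r \<Longrightarrow> C \<noteq> {}"
  by (auto simp: classes_generated_eq dest: cls_self)

lemma Union_classes_generated: "\<Union> (classes_generated X r) = X"
  by (auto simp: classes_generated_eq in_cls)

lemma sum_card_classes_generated:
  assumes "finite X"
  shows "(\<Sum>C\<in>classes_generated X r. card C) = card X"
proof -
  have "card (\<Union> (classes_generated X r)) = (\<Sum>C\<in>classes_generated X r. card C)"
  proof (rule card_Union_disjoint)
    show "pairwise disjnt (classes_generated X r)"
      unfolding pairwise_def disjnt_def using classes_generated_disjoint[of _ X r] by blast
    show "finite C" if "C \<in> classes_generated X r" for C
      using class_subset[OF that] assms by (rule finite_subset)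
  qed
  then show ?thesis by (simp add: Union_classes_generated)
qed

lemma card_image_factor:
  assumes "finite X" "\<And>x y. x \<in> X \<Longrightarrow> y \<in> X \<Longrightarrow> h x = h y \<Longrightarrow> f x = f y"
  shows "card (f ` X) \<le> card (h ` X)"
proof -
  have "f (inv_into X h (h x)) = f x" if "x \<in> X" for x
    using that assms(2) by (metis f_inv_into_f image_eqI inv_into_into)
  then have "f ` X = (\<lambda>z. f (inv_into X h z)) ` h ` X"
    by (simp add: image_image)
  then show ?thesis using card_image_le[OF finite_imageI[OF assms(1)]] by metis
qed

lemma ncl_antimono:
  assumes "finite X" "\<And>a b. a \<in> X \<Longrightarrow> b \<in> X \<Longrightarrow> r a b \<Longrightarrow> conn X s a b"
  shows "ncl X s \<le> ncl X r"
  unfolding classes_generated_eq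
  using assms(1)
proof (rule card_image_factor)
  fix x y assume xy: "x \<in> X" "y \<in> X" "cls X r x = cls X r y"
  then have "conn X r x y" by (simp add: cls_eq_iff)
  then have "conn X s x y" by (rule conn_mono) (rule assms(2))
  then show "cls X s x = cls X s y" using xy by (simp add: cls_eq_iff)
qed

lemma ncl_discrete:
  assumes "\<And>a b. a \<in> X \<Longrightarrow> b \<in> X \<Longrightarrow> r a b \<Longrightarrow> a = b"
  shows "ncl X r = card X"
proof -
  have eq: "conn X r x y \<Longrightarrow> x = y" for x y
    using conn_inv[of X r x y "\<lambda>z. z = x"] assms by auto
  have "cls X r x = {x}" if "x \<in> X" for x
    using that by (auto simp: in_cls dest: eq)
  then have "inj_on (cls X r) X" by (simp add: inj_on_def)
  then show ?thesis by (simp add: classes_generated_eq card_image)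
qed

text \<open>The classes of \<open>a\<close> and \<open>b\<close> are replaced by their union
  \<open>U\<close>, and all other classes survive. This gives the exact change in the number of
  faces, edges or components when an edge is added to a map.\<close>

lemma ncl_join:
  assumes "finite X" "a \<in> X" "b \<in> X" "\<not> conn X r a b"
  defines "s \<equiv> \<lambda>x y. r x y \<or> x = a \<and> y = b"
  shows "ncl X r = Suc (ncl X s)"
proof -
  define U where "U = cls X r a \<union> cls X r b"
  have UX: "U \<subseteq> X" by (auto simp: U_def in_cls)
  have U_closed: "x \<in> U \<longleftrightarrow> y \<in> U" if "conn X r x y" for x y
    using that conn_in[OF that] unfolding U_def in_cls Un_iff by (meson conn_sym conn_trans)
  have U_conn: "conn X s x y" if "x \<in> U" "y \<in> U" for x y
  proof -
    have ab: "conn X s a b" using assms by (intro conn_step) (auto simp: s_def)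
    have "conn X s z a" if "z \<in> U" for z
    proof -
      have "conn X r a z \<or> conn X r b z" using that by (auto simp: U_def in_cls)
      moreover have "conn X s u w" if "conn X r u w" for u w
        using that by (rule conn_mono) (auto simp: s_def intro: conn_step)
      ultimately show ?thesis using ab by (meson conn_sym conn_trans)
    qed
    then show ?thesis using that by (meson conn_sym conn_trans)
  qed
  have conn_s: "conn X s x y \<longleftrightarrow> conn X r x y \<or> x \<in> U \<and> y \<in> U" for x y
  proof
    assume "conn X s x y"
    then have "(conn X r x x \<or> x \<in> U \<and> x \<in> U) = (conn X r x y \<or> x \<in> U \<and> y \<in> U)"
    proof (rule conn_inv[where P = "\<lambda>z. conn X r x z \<or> x \<in> U \<and> z \<in> U"])
      fix u w assume uw: "u \<in> X" "w \<in> X" "s u w"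
      show "(conn X r x u \<or> x \<in> U \<and> u \<in> U) = (conn X r x w \<or> x \<in> U \<and> w \<in> U)"
      proof (cases "r u w")
        case True
        then have "conn X r u w" using uw by (intro conn_step)
        then show ?thesis by (metis U_closed conn_sym conn_trans)
      next
        case False
        then have "u = a" "w = b" using uw by (auto simp: s_def)
        then have "u \<in> U" "w \<in> U" using assms by (auto simp: U_def cls_self)
        then show ?thesis using U_closed by blast
      qed
    qed
    then show "conn X r x y \<or> x \<in> U \<and> y \<in> U" by simp
  next
    assume "conn X r x y \<or> x \<in> U \<and> y \<in> U"
    moreover have "conn X s x y" if "conn X r x y"
      using that by (rule conn_mono) (auto simp: s_def intro: conn_step)
    ultimately show "conn X s x y" using U_conn by blast
  qed
  have cls_s: "cls X s x = (if x \<in> U then U else cls X r x)" if "x \<in> X" for x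
    using that UX U_closed by (auto simp: in_cls conn_s)
  let ?R = "classes_generated X r" and ?A = "cls X r a" and ?B = "cls X r b"
  have aU: "a \<in> U" "b \<in> U" using assms by (auto simp: U_def cls_self)
  have 1: "classes_generated X s = insert U (?R - {?A, ?B})"
  proof (intro equalityI subsetI)
    fix C assume "C \<in> classes_generated X s"
    then obtain x where x: "x \<in> X" "C = cls X s x" by (auto simp: classes_generated_eq)
    show "C \<in> insert U (?R - {?A, ?B})"
    proof (cases "x \<in> U")
      case False
      then have "cls X r x \<noteq> ?A" "cls X r x \<noteq> ?B"
        using x by (auto simp: U_def dest: cls_self[of x X r])
      then show ?thesis using x False by (simp add: cls_s classes_generated_eq)
    qed (use x cls_s in auto)
  next
    fix C assume C: "C \<in> insert U (?R - {?A, ?B})"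
    show "C \<in> classes_generated X s"
    proof (cases "C = U")
      case True
      then show ?thesis using cls_s[OF assms(2)] aU assms(2) by (auto simp: classes_generated_eq)
    next
      case False
      then obtain x where x: "x \<in> X" "C = cls X r x" "C \<noteq> ?A" "C \<noteq> ?B"
        using C by (auto simp: classes_generated_eq)
      then have "x \<notin> U" using assms cls_eq_iff[of x X a r] cls_eq_iff[of x X b r]
        unfolding U_def in_cls Un_iff using conn_sym by metis
      then show ?thesis using x cls_s[of x] by (auto simp: classes_generated_eq)
    qed
  qed
  have 2: "U \<notin> ?R"
  proof
    assume "U \<in> ?R"
    then obtain x where "x \<in> X" "U = cls X r x" by (auto simp: classes_generated_eq)
    then have "conn X r x a" "conn X r x b" using aU by (auto simp: in_cls)
    then show False using assms(4) by (meson conn_sym conn_trans)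
  qed
  have 3: "?A \<in> ?R" "?B \<in> ?R" "?A \<noteq> ?B"
    using assms by (auto simp: classes_generated_eq cls_eq_iff)
  have fin: "finite ?R" using assms(1) by (rule finite_classes_generated)
  have "card ?R \<ge> 2" using 3 fin card_mono[of ?R "{?A, ?B}"] by simp
  moreover have "card (?R - {?A, ?B}) = card ?R - 2"
    using 3 fin by (subst card_Diff_subset) auto
  moreover have "card (insert U (?R - {?A, ?B})) = Suc (card (?R - {?A, ?B}))"
    using 2 fin by (intro card_insert_disjoint) auto
  ultimately show ?thesis by (simp add: 1)
qed

section \<open>Orbits of permutations\<close>

abbreviation (input) orb :: "('a \<Rightarrow> 'a) \<Rightarrow> 'a \<Rightarrow> 'a \<Rightarrow> bool" where
  "orb p \<equiv> \<lambda>x y. y = p x"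

lemma funpow_in: "bij_betw p X X \<Longrightarrow> x \<in> X \<Longrightarrow> (p ^^ n) x \<in> X"
  by (induction n) (auto dest: bij_betwE)

lemma conn_funpow: "bij_betw p X X \<Longrightarrow> x \<in> X \<Longrightarrow> conn X (orb p) x ((p ^^ n) x)"
proof (induction n)
  case (Suc n)
  have "conn X (orb p) ((p ^^ n) x) (p ((p ^^ n) x))"
    using Suc.prems funpow_in[of p X x n] bij_betwE by (intro conn_step) fastforce+
  then show ?case using Suc conn_trans by fastforce
qed simp

lemma funpow_cancel:
  assumes "bij_betw p X X" "x \<in> X" "y \<in> X" "(p ^^ n) x = (p ^^ n) y"
  shows "x = y"
  using assms(4)
proof (induction n)
  case (Suc n)
  then have "p ((p ^^ n) x) = p ((p ^^ n) y)" by simp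
  then have "(p ^^ n) x = (p ^^ n) y"
    using funpow_in[OF assms(1)] assms(2,3) bij_betw_imp_inj_on[OF assms(1)] by (meson inj_onD)
  then show ?case using Suc by simp
qed simp

lemma funpow_return:
  assumes "finite X" "bij_betw p X X" "x \<in> X"
  obtains n where "n > 0" "(p ^^ n) x = x"
proof -
  have "(\<lambda>n. (p ^^ n) x) ` UNIV \<subseteq> X" using funpow_in assms by auto
  then have "finite (range (\<lambda>n. (p ^^ n) x))" using assms(1) finite_subset by blast
  then have "\<not> inj (\<lambda>n. (p ^^ n) x)" using finite_imageD infinite_UNIV_nat by blast
  then obtain i j where "i < j" and ij: "(p ^^ i) x = (p ^^ j) x"
    by (metis (mono_tags, lifting) injI linorder_neqE_nat)
  then have "j = i + (j - i)" by simp
  then have "(p ^^ i) x = (p ^^ i) ((p ^^ (j - i)) x)"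
    using ij by (metis comp_apply funpow_add)
  then have "x = (p ^^ (j - i)) x"
    using funpow_cancel[OF assms(2,3)] funpow_in[OF assms(2,3)] by blast
  then show ?thesis using that[of "j - i"] \<open>i < j\<close> by simp
qed

text \<open>Closure under forward steps suffices: on a finite set the injective \<open>p\<close>
  maps \<open>S\<close> onto itself, so backward steps do not leave \<open>S\<close> either.\<close>

lemma closed_conn_orb:
  assumes "finite X" "bij_betw p X X" "S \<subseteq> X" "\<And>x. x \<in> S \<Longrightarrow> p x \<in> S"
    and "conn X (orb p) x y"
  shows "x \<in> S \<longleftrightarrow> y \<in> S"
  using assms(5)
proof (rule conn_inv[where P = "\<lambda>z. z \<in> S"])
  fix a b assume ab: "a \<in> X" "b \<in> X" "b = p a"
  have "inj_on p S" using assms(2,3) by (meson bij_betw_imp_inj_on inj_on_subset)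
  then have "p ` S = S" using assms(1,3,4)
    by (meson endo_inj_surj finite_subset image_subsetI)
  then show "(a \<in> S) = (b \<in> S)"
    using ab assms(2,3,4) by (metis bij_betw_imp_inj_on inj_on_image_mem_iff)
qed

lemma conn_orb_iff:
  assumes "finite X" "bij_betw p X X" "x \<in> X"
  shows "conn X (orb p) x y \<longleftrightarrow> (\<exists>n. y = (p ^^ n) x)"
proof
  assume c: "conn X (orb p) x y"
  have "x \<in> range (\<lambda>n. (p ^^ n) x) \<longleftrightarrow> y \<in> range (\<lambda>n. (p ^^ n) x)"
  proof (rule closed_conn_orb[OF assms(1,2) _ _ c])
    show "range (\<lambda>n. (p ^^ n) x) \<subseteq> X" using funpow_in[OF assms(2,3)] by auto
    show "p z \<in> range (\<lambda>n. (p ^^ n) x)" if "z \<in> range (\<lambda>n. (p ^^ n) x)" for z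
      using that by (auto intro: range_eqI[where x = "Suc _"])
  qed
  moreover have "x \<in> range (\<lambda>n. (p ^^ n) x)" by (rule range_eqI[of _ _ 0]) simp
  ultimately show "\<exists>n. y = (p ^^ n) x" by auto
qed (auto intro: conn_funpow[OF assms(2,3)])

lemma orbitE:
  assumes fin: "finite X" and bij: "bij_betw p X X" and x: "x \<in> X"
  obtains m where "m > 0" "(p ^^ m) x = x" "cls X (orb p) x = (\<lambda>j. (p ^^ j) x) ` {..<m}"
    "inj_on (\<lambda>j. (p ^^ j) x) {..<m}"
proof -
  obtain n0 where "n0 > 0" "(p ^^ n0) x = x" using funpow_return[OF fin bij x] .
  then have ex: "\<exists>n. n > 0 \<and> (p ^^ n) x = x" by blast
  define m where "m = (LEAST n. n > 0 \<and> (p ^^ n) x = x)"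
  have m: "m > 0" "(p ^^ m) x = x" using LeastI_ex[OF ex] unfolding m_def by auto
  have min: "(p ^^ i) x \<noteq> x" if "0 < i" "i < m" for i
    using that not_less_Least unfolding m_def by blast
  have inj: "inj_on (\<lambda>j. (p ^^ j) x) {..<m}"
  proof (rule linorder_inj_onI')
    fix i j assume ij: "i \<in> {..<m}" "j \<in> {..<m}" "i < j"
    show "(p ^^ i) x \<noteq> (p ^^ j) x"
    proof
      assume "(p ^^ i) x = (p ^^ j) x"
      also have "(p ^^ j) x = (p ^^ i) ((p ^^ (j - i)) x)"
        using ij by (metis comp_apply funpow_add le_add_diff_inverse less_imp_le_nat)
      finally have "x = (p ^^ (j - i)) x"
        using funpow_cancel[OF bij x funpow_in[OF bij x]] by blast
      moreover have "0 < j - i" "j - i < m" using ij by auto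
      ultimately show False using min[of "j - i"] by simp
    qed
  qed
  have closed: "p z \<in> (\<lambda>j. (p ^^ j) x) ` {..<m}" if z: "z \<in> (\<lambda>j. (p ^^ j) x) ` {..<m}" for z
  proof -
    obtain j where j: "j < m" "z = (p ^^ j) x" using z by auto
    show ?thesis
    proof (cases "Suc j = m")
      case True
      then have "p z = (p ^^ 0) x" using j m by auto
      then show ?thesis using m(1) by blast
    next
      case False
      then have "p z = (p ^^ Suc j) x" "Suc j < m" using j by auto
      then show ?thesis by blast
    qed
  qed
  have start: "x \<in> (\<lambda>j. (p ^^ j) x) ` {..<m}" using m(1) by (intro image_eqI[of _ _ 0]) auto
  have "cls X (orb p) x = (\<lambda>j. (p ^^ j) x) ` {..<m}"
  proof (intro equalityI subsetI)
    fix y assume "y \<in> cls X (orb p) x"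
    then have "conn X (orb p) x y" by (simp add: in_cls)
    then have "x \<in> (\<lambda>j. (p ^^ j) x) ` {..<m} \<longleftrightarrow> y \<in> (\<lambda>j. (p ^^ j) x) ` {..<m}"
    proof (rule closed_conn_orb[OF fin bij, rotated 2])
      show "(\<lambda>j. (p ^^ j) x) ` {..<m} \<subseteq> X" using funpow_in[OF bij x] by auto
    qed (rule closed)
    then show "y \<in> (\<lambda>j. (p ^^ j) x) ` {..<m}" using start by blast
  next
    fix y assume "y \<in> (\<lambda>j. (p ^^ j) x) ` {..<m}"
    then show "y \<in> cls X (orb p) x"
      using funpow_in[OF bij x] conn_funpow[OF bij x] by (auto simp: in_cls)
  qed
  then show ?thesis using that m inj by blast
qed

section \<open>Splitting and merging cycles by a transposition\<close>

definition swapped :: "('a \<Rightarrow> 'b) \<Rightarrow> 'a \<Rightarrow> 'a \<Rightarrow> 'a \<Rightarrow> 'b" where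
  "swapped p a b = (\<lambda>x. p (if x = a then b else if x = b then a else x))"

lemma bij_betw_swapped:
  assumes "bij_betw p X X" "a \<in> X" "b \<in> X"
  shows "bij_betw (swapped p a b) X X"
proof -
  have "bij_betw (\<lambda>x. if x = a then b else if x = b then a else x) X X"
    by (rule bij_betw_byWitness[where f' = "\<lambda>x. if x = a then b else if x = b then a else x"])
      (use assms in auto)
  then show ?thesis using bij_betw_trans[OF _ assms(1)] unfolding swapped_def comp_def by blast
qed

text \<open>The set \<open>S\<close> is the segment of the cycle from \<open>p a\<close> to the
  first occurrence of \<open>b\<close>. The new permutation sends \<open>b\<close> back to
  \<open>p a\<close>, so it preserves \<open>S\<close>, which contains \<open>b\<close> but not
  \<open>a\<close>.\<close>

lemma split_orbit:
  assumes fin: "finite X" and bij: "bij_betw p X X" and ab: "a \<in> X" "b \<in> X" "a \<noteq> b"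
    and conn: "conn X (orb p) a b"
  shows "\<not> conn X (orb (swapped p a b)) a b"
proof
  assume c: "conn X (orb (swapped p a b)) a b"
  obtain n where "b = (p ^^ n) a" using conn conn_orb_iff[OF fin bij ab(1)] by blast
  then have ex: "\<exists>n. b = (p ^^ n) a" by blast
  define j where "j = (LEAST n. b = (p ^^ n) a)"
  have j: "b = (p ^^ j) a" unfolding j_def using ex by (rule LeastI_ex)
  have min: "b \<noteq> (p ^^ i) a" if "i < j" for i using that not_less_Least unfolding j_def by blast
  have "j > 0" using j ab by (cases j) auto
  define S where "S = (\<lambda>i. (p ^^ i) a) ` {1..j}"
  have "b \<in> S" using j \<open>j > 0\<close> by (auto simp: S_def)
  have "a \<notin> S"
  proof
    assume "a \<in> S"
    then obtain i where i: "a = (p ^^ i) a" "1 \<le> i" "i \<le> j" by (auto simp: S_def)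
    have "(p ^^ j) a = (p ^^ (j - i)) ((p ^^ i) a)"
      using i by (metis comp_apply funpow_add le_add_diff_inverse2)
    then have "b = (p ^^ (j - i)) a" using i(1) j by simp
    then show False using min[of "j - i"] i \<open>j > 0\<close> by auto
  qed
  have "a \<in> S \<longleftrightarrow> b \<in> S"
  proof (rule closed_conn_orb[OF fin bij_betw_swapped[OF bij ab(1,2)] _ _ c])
    show "S \<subseteq> X" using funpow_in[OF bij ab(1)] by (auto simp: S_def)
    fix x assume x: "x \<in> S"
    then obtain i where i: "x = (p ^^ i) a" "1 \<le> i" "i \<le> j" by (auto simp: S_def)
    have "x \<noteq> a" using x \<open>a \<notin> S\<close> by auto
    show "swapped p a b x \<in> S"
    proof (cases "i = j")
      case True
      then have "swapped p a b x = p a" using i j ab by (simp add: swapped_def)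
      then show ?thesis using \<open>j > 0\<close> by (auto simp: S_def intro!: image_eqI[of _ _ 1])
    next
      case False
      then have "x \<noteq> b" using min[of i] i by auto
      then have "swapped p a b x = (p ^^ Suc i) a"
        using \<open>x \<noteq> a\<close> i by (simp add: swapped_def)
      then show ?thesis using i False unfolding S_def by (intro image_eqI[of _ _ "Suc i"]) auto
    qed
  qed
  then show False using \<open>a \<notin> S\<close> \<open>b \<in> S\<close> by blast
qed

text \<open>From \<open>b\<close> the new permutation enters the old cycle of \<open>a\<close> at
  \<open>p a\<close> and runs through it, arriving at \<open>a\<close> after as many steps as that
  cycle is long.\<close>

lemma merge_orbits:
  assumes fin: "finite X" and bij: "bij_betw p X X" and ab: "a \<in> X" "b \<in> X"
    and nconn: "\<not> conn X (orb p) a b"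
  shows "conn X (orb (swapped p a b)) a b"
proof -
  let ?q = "swapped p a b"
  have bij': "bij_betw ?q X X" using bij ab by (rule bij_betw_swapped)
  obtain n0 where "n0 > 0" "(p ^^ n0) a = a" using funpow_return[OF fin bij ab(1)] .
  then have ex: "\<exists>n. n > 0 \<and> (p ^^ n) a = a" by blast
  define m where "m = (LEAST n. n > 0 \<and> (p ^^ n) a = a)"
  have m: "m > 0" "(p ^^ m) a = a" using LeastI_ex[OF ex] unfolding m_def by auto
  have min: "(p ^^ i) a \<noteq> a" if "0 < i" "i < m" for i
    using that not_less_Least unfolding m_def by blast
  have neq: "(p ^^ i) a \<noteq> b" for i using nconn conn_funpow[OF bij ab(1)] by metis
  have "(?q ^^ i) b = (p ^^ i) a" if "1 \<le> i" "i \<le> m" for i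
    using that
  proof (induction i)
    case (Suc i)
    show ?case
    proof (cases "i = 0")
      case True
      then show ?thesis using neq[of 0] by (simp add: swapped_def)
    next
      case False
      then have "(?q ^^ i) b = (p ^^ i) a" "(p ^^ i) a \<noteq> a"
        using Suc min by auto
      then show ?thesis using neq[of i] by (simp add: swapped_def)
    qed
  qed simp
  then have "(?q ^^ m) b = a" using m by simp
  then show ?thesis using conn_funpow[OF bij' ab(2), of m] by (simp add: conn_sym)
qed

section \<open>Euler's inequality\<close>

text \<open>An edge is deleted by fixing its two darts instead of removing them, so that the dart
  set and the vertex permutation stay the same while \<open>S\<close> varies.\<close>

definition partial_map :: "('a \<Rightarrow> 'a) \<Rightarrow> 'a set \<Rightarrow> 'a \<Rightarrow> 'a" where
  "partial_map p S x = (if x \<in> S then p x else x)"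

text \<open>A rotation system on a closed oriented surface, possibly disconnected: vertices, edges
  and faces are the orbits of \<open>\<sigma>\<close>, of \<open>\<alpha>\<close> and of their
  composition.\<close>

locale combinatorial_map =
  fixes X :: "'a set" and \<sigma> \<alpha> :: "'a \<Rightarrow> 'a"
  assumes fin: "finite X"
    and bij: "bij_betw \<sigma> X X"
    and inv_in: "x \<in> X \<Longrightarrow> \<alpha> x \<in> X"
    and inv_neq: "x \<in> X \<Longrightarrow> \<alpha> x \<noteq> x"
    and inv_inv: "x \<in> X \<Longrightarrow> \<alpha> (\<alpha> x) = x"
begin

definition edge_closed :: "'a set \<Rightarrow> bool" where
  "edge_closed S \<longleftrightarrow> S \<subseteq> X \<and> (\<forall>x\<in>S. \<alpha> x \<in> S)"

text \<open>Adding the constant \<open>card X - ncl X (orb \<sigma>)\<close> gives twice the total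
  genus of the map that keeps only the edges in \<open>S\<close>. The orbits of
  \<open>partial_map \<alpha> S\<close> number \<open>card X\<close> minus the number of kept edges,
  which explains the sign of the second term.\<close>

definition defect :: "'a set \<Rightarrow> int" where
  "defect S = 2 * int (ncl X (\<lambda>x y. y = \<sigma> x \<or> y = partial_map \<alpha> S x))
    - int (ncl X (orb (partial_map \<alpha> S))) - int (ncl X (orb (\<lambda>x. \<sigma> (partial_map \<alpha> S x))))"

lemma sigma_in: "x \<in> X \<Longrightarrow> \<sigma> x \<in> X"
  using bij by (rule bij_betw_apply)

lemma edge_closed_notin: "edge_closed S \<Longrightarrow> x \<in> X \<Longrightarrow> x \<notin> S \<Longrightarrow> \<alpha> x \<notin> S"
  using inv_inv unfolding edge_closed_def by metis

lemma bij_betw_partial_map: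
  assumes "edge_closed S"
  shows "bij_betw (partial_map \<alpha> S) X X"
  by (rule bij_betw_byWitness[where f' = "partial_map \<alpha> S"])
    (use assms inv_in inv_inv in \<open>auto simp: partial_map_def edge_closed_def\<close>)

lemma bij_betw_face:
  assumes "edge_closed S"
  shows "bij_betw (\<lambda>x. \<sigma> (partial_map \<alpha> S x)) X X"
  using bij_betw_trans[OF bij_betw_partial_map[OF assms] bij] by (simp add: comp_def)

text \<open>Edges are added one at a time. The function \<open>f\<close> is arbitrary because the
  lemma serves both for \<open>defect\<close> and, with \<open>f\<close> and \<open>- f\<close>, for
  a quantity that is unchanged.\<close>

lemma edge_closed_mono:
  fixes f :: "'a set \<Rightarrow> int"
  assumes step: "\<And>T x. edge_closed T \<Longrightarrow> x \<in> X \<Longrightarrow> x \<notin> T \<Longrightarrow> f T \<le> f (insert x (insert (\<alpha> x) T))"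
    and "edge_closed T" "edge_closed S" "T \<subseteq> S"
  shows "f T \<le> f S"
  using assms(2,4)
proof (induction "card (S - T)" arbitrary: T rule: less_induct)
  case less
  show ?case
  proof (cases "S = T")
    case False
    then obtain x where x: "x \<in> S" "x \<notin> T" using less by blast
    let ?U = "insert x (insert (\<alpha> x) T)"
    have xX: "x \<in> X" "\<alpha> x \<in> S" using x assms(3) by (auto simp: edge_closed_def)
    have "finite S" using assms(3) fin by (auto simp: edge_closed_def intro: finite_subset)
    then have "card (S - ?U) < card (S - T)" using x by (intro psubset_card_mono) auto
    moreover have "edge_closed ?U" "?U \<subseteq> S"
      using less x xX inv_inv inv_in by (auto simp: edge_closed_def)
    ultimately have "f ?U \<le> f S" by (rule less.hyps)
    then show ?thesis using step[OF less.prems(1) xX(1) x(2)] by simp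
  qed simp
qed

context
  fixes T x
  assumes T: "edge_closed T" and x: "x \<in> X" "x \<notin> T"
begin

private abbreviation "S \<equiv> insert x (insert (\<alpha> x) T)"

lemma edge_closed_insert: "edge_closed S"
  using T x inv_inv inv_in by (auto simp: edge_closed_def)

lemma inserted_edge: "\<alpha> x \<in> X" "\<alpha> x \<noteq> x" "\<alpha> x \<notin> T" "\<alpha> (\<alpha> x) = x"
  using x inv_in inv_neq inv_inv edge_closed_notin[OF T] by auto

lemma ncl_partial_map_insert: "ncl X (orb (partial_map \<alpha> T)) = Suc (ncl X (orb (partial_map \<alpha> S)))"
proof -
  let ?s = "\<lambda>u w. w = partial_map \<alpha> T u \<or> u = x \<and> w = \<alpha> x"
  have nc: "\<not> conn X (orb (partial_map \<alpha> T)) x (\<alpha> x)"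
  proof
    assume "conn X (orb (partial_map \<alpha> T)) x (\<alpha> x)"
    then have "x \<in> {x} \<longleftrightarrow> \<alpha> x \<in> {x}"
      by (rule closed_conn_orb[OF fin bij_betw_partial_map[OF T], rotated 2])
        (use x in \<open>auto simp: partial_map_def\<close>)
    then show False using inserted_edge by simp
  qed
  have "conn X ?s u w = conn X (orb (partial_map \<alpha> S)) u w" for u w
  proof
    assume "conn X ?s u w"
    then show "conn X (orb (partial_map \<alpha> S)) u w"
    proof (rule conn_mono)
      fix a b assume ab: "a \<in> X" "b \<in> X" "b = partial_map \<alpha> T a \<or> a = x \<and> b = \<alpha> x"
      then have "b = partial_map \<alpha> S a \<or> a = b"
        using inserted_edge by (auto simp: partial_map_def split: if_splits)
      then show "conn X (orb (partial_map \<alpha> S)) a b" using ab by (auto intro: conn_step)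
    qed
  next
    assume "conn X (orb (partial_map \<alpha> S)) u w"
    then show "conn X ?s u w"
    proof (rule conn_mono)
      fix a b assume ab: "a \<in> X" "b \<in> X" "b = partial_map \<alpha> S a"
      then have "?s a b \<or> ?s b a"
        using inserted_edge by (auto simp: partial_map_def split: if_splits)
      then show "conn X ?s a b"
      proof
        assume "?s b a"
        then have "conn X ?s b a" using ab by (intro conn_step)
        then show ?thesis by (rule conn_sym)
      qed (use ab in \<open>intro conn_step\<close>)
    qed
  qed
  then have "classes_generated X ?s = classes_generated X (orb (partial_map \<alpha> S))" by (rule classes_generated_cong)
  then show ?thesis using ncl_join[OF fin x(1) inserted_edge(1) nc] by simp
qed

text \<open>The genus does not drop when an edge is added. If the two darts of the new edge end up
  on one face, then two faces were merged and at most two components were joined. Otherwise a face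
  was split; both darts lay on that face, hence in one component, so no components were
  joined.\<close>

lemma defect_insert: "defect T \<le> defect S"
proof -
  let ?\<phi>S = "\<lambda>z. \<sigma> (partial_map \<alpha> S z)" and ?\<phi>T = "\<lambda>z. \<sigma> (partial_map \<alpha> T z)"
  let ?kS = "\<lambda>u w. w = \<sigma> u \<or> w = partial_map \<alpha> S u" and ?kT = "\<lambda>u w. w = \<sigma> u \<or> w = partial_map \<alpha> T u"
  \<comment> \<open>Deleting the edge composes the face permutation with the transposition of its
    two darts.\<close>
  have swS: "?\<phi>T = swapped ?\<phi>S x (\<alpha> x)"
    using inserted_edge x(2) by (intro ext) (auto simp: swapped_def partial_map_def)
  have bijS: "bij_betw ?\<phi>S X X" by (rule bij_betw_face[OF edge_closed_insert])
  have kS_conn: "conn X s u w" if "u \<in> X" "w \<in> X" "?kS u w" "conn X s x (\<alpha> x)"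
    "\<And>a b. a \<in> X \<Longrightarrow> b \<in> X \<Longrightarrow> ?kT a b \<Longrightarrow> s a b" for s u w
  proof -
    have "?kT u w \<or> u = x \<and> w = \<alpha> x \<or> u = \<alpha> x \<and> w = x"
      using that(3) inserted_edge by (auto simp: partial_map_def split: if_splits)
    then show ?thesis
    proof (elim disjE conjE)
      assume "w = \<sigma> u" then show ?thesis using that(1,2,5) by (intro conn_step) auto
    next
      assume "w = partial_map \<alpha> T u" then show ?thesis using that(1,2,5) by (intro conn_step) auto
    qed (use that(4) conn_sym in auto)
  qed
  have \<phi>T_conn: "conn X s u w" if "u \<in> X" "w \<in> X" "w = ?\<phi>T u" "conn X s x (\<alpha> x)"
    "\<And>a. a \<in> X \<Longrightarrow> s a (?\<phi>S a)" for s u w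
  proof -
    have st: "conn X s a (?\<phi>S a)" if "a \<in> X" for a
      using that bij_betw_apply[OF bijS] \<open>\<And>a. a \<in> X \<Longrightarrow> s a (?\<phi>S a)\<close> by (intro conn_step) auto
    have "w = swapped ?\<phi>S x (\<alpha> x) u" using that(3) fun_cong[OF swS, of u] by (rule trans)
    then consider "u = x" "w = ?\<phi>S (\<alpha> x)" | "u = \<alpha> x" "w = ?\<phi>S x" | "w = ?\<phi>S u"
      by (cases "u = x"; cases "u = \<alpha> x"; simp add: swapped_def)
    then show ?thesis
    proof cases
      case 1
      then show ?thesis using st[OF inserted_edge(1)] that(4) by (metis conn_trans)
    next
      case 2
      then show ?thesis using st[OF x(1)] that(4) by (metis conn_trans conn_sym)
    next
      case 3
      then show ?thesis using st that by simp
    qed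
  qed
  have main: "2 * int (ncl X ?kT) - int (ncl X (orb ?\<phi>T)) \<le> 1 + 2 * int (ncl X ?kS) - int (ncl X (orb ?\<phi>S))"
  proof (cases "conn X (orb ?\<phi>S) x (\<alpha> x)")
    case True
    then have nc: "\<not> conn X (orb ?\<phi>T) x (\<alpha> x)"
      using split_orbit[OF fin bijS x(1) inserted_edge(1) inserted_edge(2)[symmetric]] by (simp only: swS[symmetric] not_False_eq_True)
    have "ncl X (orb ?\<phi>S) \<le> ncl X (\<lambda>u w. w = ?\<phi>T u \<or> u = x \<and> w = \<alpha> x)"
    proof (rule ncl_antimono[OF fin])
      fix a b assume "a \<in> X" "b \<in> X" "b = ?\<phi>T a \<or> a = x \<and> b = \<alpha> x"
      then show "conn X (orb ?\<phi>S) a b" using \<phi>T_conn[of a b "orb ?\<phi>S"] True by auto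
    qed
    moreover have "ncl X (orb ?\<phi>T) = Suc (ncl X (\<lambda>u w. w = ?\<phi>T u \<or> u = x \<and> w = \<alpha> x))"
      by (rule ncl_join[OF fin x(1) inserted_edge(1) nc])
    moreover have "ncl X ?kT \<le> Suc (ncl X ?kS)"
    proof (cases "conn X ?kT x (\<alpha> x)")
      case True
      then have "ncl X ?kT \<le> ncl X ?kS"
        by (intro ncl_antimono[OF fin]) (use kS_conn in blast)
      then show ?thesis by simp
    next
      case False
      let ?s = "\<lambda>u w. ?kT u w \<or> u = x \<and> w = \<alpha> x"
      have "conn X ?s x (\<alpha> x)" using x inserted_edge by (intro conn_step) auto
      then have "ncl X ?s \<le> ncl X ?kS"
        by (intro ncl_antimono[OF fin]) (use kS_conn[of _ _ ?s] in blast)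
      then show ?thesis using ncl_join[OF fin x(1) inserted_edge(1) False] by simp
    qed
    ultimately show ?thesis by simp
  next
    case False
    let ?s = "\<lambda>u w. w = ?\<phi>S u \<or> u = x \<and> w = \<alpha> x"
    have "conn X ?s x (\<alpha> x)" using x inserted_edge by (intro conn_step) auto
    then have "ncl X ?s \<le> ncl X (orb ?\<phi>T)"
      by (intro ncl_antimono[OF fin]) (use \<phi>T_conn[of _ _ ?s] in blast)
    moreover have "ncl X (orb ?\<phi>S) = Suc (ncl X ?s)"
      by (rule ncl_join[OF fin x(1) inserted_edge(1) False])
    moreover have "ncl X ?kT \<le> ncl X ?kS"
    proof -
      have "conn X (orb ?\<phi>T) x (\<alpha> x)"
        using merge_orbits[OF fin bijS x(1) inserted_edge(1) False] by (simp only: swS[symmetric])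
      then have "conn X ?kT x (\<alpha> x)"
      proof (rule conn_mono)
        fix a b assume ab: "a \<in> X" "b \<in> X" "b = ?\<phi>T a"
        have pa: "partial_map \<alpha> T a \<in> X"
          using ab bij_betw_apply[OF bij_betw_partial_map[OF T]] by simp
        have "conn X ?kT a (partial_map \<alpha> T a)" using ab pa by (intro conn_step) auto
        also have "conn X ?kT (partial_map \<alpha> T a) b" using ab pa by (intro conn_step) auto
        finally show "conn X ?kT a b" .
      qed
      then show ?thesis by (intro ncl_antimono[OF fin]) (use kS_conn in blast)
    qed
    ultimately show ?thesis by simp
  qed
  then show ?thesis using ncl_partial_map_insert unfolding defect_def by simp
qed

end

lemma defect_mono: "edge_closed T \<Longrightarrow> edge_closed S \<Longrightarrow> T \<subseteq> S \<Longrightarrow> defect T \<le> defect S"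
  by (rule edge_closed_mono[where f = defect]) (rule defect_insert)

lemma ncl_partial_map:
  assumes "edge_closed S"
  shows "2 * ncl X (orb (partial_map \<alpha> S)) + card S = 2 * card X"
proof -
  define f where "f S = int (2 * ncl X (orb (partial_map \<alpha> S)) + card S)" for S
  have step: "f (insert x (insert (\<alpha> x) T)) = f T" if "edge_closed T" "x \<in> X" "x \<notin> T" for T x
  proof -
    have "finite T" using that fin by (auto simp: edge_closed_def intro: finite_subset)
    then have "card (insert x (insert (\<alpha> x) T)) = card T + 2"
      using inserted_edge[OF that] that by simp
    then show ?thesis using ncl_partial_map_insert[OF that] by (simp add: f_def)
  qed
  have e: "edge_closed {}" by (simp add: edge_closed_def)
  have "f {} \<le> f S" by (rule edge_closed_mono[OF _ e assms]) (auto simp: step)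
  moreover have "- f {} \<le> - f S" by (rule edge_closed_mono[OF _ e assms, where f = "\<lambda>S. - f S"]) (auto simp: step)
  moreover have "f {} = 2 * int (card X)"
    using ncl_discrete[of X "orb (partial_map \<alpha> {})"] by (simp add: f_def partial_map_def)
  ultimately show ?thesis by (simp add: f_def)
qed

lemma edge_closed_all: "edge_closed X"
  using inv_in by (simp add: edge_closed_def)

lemma classes_partial_map_all:
  shows "classes_generated X (orb (partial_map \<alpha> X)) = classes_generated X (orb \<alpha>)"
    and "classes_generated X (orb (\<lambda>x. \<sigma> (partial_map \<alpha> X x))) = classes_generated X (orb (\<lambda>x. \<sigma> (\<alpha> x)))"
    and "classes_generated X (\<lambda>x y. y = \<sigma> x \<or> y = partial_map \<alpha> X x)
      = classes_generated X (\<lambda>x y. y = \<sigma> x \<or> y = \<alpha> x)"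
  by (rule classes_generated_cong, subst conn_cong[of X], simp_all add: partial_map_def)+

lemma card_edges: "2 * ncl X (orb \<alpha>) = card X"
  using ncl_partial_map[OF edge_closed_all] by (simp add: classes_partial_map_all)

text \<open>The map is compared with the one that has no edges, where each vertex is a component
  with a single face and the genus is zero.\<close>

lemma euler_inequality:
  "ncl X (orb \<sigma>) + ncl X (orb \<alpha>) + ncl X (orb (\<lambda>x. \<sigma> (\<alpha> x)))
    \<le> card X + 2 * ncl X (\<lambda>x y. y = \<sigma> x \<or> y = \<alpha> x)"
proof -
  have "defect {} \<le> defect X"
    by (rule defect_mono) (auto simp: edge_closed_def inv_in)
  moreover have "defect {} = int (ncl X (orb \<sigma>)) - int (card X)"
  proof -
    have "classes_generated X (\<lambda>x y. y = \<sigma> x \<or> y = x) = classes_generated X (orb \<sigma>)"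
      by (intro classes_generated_cong iffI; erule conn_mono) (auto intro: conn_step)
    then show ?thesis
      using ncl_discrete[of X "orb (\<lambda>x. x)"] by (simp add: defect_def partial_map_def)
  qed
  moreover have "defect X = 2 * int (ncl X (\<lambda>x y. y = \<sigma> x \<or> y = \<alpha> x))
      - int (ncl X (orb \<alpha>)) - int (ncl X (orb (\<lambda>x. \<sigma> (\<alpha> x))))"
    by (simp add: defect_def classes_partial_map_all)
  ultimately show ?thesis by simp
qed

end

section \<open>Double covers\<close>

text \<open>The inequality of Booleans is addition modulo 2: \<open>t\<close> tells at which
  elements the lift of \<open>p\<close> changes the sheet.\<close>

definition cover :: "('a \<Rightarrow> 'a) \<Rightarrow> ('a \<Rightarrow> bool) \<Rightarrow> 'a \<times> bool \<Rightarrow> 'a \<times> bool" where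
  "cover p t = (\<lambda>(x, i). (p x, i \<noteq> t x))"

text \<open>Two-sheeted coverings of a relation rather than of a permutation, so that vertices,
  faces and components of a map are treated alike.\<close>

locale double_cover =
  fixes X :: "'a set" and r :: "'a \<Rightarrow> 'a \<Rightarrow> bool" and r' :: "'a \<times> bool \<Rightarrow> 'a \<times> bool \<Rightarrow> bool"
  assumes finX: "finite X"
    and proj: "\<lbrakk>x \<in> X; y \<in> X; r' (x, i) (y, j)\<rbrakk> \<Longrightarrow> r x y"
    and lift: "\<lbrakk>x \<in> X; y \<in> X; r x y\<rbrakk> \<Longrightarrow> \<exists>t. \<forall>i. r' (x, i) (y, i \<noteq> t)"
begin

abbreviation "X' \<equiv> X \<times> (UNIV :: bool set)"

lemma conn_proj:
  assumes "conn X' r' u w"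
  shows "conn X r (fst u) (fst w)"
proof -
  have "conn X r (fst u) (fst u) = conn X r (fst u) (fst w)"
    using assms
  proof (rule conn_inv[where P = "\<lambda>w. conn X r (fst u) (fst w)"])
    fix a b assume "a \<in> X'" "b \<in> X'" "r' a b"
    then have "conn X r (fst a) (fst b)"
      using proj[of "fst a" "fst b" "snd a" "snd b"] by (intro conn_step) auto
    then show "conn X r (fst u) (fst a) = conn X r (fst u) (fst b)"
      by (blast intro: conn_trans conn_sym)
  qed
  then show ?thesis by simp
qed

lemma conn_lift:
  assumes "conn X r x y"
  shows "\<exists>t. \<forall>i. conn X' r' (x, i) (y, i \<noteq> t)"
proof -
  let ?P = "\<lambda>y. \<exists>t. \<forall>i. conn X' r' (x, i) (y, i \<noteq> t)"
  have xor: "(i \<noteq> (t \<noteq> s)) = ((i \<noteq> t) \<noteq> s)" for i t s :: bool by auto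
  have "?P x = ?P y"
    using assms
  proof (rule conn_inv[where P = ?P])
    fix a b assume ab: "a \<in> X" "b \<in> X" "r a b"
    then obtain s where "\<forall>i. r' (a, i) (b, i \<noteq> s)" using lift by blast
    then have s: "conn X' r' (a, i) (b, i \<noteq> s)" for i using ab by (intro conn_step) auto
    show "?P a = ?P b"
    proof
      assume "?P a"
      then obtain t where "conn X' r' (x, i) (a, i \<noteq> t)" for i by blast
      then have "conn X' r' (x, i) (b, (i \<noteq> t) \<noteq> s)" for i using s conn_trans by fast
      then have "conn X' r' (x, i) (b, i \<noteq> (t \<noteq> s))" for i by (simp only: xor)
      then show "?P b" by blast
    next
      assume "?P b"
      then obtain t where t: "conn X' r' (x, i) (b, i \<noteq> t)" for i by blast
      have "conn X' r' (a, (i \<noteq> t) \<noteq> s) (b, i \<noteq> t)" for i using s[of "(i \<noteq> t) \<noteq> s"]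
        by (cases i; cases t; cases s; simp)
      then have "conn X' r' (x, i) (a, (i \<noteq> t) \<noteq> s)" for i using t conn_trans conn_sym by fast
      then have "conn X' r' (x, i) (a, i \<noteq> (t \<noteq> s))" for i by (simp only: xor)
      then show "?P a" by blast
    qed
  qed
  moreover have "?P x" by (rule exI[of _ False]) simp
  ultimately show ?thesis by blast
qed

text \<open>By lifting paths, every point can be moved to one of the two points above the base point
  \<open>b Q\<close> of its class. So at most two classes lie above each class.\<close>

lemma ncl_cover_image:
  assumes b: "\<And>Q. Q \<in> classes_generated X r \<Longrightarrow> b Q \<in> Q"
  shows "classes_generated X' r' = (\<lambda>(Q, i). cls X' r' (b Q, i)) ` (classes_generated X r \<times> UNIV)"
proof (intro equalityI subsetI)
  fix C assume "C \<in> classes_generated X' r'"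
  then obtain x i where x: "x \<in> X" "C = cls X' r' (x, i)" by (auto simp: classes_generated_eq)
  let ?Q = "cls X r x"
  have Q: "?Q \<in> classes_generated X r" using x by (simp add: classes_generated_eq)
  then have bQ: "b ?Q \<in> X" "conn X r x (b ?Q)" using b[OF Q] by (auto simp: in_cls)
  then obtain t where "conn X' r' (x, i) (b ?Q, i \<noteq> t)" using conn_lift by blast
  then have "C = cls X' r' (b ?Q, i \<noteq> t)" using x bQ by (simp add: cls_eq_iff)
  then show "C \<in> (\<lambda>(Q, i). cls X' r' (b Q, i)) ` (classes_generated X r \<times> UNIV)"
    using Q by (intro image_eqI[of _ _ "(?Q, i \<noteq> t)"]) auto
next
  fix C assume "C \<in> (\<lambda>(Q, i). cls X' r' (b Q, i)) ` (classes_generated X r \<times> UNIV)"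
  then show "C \<in> classes_generated X' r'"
    using b class_subset[of _ X r] by (fastforce simp: classes_generated_eq[of X'])
qed

lemma ncl_cover_eq:
  assumes "\<And>x. x \<in> X \<Longrightarrow> \<not> conn X' r' (x, False) (x, True)"
  shows "ncl X' r' = 2 * ncl X r"
proof -
  obtain b where b: "\<And>Q. Q \<in> classes_generated X r \<Longrightarrow> b Q \<in> Q"
    using class_nonempty by (metis all_not_in_conv)
  have "inj_on (\<lambda>(Q, i). cls X' r' (b Q, i)) (classes_generated X r \<times> UNIV)"
  proof (rule inj_onI, clarify)
    fix P i Q j
    assume PQ: "P \<in> classes_generated X r" "Q \<in> classes_generated X r"
      "cls X' r' (b P, i) = cls X' r' (b Q, j)"
    have X: "b P \<in> X" "b Q \<in> X" using PQ b class_subset by blast+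
    then have c: "conn X' r' (b P, i) (b Q, j)" using PQ by (simp add: cls_eq_iff)
    then have "conn X r (b P) (b Q)" using conn_proj by fastforce
    then have "P = Q" using PQ b class_eq_cls[of _ X r] X by (metis cls_eq_iff)
    then show "P = Q \<and> i = j" using c assms[OF X(1)] by (cases i; cases j) (auto dest: conn_sym)
  qed
  then have "card (classes_generated X' r') = card (classes_generated X r \<times> (UNIV :: bool set))"
    using ncl_cover_image[of b] b by (simp add: card_image)
  then show ?thesis by (simp add: card_cartesian_product)
qed

text \<open>At most two classes lie above each class; if the total is twice the number of classes
  below, then no two of these candidates coincide.\<close>

lemma separated_if_ncl_cover_ge:
  assumes "2 * ncl X r \<le> ncl X' r'" "x \<in> X"
  shows "\<not> conn X' r' (x, False) (x, True)"
proof
  assume c: "conn X' r' (x, False) (x, True)"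
  obtain b0 where b0: "\<And>Q. Q \<in> classes_generated X r \<Longrightarrow> b0 Q \<in> Q"
    using class_nonempty by (metis all_not_in_conv)
  \<comment> \<open>The base point of the class of \<open>x\<close> is moved to \<open>x\<close>,
    which turns injectivity of the parametrisation into the claim for \<open>x\<close>
    itself.\<close>
  define b where "b = b0(cls X r x := x)"
  have b: "b Q \<in> Q" if "Q \<in> classes_generated X r" for Q
    using that b0 assms(2) by (auto simp: b_def cls_self)
  let ?f = "\<lambda>(Q, i). cls X' r' (b Q, i)" and ?D = "classes_generated X r \<times> (UNIV :: bool set)"
  have fin: "finite ?D" using finX by (simp add: finite_classes_generated)
  have Q: "cls X r x \<in> classes_generated X r" using assms(2) by (simp add: classes_generated_eq)
  have "card (?f ` ?D) = card ?D"
  proof (rule antisym)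
    show "card (?f ` ?D) \<le> card ?D" using fin by (rule card_image_le)
    show "card ?D \<le> card (?f ` ?D)"
      using assms(1) ncl_cover_image[of b] b by (simp add: card_cartesian_product)
  qed
  then have "inj_on ?f ?D" by (rule eq_card_imp_inj_on[OF fin])
  moreover have "?f (cls X r x, False) = ?f (cls X r x, True)"
    using c assms(2) by (simp add: b_def cls_eq_iff)
  ultimately have "(cls X r x, False) = (cls X r x, True)"
    using Q by (elim inj_onD) auto
  then show False by simp
qed

text \<open>The value \<open>h x\<close> is the sheet above \<open>x\<close> that is reached from
  sheet \<open>False\<close> above the base point of the class of \<open>x\<close>.\<close>

lemma trivialisation:
  assumes sep: "\<And>x. x \<in> X \<Longrightarrow> \<not> conn X' r' (x, False) (x, True)"
  obtains h :: "'a \<Rightarrow> bool" where "\<And>x y i j. \<lbrakk>x \<in> X; y \<in> X; r' (x, i) (y, j)\<rbrakk> \<Longrightarrow> (h x = h y) = (i = j)"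
proof -
  obtain b where b: "\<And>Q. Q \<in> classes_generated X r \<Longrightarrow> b Q \<in> Q"
    using class_nonempty by (metis all_not_in_conv)
  define h where "h x \<longleftrightarrow> conn X' r' (b (cls X r x), False) (x, True)" for x
  have h: "conn X' r' (b (cls X r x), False) (x, i) \<longleftrightarrow> i = h x" if "x \<in> X" for x i
  proof -
    let ?b = "b (cls X r x)"
    have "cls X r x \<in> classes_generated X r" using that by (simp add: classes_generated_eq)
    then have "?b \<in> X" "conn X r ?b x" using b[of "cls X r x"] by (auto simp: in_cls intro: conn_sym)
    then obtain t where "conn X' r' (?b, False) (x, False \<noteq> t)" using conn_lift by blast
    then have t: "conn X' r' (?b, False) (x, t)" by simp
    have "i = t" if "conn X' r' (?b, False) (x, i)" for i
      using that t sep[OF \<open>x \<in> X\<close>] by (cases i; cases t) (auto dest: conn_sym conn_trans)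
    then show ?thesis using t unfolding h_def by metis
  qed
  show ?thesis
  proof (rule that[of h])
    fix x y i j assume xy: "x \<in> X" "y \<in> X" "r' (x, i) (y, j)"
    then have "r x y" by (rule proj)
    then have cr: "conn X r x y" using xy by (intro conn_step)
    then have eq: "cls X r x = cls X r y" using xy by (simp add: cls_eq_iff)
    have c: "conn X' r' (x, i) (y, j)" using xy by (intro conn_step) auto
    obtain s where s: "\<And>i. conn X' r' (x, i) (y, i \<noteq> s)" using conn_lift[OF cr] by blast
    have "j = (i \<noteq> s)"
      using c s[of i] sep[OF xy(2)] by (cases j; cases i; cases s) (auto dest: conn_sym conn_trans)
    moreover have "conn X' r' (b (cls X r y), False) (y, h x \<noteq> s)"
      using h[OF xy(1), of "h x"] s[of "h x"] eq conn_trans by fastforce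
    ultimately show "(h x = h y) = (i = j)" using h[OF xy(2)] by (cases i; cases s; auto)
  qed
qed

end

context combinatorial_map
begin

text \<open>The first cohomology of the sphere vanishes: a cochain that is even on every face defines a
  double cover of the map, and Euler's inequality for the cover forces it to be disconnected.\<close>

lemma planar_coboundary:
  assumes planar: "2 * ncl X (\<lambda>x y. y = \<sigma> x \<or> y = \<alpha> x) + card X
      = ncl X (orb \<sigma>) + ncl X (orb \<alpha>) + ncl X (orb (\<lambda>x. \<sigma> (\<alpha> x)))"
    and sym: "\<And>x. x \<in> X \<Longrightarrow> c (\<alpha> x) = c x"
    and even: "\<And>x. x \<in> X \<Longrightarrow> even (card {y \<in> cls X (orb (\<lambda>x. \<sigma> (\<alpha> x))) x. c y})"
  obtains h :: "'a \<Rightarrow> bool" where "\<And>x. x \<in> X \<Longrightarrow> h (\<sigma> x) = h x" "\<And>x. x \<in> X \<Longrightarrow> (h (\<alpha> x) \<noteq> h x) = c x"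
proof -
  let ?X = "X \<times> (UNIV :: bool set)" and ?\<phi> = "\<lambda>x. \<sigma> (\<alpha> x)"
  let ?s = "cover \<sigma> (\<lambda>_. False)" and ?a = "cover \<alpha> c"
  let ?f = "\<lambda>u. ?s (?a u)"
  interpret C: combinatorial_map ?X ?s ?a
  proof
    show "finite ?X" using fin by simp
    have "bij_betw (map_prod \<sigma> id) ?X ?X" using bij by (intro bij_betw_map_prod) auto
    then show "bij_betw ?s ?X ?X" by (simp add: cover_def map_prod_def id_def)
  qed (use inv_in inv_neq inv_inv sym in \<open>auto simp: cover_def\<close>)
  interpret S: double_cover X "orb \<sigma>" "orb ?s"
    by unfold_locales (auto simp: fin cover_def)
  interpret F: double_cover X "orb ?\<phi>" "orb ?f"
    by unfold_locales (auto simp: fin cover_def)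
  interpret K: double_cover X "\<lambda>x y. y = \<sigma> x \<or> y = \<alpha> x" "\<lambda>x y. y = ?s x \<or> y = ?a x"
    by unfold_locales (auto simp: fin cover_def)
  have bij\<phi>: "bij_betw ?\<phi> X X"
    using bij_betw_face[OF edge_closed_all] by (rule bij_betw_cong[THEN iffD1, rotated]) (simp add: partial_map_def)
  have bijf: "bij_betw ?f ?X ?X"
    using C.bij_betw_face[OF C.edge_closed_all] by (rule bij_betw_cong[THEN iffD1, rotated]) (simp add: partial_map_def)
  have "ncl ?X (orb ?s) = 2 * ncl X (orb \<sigma>)"
  proof (rule S.ncl_cover_eq)
    fix x show "\<not> conn ?X (orb ?s) (x, False) (x, True)"
      using conn_inv[of ?X "orb ?s" "(x, False)" "(x, True)" snd] by (auto simp: cover_def)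
  qed
  moreover have "ncl ?X (orb ?f) = 2 * ncl X (orb ?\<phi>)"
  proof (rule F.ncl_cover_eq, rule notI)
    fix x assume x: "x \<in> X" and c: "conn ?X (orb ?f) (x, False) (x, True)"
    \<comment> \<open>After \<open>n\<close> steps the sheet is the parity of the number of visited
      darts that satisfy \<open>c\<close>. By \<open>even\<close> the lifted walk closes up after a
      single turn around the face, so it never reaches the other point above
      \<open>x\<close>.\<close>
    have pow: "(?f ^^ n) (x, False) = ((?\<phi> ^^ n) x, odd (card {j \<in> {..<n}. c ((?\<phi> ^^ j) x)}))" for n
    proof (induction n)
      case (Suc n)
      have "{j \<in> {..<Suc n}. c ((?\<phi> ^^ j) x)} = (if c ((?\<phi> ^^ n) x) then insert n {j \<in> {..<n}. c ((?\<phi> ^^ j) x)}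
        else {j \<in> {..<n}. c ((?\<phi> ^^ j) x)})"
        by (auto simp: less_Suc_eq)
      then show ?case using Suc by (simp add: cover_def)
    qed simp
    obtain m where m: "m > 0" "(?\<phi> ^^ m) x = x"
      and orbit: "cls X (orb ?\<phi>) x = (\<lambda>j. (?\<phi> ^^ j) x) ` {..<m}"
      and inj: "inj_on (\<lambda>j. (?\<phi> ^^ j) x) {..<m}"
      using orbitE[OF fin bij\<phi> x] .
    have "{y \<in> cls X (orb ?\<phi>) x. c y} = (\<lambda>j. (?\<phi> ^^ j) x) ` {j \<in> {..<m}. c ((?\<phi> ^^ j) x)}"
      unfolding orbit by auto
    then have "card {y \<in> cls X (orb ?\<phi>) x. c y} = card {j \<in> {..<m}. c ((?\<phi> ^^ j) x)}"
      using inj by (simp add: card_image inj_on_def)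
    then have fm: "(?f ^^ m) (x, False) = (x, False)" using pow[of m] m even[OF x] by simp
    let ?O = "(\<lambda>j. (?f ^^ j) (x, False)) ` {..<m}"
    have "(x, False) \<in> ?O \<longleftrightarrow> (x, True) \<in> ?O"
      using c
    proof (rule closed_conn_orb[OF C.fin bijf, rotated 2])
      show "?O \<subseteq> ?X" using funpow_in[OF bijf, of "(x, False)"] x by (intro image_subsetI) simp
      fix z assume "z \<in> ?O"
      then obtain j where j: "j < m" "z = (?f ^^ j) (x, False)" by auto
      show "?f z \<in> ?O"
      proof (cases "Suc j = m")
        case True
        then have "?f z = (?f ^^ 0) (x, False)" using j fm by auto
        then show ?thesis using m(1) by blast
      next
        case False
        then have "?f z = (?f ^^ Suc j) (x, False)" "Suc j < m" using j by auto
        then show ?thesis by blast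
      qed
    qed
    moreover have "(x, False) \<in> ?O" using m(1) by (intro image_eqI[of _ _ 0]) auto
    ultimately obtain j where j: "j < m" "(x, True) = (?f ^^ j) (x, False)" by auto
    then have "(?\<phi> ^^ j) x = (?\<phi> ^^ 0) x" using pow[of j] by simp
    then have "j = 0" using inj j(1) m(1) by (auto simp: inj_on_def)
    then show False using j by simp
  qed
  moreover have "2 * ncl ?X (orb ?a) = 2 * card X"
    using C.card_edges by (simp add: card_cartesian_product)
  \<comment> \<open>Write \<open>V + E + F = 2 K + n\<close> for the planar map with
    \<open>n\<close> darts. In the cover \<open>V\<close>, \<open>E\<close>, \<open>F\<close> and
    \<open>n\<close> are doubled, so Euler's inequality leaves at least \<open>2 K\<close>
    components.\<close>
  ultimately have "2 * ncl X (\<lambda>x y. y = \<sigma> x \<or> y = \<alpha> x) \<le> ncl ?X (\<lambda>x y. y = ?s x \<or> y = ?a x)"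
    using C.euler_inequality planar card_edges by (simp add: card_cartesian_product)
  then have "\<not> conn ?X (\<lambda>x y. y = ?s x \<or> y = ?a x) (x, False) (x, True)" if "x \<in> X" for x
    using that by (rule K.separated_if_ncl_cover_ge)
  then obtain h :: "'a \<Rightarrow> bool" where h: "\<And>x y i j. \<lbrakk>x \<in> X; y \<in> X; (y, j) = ?s (x, i) \<or> (y, j) = ?a (x, i)\<rbrakk> \<Longrightarrow> (h x = h y) = (i = j)"
    using K.trivialisation by blast
  show ?thesis
  proof (rule that[of h])
    fix x assume x: "x \<in> X"
    show "h (\<sigma> x) = h x" using h[of x "\<sigma> x" False False] x sigma_in by (auto simp: cover_def)
    show "(h (\<alpha> x) \<noteq> h x) = c x" using h[of x "\<alpha> x" "c x" False] x inv_in by (auto simp: cover_def)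
  qed
qed

end

section \<open>First return maps\<close>

definition first_return :: "('a \<Rightarrow> 'a) \<Rightarrow> 'a set \<Rightarrow> 'a \<Rightarrow> 'a" where
  "first_return p M x = (p ^^ (LEAST n. n > 0 \<and> (p ^^ n) x \<in> M)) x"

lemma first_return_eqI:
  assumes "n > 0" "(p ^^ n) x \<in> M" "\<And>i. 0 < i \<Longrightarrow> i < n \<Longrightarrow> (p ^^ i) x \<notin> M"
  shows "first_return p M x = (p ^^ n) x"
proof -
  have "(LEAST n. n > 0 \<and> (p ^^ n) x \<in> M) = n"
    using assms by (intro Least_equality) (auto simp: not_less[symmetric])
  then show ?thesis by (simp add: first_return_def)
qed

lemma first_returnE:
  assumes "finite X" "bij_betw p X X" "M \<subseteq> X" "x \<in> M"
  obtains n where "n > 0" "first_return p M x = (p ^^ n) x" "(p ^^ n) x \<in> M"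
    "\<And>i. 0 < i \<Longrightarrow> i < n \<Longrightarrow> (p ^^ i) x \<notin> M"
proof -
  obtain m where "m > 0" "(p ^^ m) x = x" using funpow_return[of X p x] assms by blast
  then have ex: "\<exists>n. n > 0 \<and> (p ^^ n) x \<in> M" using assms by auto
  let ?n = "LEAST n. n > 0 \<and> (p ^^ n) x \<in> M"
  have "?n > 0 \<and> (p ^^ ?n) x \<in> M" using ex by (rule LeastI_ex)
  moreover have "(p ^^ i) x \<notin> M" if "0 < i" "i < ?n" for i using that not_less_Least by blast
  ultimately show ?thesis by (intro that[of ?n]) (auto simp: first_return_def)
qed

lemma first_return_in:
  assumes "finite X" "bij_betw p X X" "M \<subseteq> X" "x \<in> M"
  shows "first_return p M x \<in> M"
  using first_returnE[OF assms] by metis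

lemma first_return_induct:
  assumes "finite X" "bij_betw p X X" "M \<subseteq> X" "x \<in> M"
    and "Q (p x)" "\<And>z. z \<in> X \<Longrightarrow> z \<notin> M \<Longrightarrow> Q z \<Longrightarrow> Q (p z)"
  shows "Q (first_return p M x)"
proof -
  obtain n where n: "n > 0" "first_return p M x = (p ^^ n) x" "\<And>i. 0 < i \<Longrightarrow> i < n \<Longrightarrow> (p ^^ i) x \<notin> M"
    using first_returnE[OF assms(1-4)] by metis
  have "Q ((p ^^ i) x)" if "0 < i" "i \<le> n" for i
    using that
  proof (induction i)
    case (Suc i)
    show ?case
    proof (cases "i = 0")
      case False
      then show ?thesis using Suc n(3)[of i] assms(6)[of "(p ^^ i) x"] funpow_in[OF assms(2), of x i] assms(3,4)
        by auto
    qed (use assms(5) in simp)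
  qed simp
  then show ?thesis using n by simp
qed

text \<open>If the walks from two marked elements end at the same place, the longer one passes
  through the start of the other. As that start is marked, the lengths and hence the starts
  agree.\<close>

lemma bij_betw_first_return:
  assumes "finite X" "bij_betw p X X" "M \<subseteq> X"
  shows "bij_betw (first_return p M) M M"
proof -
  have aux: "x = y" if xy: "x \<in> M" "y \<in> M" "(p ^^ n) x = (p ^^ m) y" "n \<le> m" "0 < n"
    "\<And>i. 0 < i \<Longrightarrow> i < m \<Longrightarrow> (p ^^ i) y \<notin> M" for x y n m
  proof -
    have "(p ^^ m) y = (p ^^ n) ((p ^^ (m - n)) y)"
      using xy(4) by (metis comp_apply funpow_add le_add_diff_inverse)
    then have "x = (p ^^ (m - n)) y"
      using xy(1-3) assms(3) funpow_in[OF assms(2)] funpow_cancel[OF assms(2), of x "(p ^^ (m - n)) y" n] by auto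
    then have "m - n = 0" using xy(1,5) xy(6)[of "m - n"] by (metis diff_less gr0I le_eq_less_or_eq less_le_trans xy(4))
    then show ?thesis using \<open>x = (p ^^ (m - n)) y\<close> by simp
  qed
  have "inj_on (first_return p M) M"
  proof (rule inj_onI)
    fix x y assume xy: "x \<in> M" "y \<in> M" "first_return p M x = first_return p M y"
    obtain n where n: "n > 0" "first_return p M x = (p ^^ n) x" "\<And>i. 0 < i \<Longrightarrow> i < n \<Longrightarrow> (p ^^ i) x \<notin> M"
      using first_returnE[OF assms xy(1)] by metis
    obtain m where m: "m > 0" "first_return p M y = (p ^^ m) y" "\<And>i. 0 < i \<Longrightarrow> i < m \<Longrightarrow> (p ^^ i) y \<notin> M"
      using first_returnE[OF assms xy(2)] by metis
    show "x = y"
    proof (cases "n \<le> m")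
      case True
      then show ?thesis using aux[of x y n m] xy n m by simp
    next
      case False
      then show ?thesis using aux[of y x m n] xy n m by simp
    qed
  qed
  moreover have "first_return p M ` M \<subseteq> M" using first_return_in[OF assms] by auto
  ultimately show ?thesis
    using assms endo_inj_surj[of M "first_return p M"] finite_subset unfolding bij_betw_def by blast
qed

section \<open>Counting classes by a set of marked elements\<close>

text \<open>With \<open>M\<close> the darts of the non-alternating edges, these are the state curves
  and faces that leave no trace in the decomposition graph. They are counted separately and cancel
  in the genus bound.\<close>

definition unmarked_classes :: "'a set \<Rightarrow> 'a set \<Rightarrow> ('a \<Rightarrow> 'a \<Rightarrow> bool) \<Rightarrow> 'a set set" where
  "unmarked_classes M X r = {C \<in> classes_generated X r. C \<inter> M = {}}"

lemma finite_unmarked_classes: "finite X \<Longrightarrow> finite (unmarked_classes M X r)"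
  by (simp add: unmarked_classes_def finite_classes_generated)

lemma classes_generated_split:
  assumes "M \<subseteq> X"
  shows "classes_generated X r = unmarked_classes M X r \<union> cls X r ` M"
    and "unmarked_classes M X r \<inter> cls X r ` M = {}"
proof -
  show "unmarked_classes M X r \<inter> cls X r ` M = {}"
  proof (intro equals0I)
    fix C assume C: "C \<in> unmarked_classes M X r \<inter> cls X r ` M"
    then obtain x where "x \<in> M" "C = cls X r x" by blast
    then show False using C assms cls_self[of x X r] by (auto simp: unmarked_classes_def)
  qed
  show "classes_generated X r = unmarked_classes M X r \<union> cls X r ` M"
  proof (intro equalityI subsetI)
    fix C assume C: "C \<in> classes_generated X r"
    show "C \<in> unmarked_classes M X r \<union> cls X r ` M"
      using C class_eq_cls[OF C] by (cases "C \<inter> M = {}") (auto simp: unmarked_classes_def)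
  qed (use assms in \<open>auto simp: unmarked_classes_def classes_generated_eq\<close>)
qed

lemma ncl_split:
  assumes "finite X" "M \<subseteq> X"
  shows "ncl X r = card (unmarked_classes M X r) + card (cls X r ` M)"
  using classes_generated_split[OF assms(2), of r] finite_unmarked_classes[OF assms(1), of M r]
    finite_subset[OF assms(2,1)] by (simp add: card_Un_disjoint)

lemma ncl_marked_le:
  assumes "finite X" "M \<subseteq> X" "\<And>a b. a \<in> M \<Longrightarrow> b \<in> M \<Longrightarrow> s a b \<Longrightarrow> conn X r a b"
  shows "ncl X r \<le> card (unmarked_classes M X r) + ncl M s"
proof -
  have "card (cls X r ` M) \<le> card (cls M s ` M)"
  proof (rule card_image_factor)
    fix x y assume xy: "x \<in> M" "y \<in> M" "cls M s x = cls M s y"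
    then have "conn M s x y" by (simp add: cls_eq_iff)
    then have "conn X r x y" by (rule conn_mono) (rule assms(3))
    then show "cls X r x = cls X r y" using xy assms(2) by (subst cls_eq_iff) auto
  qed (use assms finite_subset in blast)
  then show ?thesis using ncl_split[OF assms(1,2), of r] by (simp add: classes_generated_eq)
qed

lemma ncl_marked_ge:
  assumes "finite X" "M \<subseteq> X" "\<And>a b. a \<in> M \<Longrightarrow> b \<in> M \<Longrightarrow> conn X r a b \<Longrightarrow> conn M s a b"
  shows "card (unmarked_classes M X r) + ncl M s \<le> ncl X r"
proof -
  have "card (cls M s ` M) \<le> card (cls X r ` M)"
  proof (rule card_image_factor)
    fix x y assume xy: "x \<in> M" "y \<in> M" "cls X r x = cls X r y"
    then have "conn X r x y" using assms(2) cls_eq_iff[of x X y r] by auto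
    then show "cls M s x = cls M s y" using xy assms(3) by (simp add: cls_eq_iff)
  qed (use assms finite_subset in blast)
  then show ?thesis using ncl_split[OF assms(1,2), of r] by (simp add: classes_generated_eq)
qed

section \<open>The map of a link diagram and its non-alternating edges\<close>

locale diagram_map =
  fixes D :: "'d diagram"
  assumes D: "link_diagram D"
begin

abbreviation "X \<equiv> darts D"
abbreviation "M \<equiv> marked_points D"
abbreviation "\<phi> \<equiv> face_succ D"

text \<open>The point following \<open>p\<close> on its decomposition curve.\<close>

definition next_point :: "'d \<Rightarrow> 'd" where
  "next_point p = first_return \<phi> M (opp D p)"

lemma finX: "finite X"
  and bij_rot: "bij_betw (rot D) X X"
  and crossing_card: "C \<in> crossings D \<Longrightarrow> card C = 4"
  and opp_in: "x \<in> X \<Longrightarrow> opp D x \<in> X"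
  and opp_neq: "x \<in> X \<Longrightarrow> opp D x \<noteq> x"
  and opp_opp: "x \<in> X \<Longrightarrow> opp D (opp D x) = x"
  and over_rot: "x \<in> X \<Longrightarrow> over D (rot D x) \<longleftrightarrow> \<not> over D x"
  and euler: "card (crossings D) + card (faces D)
       = card (diagram_edges D) + 2 * card (crossing_components D)"
  using D unfolding link_diagram_def by blast+

lemma rot_in: "x \<in> X \<Longrightarrow> rot D x \<in> X"
  using bij_rot by (rule bij_betw_apply)

sublocale R: combinatorial_map X "rot D" "opp D"
  by unfold_locales (use finX bij_rot opp_in opp_neq opp_opp in auto)

lemma bij_phi: "bij_betw \<phi> X X"
  using R.bij_betw_face[OF R.edge_closed_all]
  by (rule bij_betw_cong[THEN iffD1, rotated]) (simp add: partial_map_def face_succ_def)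

text \<open>The dual map: its vertices are the faces of \<open>D\<close>, and its faces are the
  crossings, because \<open>\<phi> (opp D x) = rot D x\<close>.\<close>

sublocale F: combinatorial_map X \<phi> "opp D"
  by unfold_locales (use finX bij_phi opp_in opp_neq opp_opp in auto)

lemma phi_in: "x \<in> X \<Longrightarrow> \<phi> x \<in> X"
  using bij_phi by (rule bij_betw_apply)

lemma MX: "M \<subseteq> X"
  by (auto simp: marked_points_def)

lemma finM: "finite M"
  using MX finX by (rule finite_subset)

lemma over_opp: "x \<in> X \<Longrightarrow> over D (opp D x) \<longleftrightarrow> (if x \<in> M then over D x else \<not> over D x)"
  by (auto simp: marked_points_def non_alternating_def)

lemma opp_in_M: "x \<in> X \<Longrightarrow> opp D x \<in> M \<longleftrightarrow> x \<in> M"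
  using opp_in opp_opp by (auto simp: marked_points_def non_alternating_def)

lemma edge_closed_M: "F.edge_closed M"
  using MX opp_in_M by (auto simp: F.edge_closed_def)

lemma over_phi: "x \<in> X \<Longrightarrow> over D (\<phi> x) \<longleftrightarrow> (if x \<in> M then \<not> over D x else over D x)"
  using opp_in over_rot over_opp by (simp add: face_succ_def)

lemma over_first_return:
  assumes "x \<in> M"
  shows "over D (first_return \<phi> M x) \<longleftrightarrow> \<not> over D x"
  by (rule first_return_induct[OF finX bij_phi MX assms]) (use over_phi assms MX in auto)

lemma next_point_in: "p \<in> M \<Longrightarrow> next_point p \<in> M"
  unfolding next_point_def using opp_in_M MX first_return_in[OF finX bij_phi MX] by blast

lemma bij_next_point: "bij_betw next_point M M"
proof -
  have "bij_betw (opp D) M M"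
    by (rule bij_betw_byWitness[where f' = "opp D"]) (use opp_in_M opp_opp MX in auto)
  from bij_betw_trans[OF this bij_betw_first_return[OF finX bij_phi MX]]
  show ?thesis by (simp add: next_point_def[abs_def] comp_def)
qed

lemma over_next_point: "p \<in> M \<Longrightarrow> over D (next_point p) \<longleftrightarrow> \<not> over D p"
  unfolding next_point_def using over_first_return opp_in_M MX over_opp by auto

lemma phi_opp: "x \<in> X \<Longrightarrow> \<phi> (opp D x) = rot D x"
  by (simp add: face_succ_def opp_opp)

lemma next_point_induct:
  assumes "p \<in> M" "Q (rot D p)" "\<And>z. z \<in> X \<Longrightarrow> z \<notin> M \<Longrightarrow> Q z \<Longrightarrow> Q (\<phi> z)"
  shows "Q (next_point p)"
proof -
  have p: "opp D p \<in> M" "\<phi> (opp D p) = rot D p" using assms(1) MX opp_in_M phi_opp by auto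
  show ?thesis
    unfolding next_point_def
    by (rule first_return_induct[OF finX bij_phi MX p(1), of Q]) (simp_all add: p(2) assms(2,3))
qed

lemma next_non_alternating_iff:
  assumes "x \<in> M"
  shows "next_non_alternating D x y \<longleftrightarrow> y = first_return \<phi> M x"
proof -
  have na: "non_alternating D ((\<phi> ^^ n) x) \<longleftrightarrow> (\<phi> ^^ n) x \<in> M" for n
    using funpow_in[OF bij_phi, of x n] assms MX by (auto simp: marked_points_def)
  show ?thesis
  proof
    assume "next_non_alternating D x y"
    then obtain n where "n > 0" "y = (\<phi> ^^ n) x" "(\<phi> ^^ n) x \<in> M" "\<forall>i. 0 < i \<and> i < n \<longrightarrow> (\<phi> ^^ i) x \<notin> M"
      unfolding next_non_alternating_def using na by auto
    then show "y = first_return \<phi> M x" using first_return_eqI[of n \<phi> x M] by auto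
  next
    assume y: "y = first_return \<phi> M x"
    obtain n where "n > 0" "first_return \<phi> M x = (\<phi> ^^ n) x" "(\<phi> ^^ n) x \<in> M"
      "\<And>i. 0 < i \<Longrightarrow> i < n \<Longrightarrow> (\<phi> ^^ i) x \<notin> M"
      using first_returnE[OF finX bij_phi MX assms] by metis
    then show "next_non_alternating D x y"
      unfolding next_non_alternating_def y using na by (intro exI[of _ n]) auto
  qed
qed

text \<open>The side conditions in the definition of the arcs hold automatically, because consecutive
  non-alternating sides of a face have opposite signs.\<close>

lemma arc_joins_iff:
  assumes "p \<in> M"
  shows "arc_joins D p q \<longleftrightarrow> q = next_point p"
proof -
  have p: "opp D p \<in> M" "opp D (opp D p) = p" using assms MX opp_in_M opp_opp by auto
  have "next_point p \<notin> {p, opp D p}"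
    using over_next_point[OF assms] over_opp[of p] assms MX by auto
  moreover have "x = opp D p" if "x \<in> M" "p = opp D x" for x
    using that MX opp_opp by auto
  ultimately show ?thesis
    unfolding arc_joins_def using p next_non_alternating_iff[OF p(1)]
    by (metis next_point_def)
qed

lemma decomposition_curves_eq: "decomposition_curves D = classes_generated M (orb next_point)"
  unfolding decomposition_curves_def
  by (rule classes_generated_cong, subst conn_cong[of M]) (simp_all add: arc_joins_iff)

section \<open>Planarity of the diagram and cuts\<close>

lemma planarity:
  "2 * ncl X (\<lambda>x y. y = rot D x \<or> y = opp D x) + card X
    = ncl X (orb (rot D)) + ncl X (orb (opp D)) + ncl X (orb \<phi>)"
  and card_darts: "card X = 4 * ncl X (orb (rot D))"
proof -
  have "diagram_edges D = classes_generated X (orb (opp D))"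
  proof -
    have "cls X (orb (opp D)) x = {x, opp D x}" if x: "x \<in> X" for x
    proof (intro equalityI subsetI)
      fix y assume "y \<in> cls X (orb (opp D)) x"
      then have "conn X (orb (opp D)) x y" by (simp add: in_cls)
      then have "x \<in> {x, opp D x} \<longleftrightarrow> y \<in> {x, opp D x}"
        by (rule conn_inv[where P = "\<lambda>y. y \<in> {x, opp D x}"]) (use x opp_opp in \<open>auto; metis\<close>)
      then show "y \<in> {x, opp D x}" by simp
    next
      fix y assume "y \<in> {x, opp D x}"
      then show "y \<in> cls X (orb (opp D)) x"
        using x opp_in[OF x] by (auto simp: in_cls intro: conn_step)
    qed
    then show ?thesis by (simp add: diagram_edges_def classes_generated_eq)
  qed
  then show "2 * ncl X (\<lambda>x y. y = rot D x \<or> y = opp D x) + card X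
    = ncl X (orb (rot D)) + ncl X (orb (opp D)) + ncl X (orb \<phi>)"
    using euler R.card_edges by (simp add: crossings_def faces_def crossing_components_def)
  have "card X = (\<Sum>C\<in>classes_generated X (orb (rot D)). card C)"
    using sum_card_classes_generated[OF finX] by metis
  also have "\<dots> = (\<Sum>C\<in>classes_generated X (orb (rot D)). 4)"
    using crossing_card by (intro sum.cong) (auto simp: crossings_def)
  finally show "card X = 4 * ncl X (orb (rot D))" by simp
qed

text \<open>Within a face the first return map pairs the darts of \<open>C\<close> of sign
  \<open>b\<close> with those of the other sign, so \<open>C\<close> meets every face evenly and is
  the coboundary of a function on the crossings. Alternating edges are not in \<open>C\<close>, so
  this function does not change across them and is constant along each decomposition curve.\<close>

lemma cut_function:
  assumes "C \<subseteq> M" "\<And>p. p \<in> M \<Longrightarrow> opp D p \<in> C \<longleftrightarrow> p \<in> C"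
    and "\<And>p. p \<in> M \<Longrightarrow> over D p = b \<Longrightarrow> next_point p \<in> C \<longleftrightarrow> p \<in> C"
  obtains h :: "'d \<Rightarrow> bool" where "\<And>p. p \<in> M \<Longrightarrow> h (next_point p) = h p"
    "\<And>p. p \<in> M \<Longrightarrow> (h (opp D p) \<noteq> h p) \<longleftrightarrow> p \<in> C"
proof -
  let ?\<nu> = "first_return \<phi> M"
  have \<nu>C: "?\<nu> y \<in> C \<longleftrightarrow> y \<in> C" if "y \<in> M" "over D y = b" for y
  proof -
    have "opp D y \<in> M" "opp D (opp D y) = y" "over D (opp D y) = b"
      using that MX opp_in_M opp_opp over_opp by auto
    then show ?thesis using assms(3)[of "opp D y"] assms(2)[of y] that by (simp add: next_point_def)
  qed
  have even: "even (card {y \<in> cls X (orb (\<lambda>x. rot D (opp D x))) x. y \<in> C})" if "x \<in> X" for x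
  proof -
    let ?O = "{y \<in> cls X (orb \<phi>) x. y \<in> C}"
    let ?P = "{y \<in> ?O. over D y = b}" and ?N = "{y \<in> ?O. over D y \<noteq> b}"
    have con: "?\<nu> y \<in> cls X (orb \<phi>) x \<longleftrightarrow> y \<in> cls X (orb \<phi>) x" if "y \<in> M" for y
    proof -
      have "conn X (orb \<phi>) y (?\<nu> y)"
        by (rule first_return_induct[OF finX bij_phi MX that])
          (use that MX phi_in in \<open>auto intro: conn_step conn_trans\<close>)
      then show ?thesis using that MX first_return_in[OF finX bij_phi MX that]
        by (auto simp: in_cls intro: conn_trans conn_sym)
    qed
    have "bij_betw ?\<nu> ?P ?N"
      unfolding bij_betw_def
    proof
      show "inj_on ?\<nu> ?P"
        using bij_betw_first_return[OF finX bij_phi MX] assms(1)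
        by (auto simp: bij_betw_def intro: inj_on_subset)
      show "?\<nu> ` ?P = ?N"
      proof (intro equalityI subsetI)
        fix z assume "z \<in> ?\<nu> ` ?P"
        then obtain y where "y \<in> ?P" "z = ?\<nu> y" by blast
        then show "z \<in> ?N" using con[of y] \<nu>C[of y] over_first_return[of y] assms(1) by auto
      next
        fix z assume z: "z \<in> ?N"
        then have "z \<in> M" using assms(1) by auto
        then obtain y where y: "y \<in> M" "z = ?\<nu> y"
          using bij_betw_first_return[OF finX bij_phi MX] by (metis bij_betw_imp_surj_on imageE)
        then have "y \<in> ?P" using z con[of y] \<nu>C[of y] over_first_return[of y] by auto
        then show "z \<in> ?\<nu> ` ?P" using y by blast
      qed
    qed
    then have "card ?P = card ?N" by (rule bij_betw_same_card)
    moreover have "finite ?O" using finX cls_subset[of X "orb \<phi>" x] by (auto intro: finite_subset)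
    moreover have "card ?O = card ?P + card ?N"
    proof -
      have u: "?O = ?P \<union> ?N" and d: "?P \<inter> ?N = {}" by auto
      have "finite ?P" "finite ?N" using \<open>finite ?O\<close> by (rule rev_finite_subset, blast)+
      then have "card (?P \<union> ?N) = card ?P + card ?N" using d by (rule card_Un_disjoint)
      then show ?thesis by (rule trans[OF arg_cong[OF u]])
    qed
    moreover have "cls X (orb (\<lambda>x. rot D (opp D x))) x = cls X (orb \<phi>) x"
      by (simp add: face_succ_def)
    ultimately show ?thesis by simp
  qed
  have pl: "2 * ncl X (\<lambda>x y. y = rot D x \<or> y = opp D x) + card X
    = ncl X (orb (rot D)) + ncl X (orb (opp D)) + ncl X (orb (\<lambda>x. rot D (opp D x)))"
    using planarity by (simp add: face_succ_def)
  have sym: "opp D x \<in> C \<longleftrightarrow> x \<in> C" if "x \<in> X" for x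
    using that assms(1,2) opp_in_M by blast
  have ex: "\<exists>h :: 'd \<Rightarrow> bool. (\<forall>x\<in>X. h (rot D x) = h x) \<and> (\<forall>x\<in>X. (h (opp D x) \<noteq> h x) = (x \<in> C))"
  proof (rule R.planar_coboundary[of "\<lambda>x. x \<in> C", OF pl])
    show "\<exists>h :: 'd \<Rightarrow> bool. (\<forall>x\<in>X. h (rot D x) = h x) \<and> (\<forall>x\<in>X. (h (opp D x) \<noteq> h x) = (x \<in> C))"
      if "\<And>x. x \<in> X \<Longrightarrow> h (rot D x) = h x" "\<And>x. x \<in> X \<Longrightarrow> (h (opp D x) \<noteq> h x) = (x \<in> C)" for h :: "'d \<Rightarrow> bool"
      by (intro exI[of _ h] conjI ballI; erule that)
  qed (erule sym even)+
  then obtain h :: "'d \<Rightarrow> bool" where h: "\<forall>x\<in>X. h (rot D x) = h x" "\<forall>x\<in>X. (h (opp D x) \<noteq> h x) = (x \<in> C)"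
    by (elim exE conjE)
  show ?thesis
  proof (rule that[of h])
    fix p assume p: "p \<in> M"
    show "(h (opp D p) \<noteq> h p) \<longleftrightarrow> p \<in> C" using h p MX by blast
    show "h (next_point p) = h p"
    proof (rule next_point_induct[OF p])
      show "h (rot D p) = h p" using h p MX by blast
      fix z assume z: "z \<in> X" "z \<notin> M" "h z = h p"
      then have "h (opp D z) = h z" using h(2) assms(1) by blast
      then show "h (\<phi> z) = h p" using z h(1) opp_in by (simp add: face_succ_def)
    qed
  qed
qed

section \<open>State curves and the Turaev genus\<close>

abbreviation state :: "bool \<Rightarrow> 'd \<Rightarrow> 'd \<Rightarrow> bool" where
  "state b \<equiv> \<lambda>x y. y = opp D x \<or> over D x = b \<and> y = rot D x"

abbreviation curve_state :: "bool \<Rightarrow> 'd \<Rightarrow> 'd \<Rightarrow> bool" where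
  "curve_state b \<equiv> \<lambda>x y. y = opp D x \<or> over D x = b \<and> y = next_point x"

text \<open>Euler's formula and 4-valence express the number of faces as the number of crossings
  plus twice the number of components with crossings; the contributions of \<open>circles\<close>
  cancel.\<close>

lemma turaev_genus_eq:
  "2 * turaev_genus D = real (ncl X (orb \<phi>)) - real (ncl X (state False)) - real (ncl X (state True))"
  using planarity card_darts R.card_edges
  by (simp add: turaev_genus_def num_components_def s_A_def s_B_def A_state_curves_def B_state_curves_def
      crossings_def crossing_components_def)

text \<open>At an unmarked dart of sign \<open>\<not> b\<close>, passing along the edge and then
  turning as state \<open>b\<close> prescribes is a step of \<open>\<phi>\<close>, and it keeps the
  sign. So after its first turn the state curve follows a face up to the next marked point.\<close>

lemma state_conn_next_point:
  assumes "p \<in> M" "over D p = b"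
  shows "conn X (state b) p (next_point p)"
proof -
  have "conn X (state b) p (next_point p) \<and> over D (next_point p) = (\<not> b)"
  proof (rule next_point_induct[OF assms(1)])
    show "conn X (state b) p (rot D p) \<and> over D (rot D p) = (\<not> b)"
      using assms MX rot_in over_rot by (auto intro!: conn_step)
  next
    fix z assume z: "z \<in> X" "z \<notin> M" "conn X (state b) p z \<and> over D z = (\<not> b)"
    have "conn X (state b) z (opp D z)" using z opp_in by (intro conn_step) auto
    moreover have "conn X (state b) (opp D z) (\<phi> z)"
      using z opp_in rot_in over_opp unfolding face_succ_def by (intro conn_step) auto
    ultimately show "conn X (state b) p (\<phi> z) \<and> over D (\<phi> z) = (\<not> b)"
      using z over_phi by (auto intro: conn_trans)
  qed
  then show ?thesis by simp
qed

lemma ncl_state_le: "ncl X (state b) \<le> card (unmarked_classes M X (state b)) + ncl M (curve_state b)"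
proof (rule ncl_marked_le[OF finX MX])
  fix p q assume pq: "p \<in> M" "q \<in> M" "curve_state b p q"
  show "conn X (state b) p q"
  proof (cases "q = opp D p")
    case True
    then show ?thesis using pq MX by (intro conn_step) auto
  next
    case False
    then show ?thesis using pq state_conn_next_point by auto
  qed
qed

text \<open>On a state curve without non-alternating edges, the darts of sign
  \<open>\<not> b\<close> are closed under \<open>\<phi>\<close>: the curve runs along the inside of
  a face.\<close>

lemma unmarked_state_face:
  assumes "C \<in> unmarked_classes M X (state b)"
  shows "\<exists>F \<in> unmarked_classes M X (orb \<phi>). F \<subseteq> C \<and> (\<forall>x\<in>F. over D x = (\<not> b))"
proof -
  have C: "C \<in> classes_generated X (state b)" "C \<inter> M = {}" "C \<subseteq> X"
    using assms class_subset by (auto simp: unmarked_classes_def)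
  have step: "y \<in> C" if "x \<in> C" "y \<in> X" "state b x y" for x y
  proof -
    have "conn X (state b) x y" using that C by (intro conn_step) auto
    then show ?thesis using class_eq_cls[OF C(1) that(1)] that by (simp add: in_cls)
  qed
  obtain z where z: "z \<in> C" using class_nonempty[OF C(1)] by blast
  obtain x where x: "x \<in> C" "over D x = (\<not> b)"
  proof (cases "over D z = b")
    case True
    have "opp D z \<in> C" using z C step opp_in by blast
    moreover have "z \<in> X" "z \<notin> M" using z C by auto
    ultimately show ?thesis using that[of "opp D z"] True over_opp[of z] by simp
  qed (use that z in auto)
  let ?S = "{x \<in> C. over D x = (\<not> b)}"
  have closed: "\<phi> y \<in> ?S" if "y \<in> ?S" for y
  proof -
    have y: "y \<in> C" "y \<in> X" "y \<notin> M" "over D y = (\<not> b)" using that C by auto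
    have "opp D y \<in> C" using y step opp_in by blast
    then have "\<phi> y \<in> C"
      unfolding face_succ_def using y over_opp[of y] step[of "opp D y"] opp_in rot_in by simp
    then show ?thesis using over_phi y by simp
  qed
  have sub: "cls X (orb \<phi>) x \<subseteq> ?S"
  proof
    fix y assume "y \<in> cls X (orb \<phi>) x"
    then have "conn X (orb \<phi>) x y" by (simp add: in_cls)
    then have "x \<in> ?S \<longleftrightarrow> y \<in> ?S"
      by (rule closed_conn_orb[OF finX bij_phi, rotated 2]) (use C closed in auto)
    then show "y \<in> ?S" using x by simp
  qed
  then have "cls X (orb \<phi>) x \<in> unmarked_classes M X (orb \<phi>)"
    using C x by (auto simp: unmarked_classes_def classes_generated_eq)
  then show ?thesis using sub by blast
qed

text \<open>Each unmarked state curve chooses a face inside it. Choices for one state differ because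
  the curves are disjoint, and choices for different states differ because their sides have opposite
  signs.\<close>

lemma card_unmarked_states:
  "card (unmarked_classes M X (state False)) + card (unmarked_classes M X (state True))
    \<le> card (unmarked_classes M X (orb \<phi>))"
proof -
  let ?U = "\<lambda>b. unmarked_classes M X (state b)" and ?F = "unmarked_classes M X (orb \<phi>)"
  define f where "f b C = (SOME F. F \<in> ?F \<and> F \<subseteq> C \<and> (\<forall>x\<in>F. over D x = (\<not> b)))" for b C
  have f: "f b C \<in> ?F" "f b C \<subseteq> C" "\<And>x. x \<in> f b C \<Longrightarrow> over D x = (\<not> b)" if "C \<in> ?U b" for b C
    using someI_ex[OF unmarked_state_face[OF that, unfolded Bex_def]] unfolding f_def by blast+
  have ne: "\<exists>x. x \<in> f b C" if "C \<in> ?U b" for b C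
    using f(1)[OF that] class_nonempty[of "f b C" X "orb \<phi>"] by (auto simp: unmarked_classes_def)
  have fin: "finite (?U b)" for b using finX by (rule finite_unmarked_classes)
  have inj: "inj_on (f b) (?U b)" for b
  proof (rule inj_onI)
    fix C C' assume C: "C \<in> ?U b" "C' \<in> ?U b" "f b C = f b C'"
    then obtain x where "x \<in> f b C" using ne by blast
    then have "x \<in> C" "x \<in> C'" using C f(2)[OF C(1)] f(2)[OF C(2)] by blast+
    then show "C = C'" using C classes_generated_disjoint[of C X "state b" C' x]
      unfolding unmarked_classes_def by blast
  qed
  have "f False ` ?U False \<inter> f True ` ?U True = {}"
  proof (intro equals0I)
    fix F assume "F \<in> f False ` ?U False \<inter> f True ` ?U True"
    then obtain A B where "A \<in> ?U False" "B \<in> ?U True" "F = f False A" "F = f True B" by blast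
    then show False using f(3)[of A False] f(3)[of B True] ne[of A False] by metis
  qed
  then have "card (f False ` ?U False \<union> f True ` ?U True) = card (?U False) + card (?U True)"
    using fin[of False] fin[of True] inj[of False] inj[of True]
    by (simp add: card_Un_disjoint card_image)
  moreover have "card (f False ` ?U False \<union> f True ` ?U True) \<le> card ?F"
    using f(1)[of _ False] f(1)[of _ True] finX by (intro card_mono finite_unmarked_classes) blast+
  ultimately show ?thesis by simp
qed

section \<open>The dual map restricted to the non-alternating edges\<close>

abbreviation cut_rot :: "'d \<Rightarrow> 'd" where
  "cut_rot \<equiv> \<lambda>x. \<phi> (partial_map (opp D) M x)"

text \<open>From a marked point \<open>p\<close>, the map \<open>cut_rot\<close> goes to
  \<open>rot D p\<close> and then follows \<open>\<phi>\<close> to the next marked point. So a face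
  of the restricted dual map either traces a decomposition curve or is a face of \<open>D\<close>
  that avoids \<open>M\<close>.\<close>

lemma ncl_cut_rot_le: "ncl X (orb cut_rot) \<le> card (unmarked_classes M X (orb \<phi>)) + ncl M (orb next_point)"
proof -
  have bij: "bij_betw cut_rot X X" by (rule F.bij_betw_face[OF edge_closed_M])
  have "ncl X (orb cut_rot) \<le> card (unmarked_classes M X (orb cut_rot)) + ncl M (orb next_point)"
  proof (rule ncl_marked_le[OF finX MX])
    fix p q assume pq: "p \<in> M" "q \<in> M" "q = next_point p"
    have step: "conn X (orb cut_rot) z (cut_rot z)" if "z \<in> X" for z
      using that bij_betw_apply[OF bij] by (intro conn_step) auto
    have "conn X (orb cut_rot) p (next_point p)"
    proof (rule next_point_induct[OF pq(1)])
      show "conn X (orb cut_rot) p (rot D p)"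
        using step[of p] pq MX phi_opp by (auto simp: partial_map_def)
      show "conn X (orb cut_rot) p (\<phi> z)" if "z \<in> X" "z \<notin> M" "conn X (orb cut_rot) p z" for z
        using step[of z] that by (auto simp: partial_map_def intro: conn_trans)
    qed
    then show "conn X (orb cut_rot) p q" using pq by simp
  qed
  moreover have "unmarked_classes M X (orb cut_rot) \<subseteq> unmarked_classes M X (orb \<phi>)"
  proof
    fix C assume C: "C \<in> unmarked_classes M X (orb cut_rot)"
    then have cg: "C \<in> classes_generated X (orb cut_rot)" by (simp add: unmarked_classes_def)
    then obtain x where x: "x \<in> C" "x \<in> X" using class_nonempty[OF cg] class_subset[OF cg] by blast
    have CM: "C \<inter> M = {}" using C by (simp add: unmarked_classes_def)
    have C_eq: "C = cls X (orb cut_rot) x" by (rule class_eq_cls[OF cg x(1)])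
    have step: "a \<in> C \<longleftrightarrow> cut_rot a \<in> C" if "a \<in> X" for a
    proof -
      have "conn X (orb cut_rot) a (cut_rot a)" "cut_rot a \<in> X"
        using that bij_betw_apply[OF bij] by (auto intro: conn_step)
      then show ?thesis using that unfolding C_eq in_cls by (auto intro: conn_trans conn_sym)
    qed
    have "conn X (orb cut_rot) x y \<longleftrightarrow> conn X (orb \<phi>) x y" if y: "y \<in> X" for y
    proof
      assume "conn X (orb cut_rot) x y"
      then have "(x \<in> C \<and> conn X (orb \<phi>) x x) = (y \<in> C \<and> conn X (orb \<phi>) x y)"
      proof (rule conn_inv[where P = "\<lambda>y. y \<in> C \<and> conn X (orb \<phi>) x y"])
        fix a b assume ab: "a \<in> X" "b \<in> X" "b = cut_rot a"
        show "(a \<in> C \<and> conn X (orb \<phi>) x a) = (b \<in> C \<and> conn X (orb \<phi>) x b)"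
        proof (cases "a \<in> C")
          case True
          then have "b = \<phi> a" using ab CM by (auto simp: partial_map_def)
          then have "conn X (orb \<phi>) a b" using ab by (intro conn_step) auto
          then show ?thesis using step[OF ab(1)] ab(3) by (blast intro: conn_trans conn_sym)
        qed (use step[OF ab(1)] ab in simp)
      qed
      then show "conn X (orb \<phi>) x y" using x by simp
    next
      assume "conn X (orb \<phi>) x y"
      then have "x \<in> C \<longleftrightarrow> y \<in> C"
      proof (rule conn_inv[where P = "\<lambda>y. y \<in> C"])
        fix a b assume ab: "a \<in> X" "b \<in> X" "b = \<phi> a"
        show "a \<in> C \<longleftrightarrow> b \<in> C"
        proof (cases "a \<in> M")
          case False
          then show ?thesis using step[OF ab(1)] ab by (simp add: partial_map_def)
        next
          case True
          then have "opp D a \<in> M" "cut_rot (opp D a) = b"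
            using ab opp_in_M opp_opp by (auto simp: partial_map_def)
          then show ?thesis using True CM step[of "opp D a"] MX by auto
        qed
      qed
      then show "conn X (orb cut_rot) x y" using x by (simp add: C_eq in_cls)
    qed
    then have "C = cls X (orb \<phi>) x" by (auto simp: C_eq in_cls)
    then show "C \<in> unmarked_classes M X (orb \<phi>)"
      using CM x by (simp add: unmarked_classes_def classes_generated_eq)
  qed
  ultimately show ?thesis
    using card_mono[OF finite_unmarked_classes[OF finX]] by (meson add_le_mono1 le_trans)
qed

text \<open>Faces of \<open>D\<close> that avoid \<open>M\<close> are isolated vertices of the
  restricted dual map. For the other components it has to be shown that paths through unmarked darts
  connect no more marked points than paths within \<open>M\<close>.\<close>

lemma cut_components_ge:
  "card (unmarked_classes M X (orb \<phi>)) + ncl M (\<lambda>x y. y = next_point x \<or> y = opp D x)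
    \<le> ncl X (\<lambda>x y. y = \<phi> x \<or> y = partial_map (opp D) M x)"
  (is "_ + ncl M ?s \<le> ncl X ?r")
proof -
  have "unmarked_classes M X (orb \<phi>) \<subseteq> unmarked_classes M X ?r"
  proof
    fix C assume C: "C \<in> unmarked_classes M X (orb \<phi>)"
    then have cg: "C \<in> classes_generated X (orb \<phi>)" by (simp add: unmarked_classes_def)
    then obtain x where x: "x \<in> C" "x \<in> X" using class_nonempty[OF cg] class_subset[OF cg] by blast
    have CM: "C \<inter> M = {}" using C by (simp add: unmarked_classes_def)
    have C_eq: "C = cls X (orb \<phi>) x" by (rule class_eq_cls[OF cg x(1)])
    have "conn X (orb \<phi>) x y \<longleftrightarrow> conn X ?r x y" if y: "y \<in> X" for y
    proof
      assume "conn X (orb \<phi>) x y"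
      then show "conn X ?r x y" by (rule conn_mono) (auto intro: conn_step)
    next
      assume "conn X ?r x y"
      then have "x \<in> C \<longleftrightarrow> y \<in> C"
      proof (rule conn_inv[where P = "\<lambda>y. y \<in> C"])
        fix a b assume ab: "a \<in> X" "b \<in> X" "b = \<phi> a \<or> b = partial_map (opp D) M a"
        show "a \<in> C \<longleftrightarrow> b \<in> C"
        proof (cases "b = \<phi> a")
          case True
          then have "conn X (orb \<phi>) a b" using ab by (intro conn_step)
          then show ?thesis using ab unfolding C_eq in_cls by (blast intro: conn_trans conn_sym)
        next
          case False
          then show ?thesis using ab CM opp_in_M[of a] by (auto simp: partial_map_def split: if_splits)
        qed
      qed
      then show "conn X (orb \<phi>) x y" using x by (simp add: C_eq in_cls)
    qed
    then have "C = cls X ?r x" by (auto simp: C_eq in_cls)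
    then show "C \<in> unmarked_classes M X ?r"
      using CM x by (simp add: unmarked_classes_def classes_generated_eq)
  qed
  then have "card (unmarked_classes M X (orb \<phi>)) \<le> card (unmarked_classes M X ?r)"
    by (rule card_mono[OF finite_unmarked_classes[OF finX]])
  moreover have "card (unmarked_classes M X ?r) + ncl M ?s \<le> ncl X ?r"
  proof (rule ncl_marked_ge[OF finX MX])
    fix p q assume pq: "p \<in> M" "q \<in> M" "conn X ?r p q"
    \<comment> \<open>This extends the classes on \<open>M\<close> to all darts: \<open>x\<close>
      receives the class of the first marked dart that is met from \<open>x\<close> on along
      \<open>\<phi>\<close>, with \<open>x\<close> included, and the empty set if there is
      none.\<close>
    let ?P = "\<lambda>x. {q \<in> M. \<exists>n. (\<phi> ^^ n) x \<in> M \<and> (\<forall>i<n. (\<phi> ^^ i) x \<notin> M) \<and> conn M ?s ((\<phi> ^^ n) x) q}"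
    have PM: "?P a = cls M ?s a" if "a \<in> M" for a
    proof -
      have "((\<phi> ^^ n) a \<in> M \<and> (\<forall>i<n. (\<phi> ^^ i) a \<notin> M) \<and> conn M ?s ((\<phi> ^^ n) a) q) \<longleftrightarrow> n = 0 \<and> conn M ?s a q" for n q
        using that by (cases n) auto
      then show ?thesis by (simp add: cls_def)
    qed
    have P_phi: "?P a = ?P (\<phi> a)" if a: "a \<in> X" for a
    proof (cases "a \<in> M")
      case False
      have "((\<phi> ^^ n) a \<in> M \<and> (\<forall>i<n. (\<phi> ^^ i) a \<notin> M) \<and> conn M ?s ((\<phi> ^^ n) a) q) \<longleftrightarrow>
        (\<exists>m. n = Suc m \<and> (\<phi> ^^ m) (\<phi> a) \<in> M \<and> (\<forall>i<m. (\<phi> ^^ i) (\<phi> a) \<notin> M) \<and> conn M ?s ((\<phi> ^^ m) (\<phi> a)) q)" for n q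
        using False by (cases n) (auto simp: funpow_swap1 All_less_Suc2)
      then show ?thesis by auto
    next
      case True
      have oa: "opp D a \<in> M" "first_return \<phi> M a = next_point (opp D a)"
        using True a opp_opp opp_in_M by (simp_all add: next_point_def)
      have "conn M ?s a (opp D a)" using True oa by (intro conn_step) auto
      also have "conn M ?s (opp D a) (first_return \<phi> M a)"
        using oa next_point_in by (intro conn_step) auto
      finally have "conn M ?s a (first_return \<phi> M a)" .
      then have eq: "cls M ?s a = cls M ?s (first_return \<phi> M a)"
        using True first_return_in[OF finX bij_phi MX True] by (simp add: cls_eq_iff)
      have "?P (\<phi> a) = cls M ?s (first_return \<phi> M a)"
      proof (intro equalityI subsetI)
        fix q assume "q \<in> ?P (\<phi> a)"
        then obtain n where n: "q \<in> M" "(\<phi> ^^ n) (\<phi> a) \<in> M" "\<forall>i<n. (\<phi> ^^ i) (\<phi> a) \<notin> M" "conn M ?s ((\<phi> ^^ n) (\<phi> a)) q"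
          by blast
        have "first_return \<phi> M a = (\<phi> ^^ Suc n) a"
        proof (rule first_return_eqI)
          fix i assume i: "0 < i" "i < Suc n"
          then obtain j where "i = Suc j" "j < n" by (cases i) auto
          then show "(\<phi> ^^ i) a \<notin> M" using n(3) by (simp add: funpow_swap1)
        qed (use n in \<open>auto simp: funpow_swap1\<close>)
        then show "q \<in> cls M ?s (first_return \<phi> M a)" using n by (simp add: in_cls funpow_swap1)
      next
        fix q assume q: "q \<in> cls M ?s (first_return \<phi> M a)"
        obtain n where n: "n > 0" "first_return \<phi> M a = (\<phi> ^^ n) a" "(\<phi> ^^ n) a \<in> M"
          "\<And>i. 0 < i \<Longrightarrow> i < n \<Longrightarrow> (\<phi> ^^ i) a \<notin> M"
          using first_returnE[OF finX bij_phi MX True] by metis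
        obtain m where m: "n = Suc m" using n(1) by (cases n) auto
        have "(\<phi> ^^ i) (\<phi> a) \<notin> M" if "i < m" for i
          using n(4)[of "Suc i"] m that by (simp add: funpow_swap1)
        moreover have "(\<phi> ^^ m) (\<phi> a) = first_return \<phi> M a" using n m by (simp add: funpow_swap1)
        ultimately show "q \<in> ?P (\<phi> a)" using q n by (auto simp: in_cls intro!: exI[of _ m])
      qed
      then show ?thesis using PM[OF True] eq by simp
    qed
    have "?P p = ?P q"
      using pq(3)
    proof (rule conn_inv[where P = ?P])
      fix a b assume ab: "a \<in> X" "b \<in> X" "b = \<phi> a \<or> b = partial_map (opp D) M a"
      consider "b = \<phi> a" | "a = b" | "a \<in> M" "b = opp D a"
        using ab by (auto simp: partial_map_def split: if_splits)
      then show "?P a = ?P b"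
      proof cases
        case 1
        then show ?thesis using P_phi[OF ab(1)] by simp
      next
        case 3
        then have "b \<in> M" using opp_in_M ab by simp
        then have "conn M ?s a b" using 3 by (intro conn_step) auto
        then have "cls M ?s a = cls M ?s b" using 3 \<open>b \<in> M\<close> by (simp add: cls_eq_iff)
        then show ?thesis using PM[of a] PM[of b] 3 \<open>b \<in> M\<close> by simp
      qed simp
    qed
    then have "cls M ?s p = cls M ?s q" using PM[of p] PM[of q] pq(1,2) by simp
    then show "conn M ?s p q" using pq by (simp add: cls_eq_iff)
  qed
  ultimately show ?thesis by linarith
qed

text \<open>Let \<open>F\<close> be the number of faces of \<open>D\<close>, \<open>u\<close> of
  them unmarked, \<open>V\<close> the number of curves, and \<open>K\<close> the number of
  components on \<open>M\<close>. Monotonicity of the genus in the dual map gives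
  \<open>2 K + card M / 2 - V \<le> F - u\<close>. On the other hand \<open>F\<close> is twice the
  Turaev genus plus the number of state curves, and at most \<open>u\<close> of these are
  unmarked.\<close>

lemma genus_bound:
  "2 * real (ncl M (\<lambda>x y. y = next_point x \<or> y = opp D x)) + real (card M) / 2
    \<le> 2 * turaev_genus D + real (ncl M (orb next_point))
      + real (ncl M (curve_state False)) + real (ncl M (curve_state True))"
proof -
  have k: "ncl X (\<lambda>x y. y = \<phi> x \<or> y = opp D x) = ncl X (\<lambda>x y. y = rot D x \<or> y = opp D x)"
  proof (rule arg_cong[where f = card], rule classes_generated_cong, rule iffI; erule conn_mono)
    fix a b assume ab: "a \<in> X" "b \<in> X" "b = \<phi> a \<or> b = opp D a"
    let ?r = "\<lambda>x y. y = rot D x \<or> y = opp D x"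
    have "conn X ?r a (opp D a)" "conn X ?r (opp D a) (\<phi> a)"
      unfolding face_succ_def using ab opp_in rot_in by (auto intro!: conn_step)
    then show "conn X ?r a b" using ab by (auto intro: conn_trans)
  next
    fix a b assume ab: "a \<in> X" "b \<in> X" "b = rot D a \<or> b = opp D a"
    let ?r = "\<lambda>x y. y = \<phi> x \<or> y = opp D x"
    have "conn X ?r a (opp D a)" "conn X ?r (opp D a) (rot D a)"
      using ab opp_in rot_in phi_opp by (auto intro!: conn_step)
    then show "conn X ?r a b" using ab by (auto intro: conn_trans)
  qed
  have rot: "classes_generated X (orb (\<lambda>x. \<phi> (opp D x))) = classes_generated X (orb (rot D))"
    by (rule classes_generated_cong, subst conn_cong[of X]) (simp_all add: phi_opp)
  have "F.defect M \<le> F.defect X"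
    using MX by (intro F.defect_mono edge_closed_M F.edge_closed_all)
  also have "F.defect X = 2 * int (ncl X (\<lambda>x y. y = rot D x \<or> y = opp D x))
      - int (ncl X (orb (opp D))) - int (ncl X (orb (rot D)))"
    by (simp add: F.defect_def F.classes_partial_map_all k rot)
  finally have "2 * int (ncl X (\<lambda>x y. y = \<phi> x \<or> y = partial_map (opp D) M x))
      - int (ncl X (orb (partial_map (opp D) M))) - int (ncl X (orb cut_rot))
    \<le> int (ncl X (orb \<phi>)) - int (card X)"
    using planarity unfolding F.defect_def by linarith
  then show ?thesis
    using F.ncl_partial_map[OF edge_closed_M] cut_components_ge ncl_cut_rot_le
      card_unmarked_states ncl_state_le[of False] ncl_state_le[of True] turaev_genus_eq
    by linarith
qed

end

section \<open>Graphs that consist of doubled vertices outside a small set\<close>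

text \<open>Without loops, the four edges form either two pairs, and the vertex is interior to a
  doubled path of length two, or a single bundle to one neighbour.\<close>

definition doubled_vertex :: "('v, 'e) multigraph \<Rightarrow> 'v \<Rightarrow> bool" where
  "doubled_vertex G v \<longleftrightarrow> degree G v = 4 \<and>
    (\<forall>e\<in>edges G. v \<in> ends G e \<longrightarrow> (\<exists>e'\<in>edges G. e' \<noteq> e \<and> ends G e' = ends G e))"

text \<open>The property that contraction preserves. The exceptional set \<open>W\<close> has to
  meet every component, since otherwise the number of closed chains of doubled vertices would be
  unbounded.\<close>

definition doubled_outside :: "('v, 'e) multigraph \<Rightarrow> 'v set \<Rightarrow> nat \<Rightarrow> bool" where
  "doubled_outside G W N \<longleftrightarrow> multigraph G \<and> (\<forall>e\<in>edges G. card (ends G e) = 2) \<and> W \<subseteq> verts G \<and>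
    (\<forall>v\<in>verts G - W. doubled_vertex G v) \<and> (\<forall>v\<in>verts G. \<exists>w\<in>W. reachable G w v) \<and>
    card W \<le> N \<and> (\<Sum>w\<in>W. degree G w) \<le> N"

definition cut :: "('v, 'e) multigraph \<Rightarrow> 'v set \<Rightarrow> 'e set" where
  "cut G S = {e \<in> edges G. ends G e \<inter> S \<noteq> {} \<and> \<not> ends G e \<subseteq> S}"

lemma reachable_step:
  assumes "reachable G u v" "e \<in> edges G" "ends G e = {v, w}"
  shows "reachable G u w"
  using assms(1) unfolding reachable_def
  by (rule rtranclp.rtrancl_into_rtrancl) (use assms(2,3) in blast)

section \<open>The map carried by an alternating decomposition graph\<close>

text \<open>The factor \<open>K\<close> bounds the ratio of the size of a class to its excess over
  \<open>m\<close>, and the right-hand side is \<open>K\<close> times the total excess.\<close>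

lemma card_atypical_le:
  assumes "finite X" "\<And>x. x \<in> X \<Longrightarrow> m \<le> card (cls X r x)"
    and "\<And>c. m < c \<Longrightarrow> int c \<le> K * (int c - int m)"
  shows "int (card {x \<in> X. card (cls X r x) \<noteq> m}) \<le> K * (int (card X) - int m * int (ncl X r))"
proof -
  let ?R = "classes_generated X r" and ?B = "{C \<in> classes_generated X r. card C \<noteq> m}"
  have fin: "finite ?R" using assms(1) by (rule finite_classes_generated)
  have "{x \<in> X. card (cls X r x) \<noteq> m} = \<Union> ?B"
  proof (intro equalityI subsetI)
    fix x assume x: "x \<in> {x \<in> X. card (cls X r x) \<noteq> m}"
    then have "cls X r x \<in> ?B" "x \<in> cls X r x" by (auto simp: classes_generated_eq cls_self)
    then show "x \<in> \<Union> ?B" by blast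
  next
    fix x assume "x \<in> \<Union> ?B"
    then obtain C where C: "C \<in> ?R" "card C \<noteq> m" "x \<in> C" by blast
    then show "x \<in> {x \<in> X. card (cls X r x) \<noteq> m}"
      using class_eq_cls[OF C(1,3)] class_subset[OF C(1)] by auto
  qed
  then have "card {x \<in> X. card (cls X r x) \<noteq> m} \<le> (\<Sum>C\<in>?B. card C)"
    using card_Union_le_sum_card[of ?B] by simp
  then have "int (card {x \<in> X. card (cls X r x) \<noteq> m}) \<le> (\<Sum>C\<in>?B. int (card C))"
    unfolding of_nat_sum[symmetric] by (rule of_nat_mono)
  also have "\<dots> = (\<Sum>C\<in>?R. if card C \<noteq> m then int (card C) else 0)"
    using fin by (simp add: sum.If_cases Int_def)
  also have "\<dots> \<le> (\<Sum>C\<in>?R. K * (int (card C) - int m))"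
  proof (rule sum_mono)
    fix C assume "C \<in> ?R"
    then have "m \<le> card C" using assms(2) by (auto simp: classes_generated_eq)
    then show "(if card C \<noteq> m then int (card C) else 0) \<le> K * (int (card C) - int m)"
      using assms(3)[of "card C"] by auto
  qed
  also have "\<dots> = K * (int (\<Sum>C\<in>?R. card C) - int m * int (card ?R))"
    by (simp add: sum_distrib_left[symmetric] sum_subtractf mult.commute)
  finally show ?thesis using sum_card_classes_generated[OF assms(1), of r] by simp
qed

text \<open>What remains of the diagram: the rotation system of \<open>G\<close> on the darts of the
  non-alternating edges, with signs. Planarity of the diagram is kept only through
  \<open>cut_function\<close> and \<open>genus_bound\<close>. Connectivity is stated for cuts
  because \<open>G\<close> may be disconnected.\<close>

locale signed_map = combinatorial_map M \<sigma> \<alpha>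
  for M :: "'d set" and \<sigma> \<alpha> +
  fixes s :: "'d \<Rightarrow> bool" and G :: "('v, 'e) multigraph" and vt :: "'d \<Rightarrow> 'v" and ed :: "'d \<Rightarrow> 'e"
    and g :: nat
  assumes sign_inv: "p \<in> M \<Longrightarrow> s (\<alpha> p) = s p"
    and sign_rot: "p \<in> M \<Longrightarrow> s (\<sigma> p) \<longleftrightarrow> \<not> s p"
    and cut_function: "\<lbrakk>C \<subseteq> M; \<And>p. p \<in> M \<Longrightarrow> \<alpha> p \<in> C \<longleftrightarrow> p \<in> C;
        \<And>p. p \<in> M \<Longrightarrow> s p = b \<Longrightarrow> \<sigma> p \<in> C \<longleftrightarrow> p \<in> C\<rbrakk>
      \<Longrightarrow> \<exists>h :: 'd \<Rightarrow> bool. (\<forall>p\<in>M. h (\<sigma> p) = h p) \<and> (\<forall>p\<in>M. (h (\<alpha> p) \<noteq> h p) \<longleftrightarrow> p \<in> C)"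
    and genus_bound: "2 * real (ncl M (\<lambda>x y. y = \<sigma> x \<or> y = \<alpha> x)) + real (card M) / 2
      \<le> 2 * real g + real (ncl M (orb \<sigma>))
        + real (ncl M (\<lambda>x y. y = \<alpha> x \<or> s x = False \<and> y = \<sigma> x))
        + real (ncl M (\<lambda>x y. y = \<alpha> x \<or> s x = True \<and> y = \<sigma> x))"
    and verts_eq: "verts G = vt ` M"
    and edges_eq: "edges G = ed ` M"
    and vt_eq: "p \<in> M \<Longrightarrow> q \<in> M \<Longrightarrow> vt p = vt q \<longleftrightarrow> conn M (orb \<sigma>) p q"
    and ed_eq: "p \<in> M \<Longrightarrow> q \<in> M \<Longrightarrow> ed p = ed q \<longleftrightarrow> q = p \<or> q = \<alpha> p"
    and ends_ed: "p \<in> M \<Longrightarrow> ends G (ed p) = {vt p, vt (\<alpha> p)}"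
    and three_edge_connected: "cut G S \<noteq> {} \<Longrightarrow> 3 \<le> card (cut G S)"
begin

abbreviation alt :: "bool \<Rightarrow> 'd \<Rightarrow> 'd \<Rightarrow> bool" where
  "alt b \<equiv> \<lambda>x y. y = \<alpha> x \<or> s x = b \<and> y = \<sigma> x"

lemma vt_rot: "p \<in> M \<Longrightarrow> vt (\<sigma> p) = vt p"
  using vt_eq[of p "\<sigma> p"] sigma_in[of p] conn_step[of p M "\<sigma> p" "orb \<sigma>"] by simp

text \<open>The set of all darts satisfies the conditions on \<open>C\<close>, so the set of all
  edges is a cut.\<close>

lemma bipartition: "\<exists>h :: 'd \<Rightarrow> bool. (\<forall>p\<in>M. h (\<sigma> p) = h p) \<and> (\<forall>p\<in>M. h (\<alpha> p) \<noteq> h p)"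
  using cut_function[of M True] inv_in sigma_in by simp

lemma vt_const:
  assumes "\<forall>p\<in>M. h (\<sigma> p) = h p" "p \<in> M" "q \<in> M" "vt p = vt q"
  shows "h p = h q"
proof -
  have "conn M (orb \<sigma>) p q" using assms vt_eq by blast
  then show ?thesis by (rule conn_inv) (use assms(1) in auto)
qed

lemma vt_inv:
  assumes "p \<in> M"
  shows "vt (\<alpha> p) \<noteq> vt p"
proof
  obtain h :: "'d \<Rightarrow> bool" where h: "\<forall>p\<in>M. h (\<sigma> p) = h p" "\<forall>p\<in>M. h (\<alpha> p) \<noteq> h p"
    using bipartition by blast
  assume "vt (\<alpha> p) = vt p"
  then show False using vt_const[OF h(1), of "\<alpha> p" p] h(2) assms inv_in by blast
qed

lemma ed_inv: "p \<in> M \<Longrightarrow> ed (\<alpha> p) = ed p"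
  using ed_eq[of p "\<alpha> p"] inv_in by simp

lemma card_ed_image:
  assumes "edge_closed C"
  shows "2 * card (ed ` C) = card C"
proof -
  have CM: "C \<subseteq> M" "\<And>p. p \<in> C \<Longrightarrow> \<alpha> p \<in> C" using assms by (auto simp: edge_closed_def)
  then have fC: "finite C" using fin by (auto intro: finite_subset)
  have "card C = (\<Sum>p\<in>C. 1)" by simp
  also have "\<dots> = (\<Sum>e\<in>ed ` C. \<Sum>p\<in>{p \<in> C. ed p = e}. 1)" using fC by (rule sum.image_gen)
  also have "\<dots> = (\<Sum>e\<in>ed ` C. 2)"
  proof (rule sum.cong[OF refl])
    fix e assume "e \<in> ed ` C"
    then obtain p where p: "p \<in> C" "e = ed p" by blast
    have "ed q = e \<longleftrightarrow> q = p \<or> q = \<alpha> p" if "q \<in> C" for q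
    proof -
      have "p \<in> M" "q \<in> M" using p that CM by auto
      then show ?thesis using ed_eq[of p q] p(2) by (simp add: eq_commute[of "ed q"])
    qed
    then have "{q \<in> C. ed q = e} = {p, \<alpha> p}" using p CM by auto
    moreover have "\<alpha> p \<noteq> p" using p CM inv_neq by blast
    ultimately show "(\<Sum>p\<in>{p \<in> C. ed p = e}. 1) = (2::nat)" by simp
  qed
  finally show ?thesis by simp
qed

lemma even_card_edge_closed:
  assumes "edge_closed C"
  shows "even (card C)"
  using card_ed_image[OF assms] by presburger

section \<open>Lower bounds for degrees and cycle lengths\<close>

abbreviation orbit :: "'d \<Rightarrow> 'd set" where
  "orbit \<equiv> cls M (orb \<sigma>)"

lemma orbit_eq: "p \<in> M \<Longrightarrow> orbit p = {q \<in> M. vt q = vt p}"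
  using vt_eq by (auto simp: cls_def intro: conn_sym)

lemma inj_on_ed_orbit:
  assumes "p \<in> M"
  shows "inj_on ed (orbit p)"
proof (rule inj_onI)
  fix x y assume "x \<in> orbit p" "y \<in> orbit p" "ed x = ed y"
  then have xy: "x \<in> M" "y \<in> M" "vt x = vt p" "vt y = vt p" "y = x \<or> y = \<alpha> x"
    using ed_eq[of x y] assms by (auto simp: orbit_eq)
  then show "x = y" using vt_inv[of x] by auto
qed

lemma edges_at:
  assumes "p \<in> M"
  shows "{e \<in> edges G. vt p \<in> ends G e} = ed ` orbit p"
proof (intro equalityI subsetI)
  fix e assume "e \<in> {e \<in> edges G. vt p \<in> ends G e}"
  then obtain q where q: "q \<in> M" "e = ed q" "vt p \<in> ends G (ed q)" by (auto simp: edges_eq)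
  then consider "vt q = vt p" | "vt (\<alpha> q) = vt p" by (auto simp: ends_ed)
  then show "e \<in> ed ` orbit p"
  proof cases
    case 2
    then have "\<alpha> q \<in> orbit p" "e = ed (\<alpha> q)" using q assms inv_in ed_inv by (auto simp: orbit_eq)
    then show ?thesis by blast
  qed (use q assms in \<open>auto simp: orbit_eq\<close>)
next
  fix e assume "e \<in> ed ` orbit p"
  then obtain q where "q \<in> M" "vt q = vt p" "e = ed q" using assms by (auto simp: orbit_eq)
  then show "e \<in> {e \<in> edges G. vt p \<in> ends G e}" by (auto simp: edges_eq ends_ed)
qed

lemma degree_eq:
  assumes "p \<in> M"
  shows "degree G (vt p) = card (orbit p)"
proof -
  have no: "{e \<in> edges G. ends G e = {vt p}} = {}"
  proof -
    have "ends G (ed q) \<noteq> {vt p}" if "q \<in> M" for q using vt_inv[OF that] that by (auto simp: ends_ed)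
    then show ?thesis by (auto simp: edges_eq)
  qed
  show ?thesis
    unfolding degree_def no edges_at[OF assms] by (simp add: card_image[OF inj_on_ed_orbit[OF assms]])
qed

text \<open>The rotation matches the elements of \<open>C\<close> of sign \<open>b\<close> with
  those of the other sign.\<close>

lemma card_sign_classes:
  assumes "C \<subseteq> M" "\<And>p. p \<in> M \<Longrightarrow> s p = b \<Longrightarrow> \<sigma> p \<in> C \<longleftrightarrow> p \<in> C"
  shows "card C = 2 * card {p \<in> C. s p = b}"
proof -
  let ?P = "{p \<in> C. s p = b}" and ?N = "{p \<in> C. s p \<noteq> b}"
  have "bij_betw \<sigma> ?P ?N"
    unfolding bij_betw_def
  proof
    show "inj_on \<sigma> ?P" using bij assms(1) by (auto simp: bij_betw_def intro: inj_on_subset)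
    show "\<sigma> ` ?P = ?N"
    proof (intro equalityI subsetI)
      fix z assume "z \<in> \<sigma> ` ?P"
      then show "z \<in> ?N" using assms sign_rot by auto
    next
      fix z assume z: "z \<in> ?N"
      then have "z \<in> M" using assms(1) by auto
      then obtain y where y: "y \<in> M" "z = \<sigma> y" using bij by (metis bij_betw_imp_surj_on imageE)
      then have "y \<in> ?P" using z sign_rot assms(2)[of y] by auto
      then show "z \<in> \<sigma> ` ?P" using y by blast
    qed
  qed
  then have eq: "card ?P = card ?N" by (rule bij_betw_same_card)
  have fC: "finite C" using assms(1) fin by (rule finite_subset)
  have "C = ?P \<union> ?N" "?P \<inter> ?N = {}" by auto
  moreover have "finite ?P" "finite ?N" using fC by (rule rev_finite_subset, blast)+
  ultimately have "card C = card ?P + card ?N" using card_Un_disjoint[of ?P ?N] by simp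
  then show ?thesis using eq by simp
qed

text \<open>The edges at a vertex form a cut, so there are at least three; signs alternate around
  the vertex, so their number is even.\<close>

lemma card_orbit_ge:
  assumes p: "p \<in> M"
  shows "4 \<le> card (orbit p)"
proof -
  have "cut G {vt p} = {e \<in> edges G. vt p \<in> ends G e}"
  proof -
    have "\<not> ends G e \<subseteq> {vt p}" if e: "e \<in> edges G" for e
    proof -
      obtain q where "q \<in> M" "e = ed q" using e by (auto simp: edges_eq)
      then show ?thesis using vt_inv[of q] by (auto simp: ends_ed)
    qed
    then show ?thesis by (auto simp: cut_def)
  qed
  then have c: "cut G {vt p} = ed ` orbit p" using edges_at[OF p] by simp
  moreover have "p \<in> orbit p" using p by (rule cls_self)
  ultimately have "3 \<le> card (ed ` orbit p)" using three_edge_connected[of "{vt p}"] by auto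
  then have "3 \<le> card (orbit p)" using card_image[OF inj_on_ed_orbit[OF p]] by simp
  moreover have "card (orbit p) = 2 * card {q \<in> orbit p. s q = True}"
    using p vt_rot sigma_in by (intro card_sign_classes) (auto simp: orbit_eq)
  ultimately show ?thesis by presburger
qed

lemma alt_closed:
  assumes "p \<in> M"
  shows "edge_closed (cls M (alt b) p)"
    and "q \<in> M \<Longrightarrow> \<alpha> q \<in> cls M (alt b) p \<longleftrightarrow> q \<in> cls M (alt b) p"
    and "q \<in> M \<Longrightarrow> s q = b \<Longrightarrow> \<sigma> q \<in> cls M (alt b) p \<longleftrightarrow> q \<in> cls M (alt b) p"
proof -
  have *: "y \<in> cls M (alt b) p \<longleftrightarrow> x \<in> cls M (alt b) p" if "x \<in> M" "y \<in> M" "alt b x y" for x y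
  proof -
    have "conn M (alt b) x y" using that by (rule conn_step)
    then show ?thesis using that by (intro cls_step)
  qed
  show 1: "\<alpha> q \<in> cls M (alt b) p \<longleftrightarrow> q \<in> cls M (alt b) p" if "q \<in> M" for q
    using that inv_in by (intro *) auto
  show "\<sigma> q \<in> cls M (alt b) p \<longleftrightarrow> q \<in> cls M (alt b) p" if "q \<in> M" "s q = b" for q
    using that sigma_in by (intro *) auto
  show "edge_closed (cls M (alt b) p)"
    unfolding edge_closed_def using 1 cls_subset[of M "alt b" p] by blast
qed

lemma alt_cut_function:
  assumes "p \<in> M"
  obtains h :: "'d \<Rightarrow> bool" where "\<forall>q\<in>M. h (\<sigma> q) = h q" "\<forall>q\<in>M. (h (\<alpha> q) \<noteq> h q) \<longleftrightarrow> q \<in> cls M (alt b) p"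
proof -
  have "\<exists>h :: 'd \<Rightarrow> bool. (\<forall>q\<in>M. h (\<sigma> q) = h q) \<and> (\<forall>q\<in>M. (h (\<alpha> q) \<noteq> h q) \<longleftrightarrow> q \<in> cls M (alt b) p)"
    by (rule cut_function[of _ b]) (fact cls_subset alt_closed(2,3)[OF assms])+
  then show ?thesis using that by blast
qed

text \<open>Cycles are counted in darts, two for each edge. The cycle is a non-empty cut, so it has
  at least three edges. Half of its darts have sign \<open>b\<close>, and these come in pairs under
  \<open>\<alpha>\<close>; so the number of darts is divisible by four, which excludes three
  edges.\<close>

lemma card_alt_ge:
  assumes p: "p \<in> M"
  shows "8 \<le> card (cls M (alt b) p)"
proof -
  let ?C = "cls M (alt b) p"
  obtain h :: "'d \<Rightarrow> bool" where h: "\<forall>q\<in>M. h (\<sigma> q) = h q" "\<forall>q\<in>M. (h (\<alpha> q) \<noteq> h q) \<longleftrightarrow> q \<in> ?C"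
    using alt_cut_function[OF p] .
  let ?S = "vt ` {q \<in> M. h q}"
  have S: "vt q \<in> ?S \<longleftrightarrow> h q" if "q \<in> M" for q using that vt_const[OF h(1) that] by blast
  have "cut G ?S = ed ` ?C"
  proof (intro equalityI subsetI)
    fix e assume e: "e \<in> cut G ?S"
    then obtain q where q: "q \<in> M" "e = ed q" by (auto simp: cut_def edges_eq)
    then have "h (\<alpha> q) \<noteq> h q" using e S[OF q(1)] S[OF inv_in[OF q(1)]] by (auto simp: cut_def ends_ed)
    then show "e \<in> ed ` ?C" using h(2) q by blast
  next
    fix e assume "e \<in> ed ` ?C"
    then obtain q where q: "q \<in> M" "e = ed q" "h (\<alpha> q) \<noteq> h q" using h(2) cls_subset[of M "alt b" p] by blast
    then show "e \<in> cut G ?S" using S[OF q(1)] S[OF inv_in[OF q(1)]] by (auto simp: cut_def edges_eq ends_ed)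
  qed
  moreover have "p \<in> ?C" using p by (rule cls_self)
  ultimately have "3 \<le> card (ed ` ?C)" using three_edge_connected[of ?S] by auto
  moreover have "2 * card (ed ` ?C) = card ?C" by (rule card_ed_image[OF alt_closed(1)[OF p]])
  moreover have "card ?C = 2 * card {q \<in> ?C. s q = b}"
    using alt_closed(3)[OF p] by (intro card_sign_classes cls_subset)
  moreover have "even (card {q \<in> ?C. s q = b})"
    using alt_closed(1)[OF p] sign_inv by (intro even_card_edge_closed) (auto simp: edge_closed_def)
  ultimately show ?thesis by presburger
qed

section \<open>Atypical darts\<close>

definition bad :: "'d set" where
  "bad = {p \<in> M. card (orbit p) \<noteq> 4 \<or> card (cls M (alt False) p) \<noteq> 8 \<or> card (cls M (alt True) p) \<noteq> 8}"

lemma card_bad: "card bad \<le> 144 * g"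
  and num_components_le: "ncl M (\<lambda>x y. y = \<sigma> x \<or> y = \<alpha> x) \<le> g"
proof -
  let ?n = "int (card M)"
  let ?V = "?n - 4 * int (ncl M (orb \<sigma>))" and ?A = "\<lambda>b. ?n - 8 * int (ncl M (alt b))"
  \<comment> \<open>For cycles the factor 9 is the ratio of size to excess in a class of nine darts.
    Here 18 is twice 9, so that the three bounds add up to nine times
    \<open>2 * ?V + ?A False + ?A True\<close>, which is at most \<open>16 * int g\<close>; this is
    the origin of 144.\<close>
  have V: "int (card {p \<in> M. card (orbit p) \<noteq> 4}) \<le> 18 * ?V"
    using card_atypical_le[OF fin card_orbit_ge, of 18] by simp
  have A: "int (card {p \<in> M. card (cls M (alt b) p) \<noteq> 8}) \<le> 9 * ?A b" for b
    using card_atypical_le[OF fin card_alt_ge, of 9 b] by simp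
  have g: "16 * int (ncl M (\<lambda>x y. y = \<sigma> x \<or> y = \<alpha> x)) + 2 * ?V + ?A False + ?A True \<le> 16 * int g"
  proof -
    have "real (4 * ncl M (\<lambda>x y. y = \<sigma> x \<or> y = \<alpha> x) + card M)
        \<le> real (4 * g + 2 * ncl M (orb \<sigma>) + 2 * ncl M (alt False) + 2 * ncl M (alt True))"
      using genus_bound by simp
    then have "int (4 * ncl M (\<lambda>x y. y = \<sigma> x \<or> y = \<alpha> x) + card M)
        \<le> int (4 * g + 2 * ncl M (orb \<sigma>) + 2 * ncl M (alt False) + 2 * ncl M (alt True))"
      unfolding of_nat_le_iff .
    moreover have "16 * K + 2 * (n - 4 * V) + (n - 8 * A) + (n - 8 * B) \<le> 16 * G"
      if "4 * K + n \<le> 4 * G + 2 * V + 2 * A + 2 * B" for K n V A B G :: int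
      using that by simp
    ultimately show ?thesis unfolding of_nat_add of_nat_mult of_nat_numeral by blast
  qed
  have "card bad \<le> card {p \<in> M. card (orbit p) \<noteq> 4} + card {p \<in> M. card (cls M (alt False) p) \<noteq> 8}
      + card {p \<in> M. card (cls M (alt True) p) \<noteq> 8}"
  proof -
    have "bad = {p \<in> M. card (orbit p) \<noteq> 4} \<union> {p \<in> M. card (cls M (alt False) p) \<noteq> 8}
      \<union> {p \<in> M. card (cls M (alt True) p) \<noteq> 8}" unfolding bad_def by blast
    then show ?thesis by (metis (no_types, lifting) add_le_mono1 card_Un_le order_trans)
  qed
  moreover have "b \<le> 144 * g'" "K \<le> g'"
    if "b \<le> v + a1 + a2" "int v \<le> 18 * V" "int a1 \<le> 9 * A1" "int a2 \<le> 9 * A2"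
      "16 * int K + 2 * V + A1 + A2 \<le> 16 * int g'" for b v a1 a2 K g' :: nat and V A1 A2 :: int
    using that by linarith+
  ultimately show "card bad \<le> 144 * g" "ncl M (\<lambda>x y. y = \<sigma> x \<or> y = \<alpha> x) \<le> g"
    using V A[of False] A[of True] g by blast+
qed

text \<open>The step of \<open>alt b\<close> at a vertex as an involution: forwards from a dart of
  sign \<open>b\<close>, backwards from the others. A class of \<open>alt b\<close> is then a closed
  walk that alternates between \<open>\<alpha>\<close> and \<open>mate b\<close>.\<close>

definition mate :: "bool \<Rightarrow> 'd \<Rightarrow> 'd" where
  "mate b x = (if s x = b then \<sigma> x else the_inv_into M \<sigma> x)"

lemma mate_cases:
  assumes "x \<in> M"
  shows "mate b x \<in> M \<and> s (mate b x) = (\<not> s x) \<and> mate b (mate b x) = x \<and> vt (mate b x) = vt x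
    \<and> (if s x = b then mate b x = \<sigma> x else \<sigma> (mate b x) = x)"
proof (cases "s x = b")
  case True
  have inj: "inj_on \<sigma> M" using bij by (rule bij_betw_imp_inj_on)
  then show ?thesis
    using True assms sign_rot sigma_in vt_rot the_inv_into_f_f[OF inj assms] by (auto simp: mate_def)
next
  case False
  have inj: "inj_on \<sigma> M" "\<sigma> ` M = M" using bij by (auto simp: bij_betw_def)
  let ?y = "the_inv_into M \<sigma> x"
  have y: "?y \<in> M" "\<sigma> ?y = x"
    using inj assms f_the_inv_into_f[OF inj(1), of x] the_inv_into_into[OF inj(1), of x M] by auto
  then show ?thesis using False sign_rot[OF y(1)] vt_rot[OF y(1)] by (auto simp: mate_def)
qed

text \<open>If the two mates coincided, \<open>\<sigma>\<close> would interchange \<open>x\<close>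
  and its mate, and the vertex would have degree at most two.\<close>

lemma mate_neq:
  assumes "x \<in> M"
  shows "mate False x \<noteq> mate True x"
proof
  assume eq: "mate False x = mate True x"
  define y where "y = mate True x"
  have y: "y \<in> M" "\<sigma> x = y \<and> \<sigma> y = x"
    using mate_cases[OF assms, of True] mate_cases[OF assms, of False] eq unfolding y_def
    by (cases "s x"; simp)+
  have "orbit x \<subseteq> {x, y}"
  proof
    fix z assume "z \<in> orbit x"
    then have "conn M (orb \<sigma>) x z" by (simp add: in_cls)
    then have "x \<in> {x, y} \<longleftrightarrow> z \<in> {x, y}"
      by (rule closed_conn_orb[OF fin bij, rotated 2]) (use y assms in auto)
    then show "z \<in> {x, y}" by simp
  qed
  then have "card (orbit x) \<le> card {x, y}" by (intro card_mono) auto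
  also have "\<dots> \<le> 2" by (simp add: card_insert_if)
  finally show False using card_orbit_ge[OF assms] by simp
qed

text \<open>The walk \<open>t\<close> passes one edge of the cycle per step. Along it both the side
  \<open>h\<close> of the cut and the sign \<open>s\<close> change, whereas \<open>\<alpha>\<close>
  changes \<open>h\<close> alone; so no edge is passed in both directions. The class thus splits
  into the walk and its image under \<open>\<alpha>\<close>, of four darts each.\<close>

lemma alt_cycle:
  assumes p: "p \<in> M" and c8: "card (cls M (alt b) p) = 8"
  defines "t \<equiv> \<lambda>x. mate b (\<alpha> x)"
  shows "t (t (t (t p))) = p"
    and "cls M (alt b) p = {p, t p, t (t p), t (t (t p)), \<alpha> p, \<alpha> (t p), \<alpha> (t (t p)), \<alpha> (t (t (t p)))}"
proof -
  let ?C = "cls M (alt b) p"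
  have t_in: "t x \<in> M" if "x \<in> M" for x using that inv_in mate_cases[of "\<alpha> x" b] by (auto simp: t_def)
  have t_inv: "\<alpha> (mate b (t x)) = x" if "x \<in> M" for x
    using that inv_in mate_cases[of "\<alpha> x" b] inv_inv by (simp add: t_def)
  have bijt: "bij_betw t M M"
    by (rule bij_betw_byWitness[where f' = "\<lambda>x. \<alpha> (mate b x)"])
      (use t_in t_inv inv_in inv_inv mate_cases in \<open>auto simp: t_def\<close>)
  obtain m where m: "m > 0" "(t ^^ m) p = p" "cls M (orb t) p = (\<lambda>j. (t ^^ j) p) ` {..<m}"
    "inj_on (\<lambda>j. (t ^^ j) p) {..<m}"
    using orbitE[OF fin bijt p] .
  let ?O = "cls M (orb t) p"
  have t_conn: "conn M (orb t) x (t x)" if "x \<in> M" for x using that t_in by (intro conn_step) auto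
  have O_t: "t x \<in> ?O \<longleftrightarrow> x \<in> ?O" if "x \<in> M" for x
    using t_conn[OF that] t_in[OF that] that by (intro cls_step)
  have OM: "?O \<subseteq> M" by (rule cls_subset)
  have mate_C: "mate b x \<in> ?C \<longleftrightarrow> x \<in> ?C" if "x \<in> M" for x
    using mate_cases[OF that, of b] alt_closed(3)[OF p, of x b] alt_closed(3)[OF p, of "mate b x" b] that
    by (cases "s x = b") auto
  have C_t: "t x \<in> ?C \<longleftrightarrow> x \<in> ?C" if "x \<in> M" for x
    using that inv_in mate_C[of "\<alpha> x"] alt_closed(2)[OF p, of x b] by (simp add: t_def)
  have "?O \<subseteq> ?C"
  proof
    fix y assume "y \<in> ?O"
    then have "conn M (orb t) p y" by (simp add: in_cls)
    then have "p \<in> ?C \<longleftrightarrow> y \<in> ?C"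
      by (rule conn_inv[where P = "\<lambda>y. y \<in> ?C"]) (use C_t in auto)
    then show "y \<in> ?C" using cls_self[OF p] by blast
  qed
  then have sub: "?O \<union> \<alpha> ` ?O \<subseteq> ?C" using alt_closed(2)[OF p] OM by blast
  have mate_O: "mate b x \<in> ?O \<union> \<alpha> ` ?O" if x: "x \<in> ?O \<union> \<alpha> ` ?O" for x
    using x
  proof
    assume "x \<in> ?O"
    then have x: "x \<in> M" "x \<in> ?O" using OM by auto
    define y where "y = \<alpha> (mate b x)"
    have "y \<in> M" "t y = x" "mate b x = \<alpha> y"
      using x mate_cases[OF x(1), of b] inv_in inv_inv by (auto simp: y_def t_def)
    then show ?thesis using O_t[of y] x by auto
  next
    assume "x \<in> \<alpha> ` ?O"
    then obtain y where "y \<in> ?O" "x = \<alpha> y" by blast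
    then have "mate b x = t y" "y \<in> M" "y \<in> ?O" using OM by (auto simp: t_def)
    then show ?thesis using O_t[of y] by auto
  qed
  have inv_O: "\<alpha> x \<in> ?O \<union> \<alpha> ` ?O" if "x \<in> ?O \<union> \<alpha> ` ?O" for x
    using that OM inv_inv by auto
  have "?C \<subseteq> ?O \<union> \<alpha> ` ?O"
  proof
    fix y assume "y \<in> ?C"
    then have "conn M (alt b) p y" by (simp add: in_cls)
    then have "p \<in> ?O \<union> \<alpha> ` ?O \<longleftrightarrow> y \<in> ?O \<union> \<alpha> ` ?O"
    proof (rule conn_inv[where P = "\<lambda>y. y \<in> ?O \<union> \<alpha> ` ?O"])
      fix x y assume xy: "x \<in> M" "y \<in> M" "alt b x y"
      then have "y = \<alpha> x \<and> x = \<alpha> y \<or> y = mate b x \<and> x = mate b y"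
        using inv_inv mate_cases[of x b] by (cases "y = \<alpha> x") auto
      then show "x \<in> ?O \<union> \<alpha> ` ?O \<longleftrightarrow> y \<in> ?O \<union> \<alpha> ` ?O" using mate_O inv_O by metis
    qed
    then show "y \<in> ?O \<union> \<alpha> ` ?O" using cls_self[OF p, of "orb t"] by blast
  qed
  then have C_eq: "?C = ?O \<union> \<alpha> ` ?O" using sub by blast
  obtain h :: "'d \<Rightarrow> bool" where h: "\<forall>q\<in>M. h (\<sigma> q) = h q" "\<forall>q\<in>M. (h (\<alpha> q) \<noteq> h q) \<longleftrightarrow> q \<in> ?C"
    using alt_cut_function[OF p] .
  have h_mate: "h (mate b x) = h x" if "x \<in> M" for x
    using vt_const[OF h(1)] mate_cases[OF that, of b] that by blast
  have O_parity: "(h x = h p) = (s x = s p)" if "x \<in> ?O" for x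
  proof -
    have "conn M (orb t) p x" using that by (simp add: in_cls)
    then have "(p \<in> ?O \<longrightarrow> (h p = h p) = (s p = s p)) = (x \<in> ?O \<longrightarrow> (h x = h p) = (s x = s p))"
    proof (rule conn_inv[where P = "\<lambda>x. x \<in> ?O \<longrightarrow> (h x = h p) = (s x = s p)"])
      fix x y assume xy: "x \<in> M" "y \<in> M" "y = t x"
      show "(x \<in> ?O \<longrightarrow> (h x = h p) = (s x = s p)) = (y \<in> ?O \<longrightarrow> (h y = h p) = (s y = s p))"
      proof (cases "x \<in> ?O")
        case True
        then have "h y \<noteq> h x" "s y \<noteq> s x"
          using xy C_eq h(2) h_mate[of "\<alpha> x"] inv_in sign_inv mate_cases[of "\<alpha> x" b] by (auto simp: t_def)
        then show ?thesis using True O_t[OF xy(1)] xy by auto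
      qed (use O_t[OF xy(1)] xy in auto)
    qed
    then show ?thesis using that by simp
  qed
  have disj: "?O \<inter> \<alpha> ` ?O = {}"
  proof (intro equals0I)
    fix z assume "z \<in> ?O \<inter> \<alpha> ` ?O"
    then obtain x where x: "x \<in> ?O" "\<alpha> x \<in> ?O" by blast
    then have "x \<in> M" "h (\<alpha> x) \<noteq> h x" "s (\<alpha> x) = s x" using OM sub h(2) sign_inv by auto
    then show False using O_parity[OF x(1)] O_parity[OF x(2)] by auto
  qed
  have "inj_on \<alpha> ?O" by (rule inj_on_inverseI[of _ \<alpha>]) (use inv_inv OM in auto)
  then have "card (\<alpha> ` ?O) = card ?O" by (rule card_image)
  moreover have "finite ?O" using OM fin by (rule finite_subset)
  ultimately have "card ?C = 2 * card ?O" using C_eq disj by (simp add: card_Un_disjoint)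
  then have "card ?O = 4" using c8 by simp
  then have "m = 4" using m(3,4) by (simp add: card_image)
  then have O_eq: "?O = {p, t p, t (t p), t (t (t p))}"
    unfolding m(3) by (simp add: numeral_eq_Suc lessThan_Suc insert_commute)
  show "t (t (t (t p))) = p" using m(2) \<open>m = 4\<close> by (simp add: numeral_eq_Suc)
  show "?C = {p, t p, t (t p), t (t (t p)), \<alpha> p, \<alpha> (t p), \<alpha> (t (t p)), \<alpha> (t (t (t p)))}"
    unfolding C_eq O_eq by auto
qed

text \<open>The \<open>A\<close>-cycle and the \<open>B\<close>-cycle through an edge are closed walks and the former is a cut,
  so they share a second edge; since the graph is bipartite, this edge is adjacent to the first
  one on the \<open>B\<close>-cycle, which forces two vertices of the \<open>A\<close>-cycle to coincide.\<close>

lemma twin_edge: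
  assumes p: "p \<in> M" "p \<notin> bad"
  shows "\<exists>q\<in>M. ed q \<noteq> ed p \<and> vt q = vt (\<alpha> p) \<and> vt (\<alpha> q) = vt p"
proof -
  let ?A = "cls M (alt False) p" and ?B = "cls M (alt True) p"
  have c: "card ?A = 8" "card ?B = 8" using p by (auto simp: bad_def)
  define a where "a x = mate False (\<alpha> x)" for x
  define b where "b x = mate True (\<alpha> x)" for x
  note A = alt_cycle[OF p(1) c(1), folded a_def] and B = alt_cycle[OF p(1) c(2), folded b_def]
  obtain h :: "'d \<Rightarrow> bool" where h: "\<forall>q\<in>M. h (\<sigma> q) = h q" "\<forall>q\<in>M. (h (\<alpha> q) \<noteq> h q) \<longleftrightarrow> q \<in> ?A"
    using alt_cut_function[OF p(1)] .
  obtain k :: "'d \<Rightarrow> bool" where k: "\<forall>q\<in>M. k (\<sigma> q) = k q" "\<forall>q\<in>M. k (\<alpha> q) \<noteq> k q"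
    using bipartition by blast
  have step: "f x \<in> M \<and> vt (f x) = vt (\<alpha> x) \<and> s (f x) = (\<not> s x) \<and> k (f x) = (\<not> k x)
      \<and> h (f x) = h (\<alpha> x)" if "x \<in> M" "f = a \<or> f = b" for f x
  proof -
    have "\<alpha> x \<in> M" "s (\<alpha> x) = s x" "k (\<alpha> x) = (\<not> k x)" using that inv_in sign_inv k(2) by auto
    moreover have "\<exists>d. f x = mate d (\<alpha> x)" using that(2) a_def[of x] b_def[of x] by metis
    then obtain d where "f x = mate d (\<alpha> x)" by blast
    ultimately show ?thesis
      using mate_cases[of "\<alpha> x" d] vt_const[OF k(1), of "f x" "\<alpha> x"] vt_const[OF h(1), of "f x" "\<alpha> x"]
      by simp
  qed
  define a1 a2 a3 where "a1 = a p" and "a2 = a a1" and "a3 = a a2"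
  define b1 b2 b3 where "b1 = b p" and "b2 = b b1" and "b3 = b b2"
  have a1: "a1 \<in> M" "vt a1 = vt (\<alpha> p)" "s a1 = (\<not> s p)" "k a1 = (\<not> k p)" "h a1 = h (\<alpha> p)"
    using step[OF p(1), of a] by (simp_all add: a1_def)
  have a2: "a2 \<in> M" "vt a2 = vt (\<alpha> a1)" "s a2 = s p" "k a2 = k p" "h a2 = h (\<alpha> a1)"
    using step[OF a1(1), of a] a1 by (simp_all add: a2_def)
  have a3: "a3 \<in> M" "vt a3 = vt (\<alpha> a2)" "s a3 = (\<not> s p)" "k a3 = (\<not> k p)" "h a3 = h (\<alpha> a2)"
    using step[OF a2(1), of a] a2 by (simp_all add: a3_def)
  have a4: "a a3 = p" "vt (\<alpha> a3) = vt p" "h p = h (\<alpha> a3)"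
    using step[OF a3(1), of a] A(1) by (simp_all add: a1_def a2_def a3_def)
  have b1: "b1 \<in> M" "vt b1 = vt (\<alpha> p)" "s b1 = (\<not> s p)" "k b1 = (\<not> k p)" "h b1 = h (\<alpha> p)"
    using step[OF p(1), of b] by (simp_all add: b1_def)
  have b2: "b2 \<in> M" "vt b2 = vt (\<alpha> b1)" "s b2 = s p" "k b2 = k p" "h b2 = h (\<alpha> b1)"
    using step[OF b1(1), of b] b1 by (simp_all add: b2_def)
  have b3: "b3 \<in> M" "vt b3 = vt (\<alpha> b2)" "s b3 = (\<not> s p)" "k b3 = (\<not> k p)" "h b3 = h (\<alpha> b2)"
    using step[OF b2(1), of b] b2 by (simp_all add: b3_def)
  have b4: "b b3 = p" "vt (\<alpha> b3) = vt p" "h p = h (\<alpha> b3)"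
    using step[OF b3(1), of b] B(1) by (simp_all add: b1_def b2_def b3_def)
  have A_eq: "?A = {p, a1, a2, a3, \<alpha> p, \<alpha> a1, \<alpha> a2, \<alpha> a3}"
    using A(2) by (simp add: a1_def a2_def a3_def)
  have sk: "s (\<alpha> p) = s p" "s (\<alpha> a1) = s a1" "s (\<alpha> a2) = s a2" "s (\<alpha> a3) = s a3"
    "k (\<alpha> p) = (\<not> k p)" "k (\<alpha> a1) = (\<not> k a1)" "k (\<alpha> a2) = (\<not> k a2)" "k (\<alpha> a3) = (\<not> k a3)"
    using p(1) a1(1) a2(1) a3(1) sign_inv k(2) by auto
  \<comment> \<open>Each of the four combinations of sign \<open>s\<close> and colour
    \<open>k\<close> occurs at exactly two of the eight darts listed in \<open>A_eq\<close>;
    \<open>b1\<close> and \<open>b3\<close> carry the combination of \<open>a1\<close> and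
    \<open>a3\<close>.\<close>
  have odd: "x = a1 \<or> x = a3" if "x \<in> ?A" "s x = (\<not> s p)" "k x = (\<not> k p)" for x
  proof -
    have "x \<notin> {p, a2, \<alpha> p, \<alpha> a1, \<alpha> a2, \<alpha> a3}" using that(2,3) sk a1 a2 a3 by auto
    then show ?thesis using that(1) unfolding A_eq by blast
  qed
  have inA: "p \<in> ?A" "a1 \<in> ?A" "a2 \<in> ?A" "a3 \<in> ?A" unfolding A_eq by simp_all
  have hA: "h (\<alpha> p) \<noteq> h p" "h (\<alpha> a1) \<noteq> h a1" "h (\<alpha> a2) \<noteq> h a2" "h (\<alpha> a3) \<noteq> h a3"
    using inA h(2) p(1) a1(1) a2(1) a3(1) by blast+
  \<comment> \<open>On the A-cycle the colour \<open>k\<close> and the side \<open>h\<close> of the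
    cut change together. This will keep \<open>b2\<close>, the edge opposite to \<open>p\<close> on
    the B-cycle, off the A-cycle.\<close>
  have even: "h x = h p" if "x \<in> ?A" "k x = k p" for x
  proof -
    have "x \<notin> {a1, a3, \<alpha> p, \<alpha> a2}" using that(2) sk a1 a2 a3 by auto
    then have "x \<in> {p, a2, \<alpha> a1, \<alpha> a3}" using that(1) unfolding A_eq by blast
    then show ?thesis using hA a1 a2 a3 a4 by auto
  qed
  have twin: "\<exists>q\<in>M. ed q \<noteq> ed p \<and> vt q = vt (\<alpha> p) \<and> vt (\<alpha> q) = vt p"
    if "q \<in> M" "s q = (\<not> s p)" "vt q = vt (\<alpha> p)" "vt (\<alpha> q) = vt p" for q
    using that ed_eq[OF p(1) that(1)] sk(1) by metis
  consider "b1 \<in> ?A" | "b3 \<in> ?A" | "b1 \<notin> ?A" "b3 \<notin> ?A" by blast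
  then show ?thesis
  proof cases
    case 1
    \<comment> \<open>The dart \<open>b1\<close> starts at \<open>vt (\<alpha> p)\<close> and
      \<open>a3\<close> ends at \<open>vt p\<close>, so \<open>b1 = a3\<close> makes the edge of
      \<open>b1\<close> parallel to that of \<open>p\<close>.\<close>
    then have "b1 = a1 \<or> b1 = a3" using odd b1 by blast
    moreover have "b1 \<noteq> a1" using mate_neq[OF inv_in[OF p(1)]] by (simp add: a1_def b1_def a_def b_def)
    ultimately show ?thesis using twin[of b1] b1 a4 by blast
  next
    case 2
    then have "b3 = a1 \<or> b3 = a3" using odd b3 by blast
    moreover have "b3 \<noteq> a3"
      using mate_neq[OF inv_in[OF a3(1)]] a4(1) b4(1) by (auto simp: a_def b_def)
    ultimately show ?thesis using twin[of b3] b3 b4 a1 by metis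
  next
    \<comment> \<open>Going around the B-cycle, \<open>h\<close> changes at \<open>p\<close> and has
      to change back. Only \<open>b2\<close> is left for this, but then \<open>b2\<close> has the
      colour of \<open>p\<close> and lies on the other side of the cut, against
      \<open>even\<close>.\<close>
    case 3
    then have hb: "h (\<alpha> b1) = h b1" "h (\<alpha> b3) = h b3" using h(2) b1(1) b3(1) by blast+
    show ?thesis
    proof (cases "b2 \<in> ?A")
      case True
      then have "h b2 = h p" using even b2 by blast
      then show ?thesis using hb b1 b2 hA by auto
    next
      case False
      then have "h (\<alpha> b2) = h b2" using h(2) b2(1) by blast
      then show ?thesis using hb b1 b2 b3 b4 hA by auto
    qed
  qed
qed

lemma loopless: "e \<in> edges G \<Longrightarrow> card (ends G e) = 2"
  using vt_inv[THEN not_sym] by (auto simp: edges_eq ends_ed)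

lemma multigraph_G: "multigraph G"
  unfolding multigraph_def using fin loopless inv_in by (auto simp: verts_eq edges_eq ends_ed)

section \<open>Exceptional vertices\<close>

lemma doubled_vertex_good:
  assumes p: "p \<in> M" and good: "orbit p \<inter> bad = {}"
  shows "doubled_vertex G (vt p)"
  unfolding doubled_vertex_def
proof (intro conjI ballI impI)
  have "p \<notin> bad" using good cls_self[OF p] by blast
  then show "degree G (vt p) = 4" using p degree_eq[OF p] by (simp add: bad_def)
  fix e assume "e \<in> edges G" "vt p \<in> ends G e"
  then obtain q where q: "q \<in> orbit p" "e = ed q" using edges_at[OF p] by blast
  then have "q \<in> M" "q \<notin> bad" using good by (auto simp: in_cls)
  then obtain q' where "q' \<in> M" "ed q' \<noteq> ed q" "vt q' = vt (\<alpha> q)" "vt (\<alpha> q') = vt q"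
    using twin_edge by blast
  then show "\<exists>e'\<in>edges G. e' \<noteq> e \<and> ends G e' = ends G e"
    using q \<open>q \<in> M\<close> by (intro bexI[of _ "ed q'"]) (auto simp: ends_ed edges_eq)
qed

lemma reachable_vt:
  assumes "conn M (\<lambda>x y. y = \<sigma> x \<or> y = \<alpha> x) p q"
  shows "reachable G (vt p) (vt q)"
proof -
  have "reachable G (vt p) (vt p) = reachable G (vt p) (vt q)"
    using assms
  proof (rule conn_inv[where P = "\<lambda>q. reachable G (vt p) (vt q)"])
    fix a b assume ab: "a \<in> M" "b \<in> M" "b = \<sigma> a \<or> b = \<alpha> a"
    show "reachable G (vt p) (vt a) = reachable G (vt p) (vt b)"
    proof (cases "b = \<sigma> a")
      case False
      then have "ed a \<in> edges G" "ends G (ed a) = {vt a, vt b}" using ab by (auto simp: edges_eq ends_ed)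
      then show ?thesis
        using reachable_step[of G _ "vt a" "ed a" "vt b"] reachable_step[of G _ "vt b" "ed a" "vt a"]
        by (auto simp: insert_commute)
    qed (use vt_rot ab in simp)
  qed
  then show ?thesis by (simp add: reachable_def)
qed

theorem doubled_outside_G: "\<exists>W. doubled_outside G W (580 * g)"
proof -
  let ?c = "\<lambda>x y. y = \<sigma> x \<or> y = \<alpha> x"
  define r where "r C = (SOME x. x \<in> C)" for C :: "'d set"
  have r: "r C \<in> C" if "C \<in> classes_generated M ?c" for C
    using class_nonempty[OF that] some_in_eq unfolding r_def by blast
  \<comment> \<open>One dart from each component is added to the bad ones, so that every component
    contains an exceptional vertex. With at most \<open>g\<close> components this raises 144 to
    145.\<close>
  define Q where "Q = bad \<union> r ` classes_generated M ?c"
  have finc: "finite (classes_generated M ?c)" using fin by (rule finite_classes_generated)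
  have QM: "Q \<subseteq> M" using r class_subset unfolding Q_def bad_def by fast
  then have finQ: "finite Q" using fin by (rule finite_subset)
  have "card Q \<le> card bad + card (r ` classes_generated M ?c)" unfolding Q_def by (rule card_Un_le)
  also have "\<dots> \<le> 145 * g"
    using card_bad num_components_le card_image_le[OF finc, of r] by linarith
  finally have cardQ: "card Q \<le> 145 * g" .
  \<comment> \<open>Either the degree is four and at least one dart at the vertex lies in
    \<open>Q\<close>, or all darts there are bad and are counted in \<open>Q\<close>. The factor 4
    yields \<open>580 = 4 * 145\<close>.\<close>
  have deg: "degree G (vt p) \<le> 4 * card {q \<in> Q. vt q = vt p}" if p: "p \<in> Q" for p
  proof (cases "card (orbit p) = 4")
    case True
    have "{q \<in> Q. vt q = vt p} \<noteq> {}" using p by blast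
    then have "card {q \<in> Q. vt q = vt p} > 0" using finQ by (simp add: card_gt_0_iff)
    then show ?thesis using True p QM degree_eq[of p] by auto
  next
    case False
    have pM: "p \<in> M" using p QM by blast
    have "orbit p \<subseteq> {q \<in> Q. vt q = vt p}"
    proof
      fix q assume q: "q \<in> orbit p"
      then have "q \<in> M" "vt q = vt p" using pM by (auto simp: orbit_eq)
      then have "orbit q = orbit p" using pM by (simp add: orbit_eq)
      then show "q \<in> {q \<in> Q. vt q = vt p}"
        using False \<open>q \<in> M\<close> \<open>vt q = vt p\<close> by (simp add: Q_def bad_def)
    qed
    then have "card (orbit p) \<le> card {q \<in> Q. vt q = vt p}" using finQ by (intro card_mono) auto
    then show ?thesis using degree_eq[OF pM] by simp
  qed
  have "(\<Sum>w\<in>vt ` Q. degree G w) \<le> (\<Sum>w\<in>vt ` Q. 4 * card {q \<in> Q. vt q = w})"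
    using deg by (intro sum_mono) auto
  also have "\<dots> = 4 * (\<Sum>w\<in>vt ` Q. \<Sum>q\<in>{q \<in> Q. vt q = w}. 1)" by (simp add: sum_distrib_left)
  also have "\<dots> = 4 * card Q" using sum.image_gen[OF finQ, of "\<lambda>_. 1::nat" vt] by simp
  finally have "(\<Sum>w\<in>vt ` Q. degree G w) \<le> 580 * g" using cardQ by linarith
  moreover have "card (vt ` Q) \<le> 580 * g" using card_image_le[OF finQ, of vt] cardQ by linarith
  moreover have "doubled_vertex G v" if v: "v \<in> verts G - vt ` Q" for v
  proof -
    obtain p where p: "p \<in> M" "v = vt p" using v by (auto simp: verts_eq)
    have "orbit p \<inter> bad = {}"
    proof (intro equals0I)
      fix q assume "q \<in> orbit p \<inter> bad"
      then have "q \<in> Q" "vt q = v" using p by (auto simp: orbit_eq Q_def)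
      then show False using v by blast
    qed
    then show ?thesis using doubled_vertex_good p by simp
  qed
  moreover have "\<exists>w\<in>vt ` Q. reachable G w v" if v: "v \<in> verts G" for v
  proof -
    obtain p where p: "p \<in> M" "v = vt p" using v by (auto simp: verts_eq)
    let ?C = "cls M ?c p"
    have C: "?C \<in> classes_generated M ?c" using p by (simp add: classes_generated_eq)
    then have "r ?C \<in> ?C" by (rule r)
    then have "conn M ?c (r ?C) p" by (auto simp: in_cls intro: conn_sym)
    then have "reachable G (vt (r ?C)) v" using reachable_vt p by simp
    moreover have "r ?C \<in> Q" using C by (simp add: Q_def)
    ultimately show ?thesis by blast
  qed
  moreover have "vt ` Q \<subseteq> verts G" using QM by (auto simp: verts_eq)
  ultimately show ?thesis
    unfolding doubled_outside_def using multigraph_G loopless by (intro exI[of _ "vt ` Q"]) simp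
qed

end

section \<open>Contracting doubled paths\<close>

lemma two_element_ends:
  assumes "card A = 2" "v \<in> A"
  obtains u where "A = {v, u}" "u \<noteq> v"
proof -
  obtain x y where "A = {x, y}" "x \<noteq> y" using assms(1) by (auto simp: card_2_iff)
  then show ?thesis using that[of x] that[of y] assms(2) by (auto simp: insert_commute)
qed

lemma degree_loopless:
  assumes "\<forall>e\<in>edges G. card (ends G e) = 2"
  shows "degree G v = card {e \<in> edges G. v \<in> ends G e}"
proof -
  have no: "{e \<in> edges G. ends G e = {v}} = {}" using assms by fastforce
  show ?thesis unfolding degree_def no by simp
qed

text \<open>The vertex \<open>v\<close> has two neighbours \<open>u\<close> and \<open>w\<close>,
  with two edges to each, so \<open>u\<close>, \<open>v\<close>, \<open>w\<close> is a doubled path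
  of length two. When \<open>v\<close> is merged into \<open>u\<close>, the pair towards
  \<open>w\<close> replaces the deleted pair at \<open>u\<close>: all remaining degrees are kept,
  and no loop arises because \<open>u\<close> and \<open>w\<close> differ.\<close>

lemma contract_doubled_vertex:
  assumes G: "doubled_outside G W N" and v: "v \<in> verts G - W"
    and e: "e1 \<in> edges G" "e3 \<in> edges G" "v \<in> ends G e1" "v \<in> ends G e3" "ends G e1 \<noteq> ends G e3"
  shows "\<exists>H. doubled_path_contraction G H \<and> doubled_outside H W N \<and> card (verts H) < card (verts G)"
proof -
  have mg: "multigraph G" and two: "\<forall>e\<in>edges G. card (ends G e) = 2" and W: "W \<subseteq> verts G"
    and dbl: "\<forall>v\<in>verts G - W. doubled_vertex G v" and reach: "\<forall>v\<in>verts G. \<exists>w\<in>W. reachable G w v"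
    and N: "card W \<le> N" "(\<Sum>w\<in>W. degree G w) \<le> N"
    using G unfolding doubled_outside_def by blast+
  have dv: "degree G v = 4" "\<And>e. e \<in> edges G \<Longrightarrow> v \<in> ends G e \<Longrightarrow> \<exists>e'\<in>edges G. e' \<noteq> e \<and> ends G e' = ends G e"
    using dbl v unfolding doubled_vertex_def by blast+
  obtain e2 where e2: "e2 \<in> edges G" "e2 \<noteq> e1" "ends G e2 = ends G e1" using dv(2) e by blast
  obtain e4 where e4: "e4 \<in> edges G" "e4 \<noteq> e3" "ends G e4 = ends G e3" using dv(2) e by blast
  obtain u where u: "ends G e1 = {v, u}" "u \<noteq> v" using two e two_element_ends by metis
  obtain w where w: "ends G e3 = {v, w}" "w \<noteq> v" using two e two_element_ends by metis
  have uw: "u \<noteq> w" using u w e by auto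
  have in_verts: "u \<in> verts G" "w \<in> verts G" "v \<in> verts G"
    using mg e u w v unfolding multigraph_def by auto
  have fin: "finite (edges G)" "finite (verts G)" using mg by (auto simp: multigraph_def)
  have dist: "e1 \<noteq> e3" "e1 \<noteq> e4" "e2 \<noteq> e3" "e2 \<noteq> e4" using e e2 e4 by auto
  have at_v: "{e \<in> edges G. v \<in> ends G e} = {e1, e2, e3, e4}"
  proof (rule card_subset_eq[symmetric])
    show "card {e1, e2, e3, e4} = card {e \<in> edges G. v \<in> ends G e}"
      using dv(1) dist e2 e4 degree_loopless[OF two, of v] by simp
  qed (use fin e e2 e4 in auto)
  define H where "H = contract G u v {e1, e2}"
  have H: "verts H = verts G - {v}" "edges H = edges G - {e1, e2}"
    by (simp_all add: H_def contract_def)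
  have ends_H: "ends H e = (if e = e3 \<or> e = e4 then {u, w} else ends G e)" if "e \<in> edges H" for e
  proof (cases "e = e3 \<or> e = e4")
    case True
    then have "ends G e = {v, w}" using w e4 by auto
    then show ?thesis using True w(2) by (auto simp: H_def contract_def)
  next
    case False
    then have "v \<notin> ends G e" using at_v that H by blast
    then show ?thesis using False by (auto simp: H_def contract_def)
  qed
  have no_v: "v \<notin> ends G e" if "e \<in> edges H" "e \<noteq> e3" "e \<noteq> e4" for e
    using at_v that H by blast
  have contr: "doubled_path_contraction G H"
    unfolding doubled_path_contraction_def
  proof (intro exI conjI)
    show "doubled_path G [u, v, w] [(e1, e2), (e3, e4)]"
      unfolding doubled_path_def
      using e e2 e4 u w uw in_verts dv(1)
      by (auto simp: less_Suc_eq nth_Cons' insert_commute)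
    show "H = contract G ([u, v, w] ! 0) ([u, v, w] ! Suc 0) {fst ([(e1, e2), (e3, e4)] ! 0), snd ([(e1, e2), (e3, e4)] ! 0)}"
      by (simp add: H_def)
  qed simp_all
  have two_H: "\<forall>e\<in>edges H. card (ends H e) = 2"
    using two uw by (auto simp: ends_H) (auto simp: H)
  have mg_H: "multigraph H"
    unfolding multigraph_def
  proof (intro conjI ballI)
    fix e assume eH: "e \<in> edges H"
    show "ends H e \<subseteq> verts H"
    proof (cases "e = e3 \<or> e = e4")
      case True
      then show ?thesis using ends_H[OF eH] in_verts u w H by auto
    next
      case False
      then show ?thesis using ends_H[OF eH] no_v[OF eH] mg eH unfolding multigraph_def H by auto
    qed
    show "card (ends H e) \<in> {1, 2}" using two_H eH by simp
  qed (use fin H in auto)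
  have deg: "degree H x = degree G x" if x: "x \<in> verts H" for x
  proof (cases "x = u")
    case False
    have "{e \<in> edges H. x \<in> ends H e} = {e \<in> edges G. x \<in> ends G e}"
    proof (intro Collect_cong iffI)
      fix e assume "e \<in> edges H \<and> x \<in> ends H e"
      then show "e \<in> edges G \<and> x \<in> ends G e"
        using ends_H[of e] False w(1) e4 by (auto simp: H split: if_splits)
    next
      fix e assume e: "e \<in> edges G \<and> x \<in> ends G e"
      then have "e \<noteq> e1" "e \<noteq> e2" using u False x e2 H by auto
      then have eH: "e \<in> edges H" using e H by simp
      then show "e \<in> edges H \<and> x \<in> ends H e"
        using ends_H[OF eH] e x w(1) e4 H by auto
    qed
    then show ?thesis using degree_loopless[OF two] degree_loopless[OF two_H] by simp
  next
    case True
    let ?E = "{e \<in> edges G. u \<in> ends G e}"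
    have "{e \<in> edges H. u \<in> ends H e} = (?E - {e1, e2}) \<union> {e3, e4}"
    proof (intro equalityI subsetI)
      fix e assume "e \<in> {e \<in> edges H. u \<in> ends H e}"
      then show "e \<in> (?E - {e1, e2}) \<union> {e3, e4}"
        using ends_H[of e] by (auto simp: H split: if_splits)
    next
      fix f assume f: "f \<in> (?E - {e1, e2}) \<union> {e3, e4}"
      then have fH: "f \<in> edges H" using H e e4 dist by auto
      then show "f \<in> {e \<in> edges H. u \<in> ends H e}" using ends_H[OF fH] f by auto
    qed
    moreover have "(?E - {e1, e2}) \<inter> {e3, e4} = {}" using w u uw e4 by auto
    moreover have "{e1, e2} \<subseteq> ?E" using e e2 u by auto
    then have "card (?E - {e1, e2}) = card ?E - 2" "2 \<le> card ?E"
      using e2 fin card_mono[of ?E "{e1, e2}"] by (simp_all add: card_Diff_subset)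
    ultimately have "card {e \<in> edges H. u \<in> ends H e} = card ?E"
      using fin e4 by (simp add: card_Un_disjoint)
    then show ?thesis using degree_loopless[OF two] degree_loopless[OF two_H] True by simp
  qed
  have dbl_H: "doubled_vertex H x" if x: "x \<in> verts H - W" for x
    unfolding doubled_vertex_def
  proof (intro conjI ballI impI)
    have dx: "doubled_vertex G x" using x dbl H by auto
    then show "degree H x = 4" using deg x unfolding doubled_vertex_def by auto
    fix e assume eH: "e \<in> edges H" "x \<in> ends H e"
    have "e3 \<in> edges H" "e4 \<in> edges H" using e e4 dist H by auto
    show "\<exists>e'\<in>edges H. e' \<noteq> e \<and> ends H e' = ends H e"
    proof (cases "e = e3 \<or> e = e4")
      case True
      then show ?thesis using \<open>e3 \<in> edges H\<close> \<open>e4 \<in> edges H\<close> e4(2) ends_H by metis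
    next
      case False
      then have "ends H e = ends G e" "v \<notin> ends G e" using ends_H[OF eH(1)] no_v[OF eH(1)] by auto
      then obtain e' where e': "e' \<in> edges G" "e' \<noteq> e" "ends G e' = ends G e"
        using dx eH H unfolding doubled_vertex_def by auto
      then have "e' \<notin> {e1, e2, e3, e4}" using \<open>v \<notin> ends G e\<close> e e2 e4 by auto
      then have "e' \<in> edges H" "ends H e' = ends G e'" using e' ends_H[of e'] H by auto
      then show ?thesis using e' \<open>ends H e = ends G e\<close> by auto
    qed
  qed
  have reach_H: "\<exists>a\<in>W. reachable H a y" if y: "y \<in> verts H" for y
  proof -
    let ?q = "\<lambda>x. if x = v then u else x"
    obtain a where a: "a \<in> W" "reachable G a y" using reach y H by auto
    have "reachable H (?q a) (?q y)"
      using a(2) unfolding reachable_def[of G]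
    proof (induction rule: rtranclp_induct)
      case base
      then show ?case by (simp add: reachable_def)
    next
      case (step b c)
      then obtain f where f: "f \<in> edges G" "ends G f = {b, c}" by blast
      show ?case
      proof (cases "f \<in> {e1, e2}")
        case True
        then have "{b, c} = {v, u}" using f e2 u by auto
        then have "?q b = ?q c" by (auto simp: doubleton_eq_iff)
        then show ?thesis using step.IH by simp
      next
        case False
        then have "f \<in> edges H" "ends H f = {?q b, ?q c}"
          using f by (auto simp: H_def contract_def)
        then show ?thesis using reachable_step[OF step.IH] by blast
      qed
    qed
    moreover have "?q a = a" "?q y = y" using a v y H by auto
    ultimately show ?thesis using a by metis
  qed
  have "W \<subseteq> verts H" using W v H by auto
  moreover from this have "(\<Sum>w\<in>W. degree H w) \<le> N" using N(2) deg by (metis (no_types, lifting) subsetD sum.cong)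
  ultimately have "doubled_outside H W N"
    unfolding doubled_outside_def using mg_H two_H dbl_H reach_H N(1) by blast
  moreover have "card (verts H) < card (verts G)" unfolding H using fin in_verts by (intro psubset_card_mono) auto
  ultimately show ?thesis using contr by blast
qed

text \<open>A vertex outside \<open>W\<close> now has a single neighbour. An edge that avoids
  \<open>W\<close> would thus span a whole component, out of reach from \<open>W\<close>. Hence
  every edge touches \<open>W\<close> and is counted by the degrees there.\<close>

lemma uncontractible_bounded:
  assumes G: "doubled_outside G W N"
    and same: "\<And>v e f. \<lbrakk>v \<in> verts G - W; e \<in> edges G; f \<in> edges G; v \<in> ends G e; v \<in> ends G f\<rbrakk> \<Longrightarrow> ends G e = ends G f"
  shows "card (verts G) \<le> 3 * N \<and> card (edges G) \<le> N"
proof -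
  have mg: "multigraph G" and two: "\<forall>e\<in>edges G. card (ends G e) = 2" and W: "W \<subseteq> verts G"
    and dbl: "\<forall>v\<in>verts G - W. doubled_vertex G v" and reach: "\<forall>v\<in>verts G. \<exists>w\<in>W. reachable G w v"
    and N: "card W \<le> N" "(\<Sum>w\<in>W. degree G w) \<le> N"
    using G unfolding doubled_outside_def by blast+
  have fin: "finite (edges G)" "finite (verts G)" using mg by (auto simp: multigraph_def)
  have finW: "finite W" using W fin by (auto intro: finite_subset)
  have sub: "ends G e \<subseteq> verts G" if "e \<in> edges G" for e using mg that by (auto simp: multigraph_def)
  have meets: "ends G e \<inter> W \<noteq> {}" if e: "e \<in> edges G" for e
  proof
    assume disj: "ends G e \<inter> W = {}"
    obtain u v where uv: "ends G e = {u, v}" "u \<noteq> v" using two e by (metis card_2_iff)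
    then have out: "u \<in> verts G - W" "v \<in> verts G - W" using sub[OF e] disj by auto
    obtain a where a: "a \<in> W" "reachable G a u" using reach out by blast
    have avoid: "y \<notin> {u, v}" if "reachable G a y" for y
      using that unfolding reachable_def
    proof (induction rule: rtranclp_induct)
      case base
      then show ?case using a out by auto
    next
      case (step b c)
      then obtain f where f: "f \<in> edges G" "ends G f = {b, c}" by blast
      show ?case
      proof
        assume "c \<in> {u, v}"
        then have "ends G e = ends G f" using same[of c e f] out e f uv by auto
        then show False using f uv step.IH by auto
      qed
    qed
    then show False using avoid[OF a(2)] by simp
  qed
  have "edges G \<subseteq> (\<Union>w\<in>W. {e \<in> edges G. w \<in> ends G e})" using meets by blast
  then have "card (edges G) \<le> card (\<Union>w\<in>W. {e \<in> edges G. w \<in> ends G e})"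
    using fin finW by (intro card_mono) auto
  also have "\<dots> \<le> (\<Sum>w\<in>W. card {e \<in> edges G. w \<in> ends G e})" using finW by (rule card_UN_le)
  also have "\<dots> = (\<Sum>w\<in>W. degree G w)" using degree_loopless[OF two] by simp
  finally have E: "card (edges G) \<le> N" using N(2) by simp
  have "verts G \<subseteq> W \<union> (\<Union>e\<in>edges G. ends G e)"
  proof
    fix v assume v: "v \<in> verts G"
    show "v \<in> W \<union> (\<Union>e\<in>edges G. ends G e)"
    proof (cases "v \<in> W")
      case False
      then have "degree G v = 4" using dbl v unfolding doubled_vertex_def by blast
      then have "card {e \<in> edges G. v \<in> ends G e} = 4" using degree_loopless[OF two, of v] by simp
      then have "{e \<in> edges G. v \<in> ends G e} \<noteq> {}" by (metis card.empty zero_neq_numeral)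
      then show ?thesis by blast
    qed simp
  qed
  moreover have "finite (W \<union> (\<Union>e\<in>edges G. ends G e))"
    using finW fin sub by (meson finite_UN finite_Un finite_subset)
  ultimately have "card (verts G) \<le> card (W \<union> (\<Union>e\<in>edges G. ends G e))" by (rule card_mono[rotated])
  also have "\<dots> \<le> card W + card (\<Union>e\<in>edges G. ends G e)" by (rule card_Un_le)
  also have "\<dots> \<le> card W + (\<Sum>e\<in>edges G. card (ends G e))" using card_UN_le[OF fin(1)] by simp
  also have "\<dots> = card W + 2 * card (edges G)" using two by simp
  finally show ?thesis using E N(1) by simp
qed

lemma doubled_path_equiv_bounded:
  assumes "doubled_outside G W N"
  shows "\<exists>H. (G, H) \<in> doubled_path_equiv \<and> multigraph H \<and> card (verts H) \<le> 3 * N \<and> card (edges H) \<le> N"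
  using assms
proof (induction "card (verts G)" arbitrary: G rule: less_induct)
  case less
  have mg: "multigraph G" using less.prems by (simp add: doubled_outside_def)
  show ?case
  proof (cases "\<exists>v e f. v \<in> verts G - W \<and> e \<in> edges G \<and> f \<in> edges G \<and> v \<in> ends G e \<and> v \<in> ends G f \<and> ends G e \<noteq> ends G f")
    case True
    then obtain H where H: "doubled_path_contraction G H" "doubled_outside H W N" "card (verts H) < card (verts G)"
      using contract_doubled_vertex[OF less.prems] by blast
    obtain K where K: "(H, K) \<in> doubled_path_equiv" "multigraph K" "card (verts K) \<le> 3 * N" "card (edges K) \<le> N"
      using less.hyps[OF H(3,2)] by blast
    have "multigraph H" using H(2) by (simp add: doubled_outside_def)
    then have "(G, H) \<in> doubled_path_equiv"
      using mg H(1) by (simp add: doubled_path_equiv_def r_into_equivclp)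
    then have "(G, K) \<in> doubled_path_equiv"
      using K(1) equiv_doubled_path_equiv unfolding equiv_def trans_def by blast
    then show ?thesis using K by blast
  next
    case False
    then have "card (verts G) \<le> 3 * N \<and> card (edges G) \<le> N"
      by (intro uncontractible_bounded[OF less.prems]) blast
    moreover have "(G, G) \<in> doubled_path_equiv"
      using equiv_doubled_path_equiv unfolding equiv_def refl_on_def by blast
    ultimately show ?thesis using mg by blast
  qed
qed

section \<open>Finitely many graphs of bounded size\<close>

lemma multigraph_iso:
  assumes "multigraph G" "graph_iso G H"
  shows "multigraph H"
proof -
  obtain f g where f: "bij_betw f (verts G) (verts H)" and g: "bij_betw g (edges G) (edges H)"
    and fg: "\<forall>e\<in>edges G. ends H (g e) = f ` ends G e"
    using assms(2) unfolding graph_iso_def by blast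
  show ?thesis
    unfolding multigraph_def
  proof (intro conjI ballI)
    show "finite (verts H)" "finite (edges H)"
      using assms(1) f g bij_betw_finite unfolding multigraph_def by blast+
    fix e assume "e \<in> edges H"
    then obtain d where d: "d \<in> edges G" "e = g d" using g by (metis bij_betw_imp_surj_on imageE)
    then have s: "ends G d \<subseteq> verts G" "card (ends G d) \<in> {1, 2}" "ends H e = f ` ends G d"
      using assms(1) fg unfolding multigraph_def by auto
    then show "ends H e \<subseteq> verts H" using f by (auto simp: bij_betw_def)
    have "inj_on f (ends G d)" using f s(1) by (auto simp: bij_betw_def intro: inj_on_subset)
    then show "card (ends H e) \<in> {1, 2}" using s by (simp add: card_image)
  qed
qed

text \<open>Records that differ only in the ends of non-edges are different, so the values of
  \<open>d\<close> from \<open>n\<close> on are fixed to be empty to keep the set finite.\<close>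

definition standard_graphs :: "nat \<Rightarrow> nat \<Rightarrow> (nat, nat) multigraph set" where
  "standard_graphs m n = (\<lambda>(a, b, d). \<lparr>verts = {..<a}, edges = {..<b}, ends = d\<rparr>) `
    ({..m} \<times> {..n} \<times> {d. \<forall>x. (x \<in> {..<n} \<longrightarrow> d x \<in> Pow {..<m}) \<and> (x \<notin> {..<n} \<longrightarrow> d x = {})})"

lemma finite_standard_graphs: "finite (standard_graphs m n)"
  unfolding standard_graphs_def
  by (intro finite_imageI finite_cartesian_product finite_set_of_finite_funs) auto

lemma standard_graph_iso:
  fixes G :: "('v, 'e) multigraph"
  assumes G: "multigraph G" "card (verts G) \<le> m" "card (edges G) \<le> n"
  shows "\<exists>H\<in>standard_graphs m n. graph_iso G H"
proof -
  have fin: "finite (edges G)" "finite (verts G)" using G by (auto simp: multigraph_def)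
  let ?a = "card (verts G)" and ?b = "card (edges G)"
  obtain f where f: "bij_betw f (verts G) {..<?a}"
    using ex_bij_betw_finite_nat[OF fin(2)] by (auto simp: atLeast0LessThan)
  obtain g where g: "bij_betw g (edges G) {..<?b}"
    using ex_bij_betw_finite_nat[OF fin(1)] by (auto simp: atLeast0LessThan)
  define d where "d x = (if x < ?b then f ` ends G (the_inv_into (edges G) g x) else {})" for x
  let ?H = "\<lparr>verts = {..<?a}, edges = {..<?b}, ends = d\<rparr>"
  have inv: "the_inv_into (edges G) g x \<in> edges G" if "x < ?b" for x
    using g that by (metis bij_betw_def lessThan_iff order_refl the_inv_into_into)
  have "d x \<subseteq> {..<m}" for x
  proof (cases "x < ?b")
    case True
    then have "ends G (the_inv_into (edges G) g x) \<subseteq> verts G" using inv G by (auto simp: multigraph_def)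
    then have "d x \<subseteq> f ` verts G" using True by (auto simp: d_def)
    also have "f ` verts G = {..<?a}" using f by (simp add: bij_betw_def)
    finally show ?thesis using G(2) by auto
  qed (simp add: d_def)
  moreover have "d x = {}" if "x \<notin> {..<n}" for x using that G(3) by (simp add: d_def)
  ultimately have "?H \<in> standard_graphs m n"
    unfolding standard_graphs_def using G(2,3) by (intro image_eqI[of _ _ "(?a, ?b, d)"]) auto
  moreover have "graph_iso G ?H"
    unfolding graph_iso_def
  proof (intro exI conjI ballI)
    show "bij_betw f (verts G) (verts ?H)" "bij_betw g (edges G) (edges ?H)" using f g by simp_all
    fix e assume e: "e \<in> edges G"
    then have "g e < ?b" "the_inv_into (edges G) g (g e) = e"
      using g by (auto simp: bij_betw_def the_inv_into_f_f)
    then show "ends ?H (g e) = f ` ends G e" by (simp add: d_def)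
  qed
  ultimately show ?thesis by blast
qed

lemma finite_quotient_bounded:
  fixes S :: "(nat, nat) multigraph set"
  assumes "\<And>G. G \<in> S \<Longrightarrow> \<exists>H. (G, H) \<in> doubled_path_equiv \<and> multigraph H \<and> card (verts H) \<le> m \<and> card (edges H) \<le> n"
  shows "finite (S // doubled_path_equiv)"
proof (rule finite_subset)
  show "S // doubled_path_equiv \<subseteq> (\<lambda>H. doubled_path_equiv `` {H}) ` standard_graphs m n"
  proof
    fix Q assume "Q \<in> S // doubled_path_equiv"
    then obtain G where G: "G \<in> S" "Q = doubled_path_equiv `` {G}" by (auto simp: quotient_def)
    obtain H where H: "(G, H) \<in> doubled_path_equiv" "multigraph H" "card (verts H) \<le> m" "card (edges H) \<le> n"
      using assms[OF G(1)] by blast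
    obtain K where K: "K \<in> standard_graphs m n" "graph_iso H K"
      using standard_graph_iso[OF H(2-4)] by blast
    have "(H, K) \<in> doubled_path_equiv"
      using H(2) K(2) multigraph_iso by (auto simp: doubled_path_equiv_def intro!: r_into_equivclp)
    then have "(G, K) \<in> doubled_path_equiv"
      using H(1) equiv_doubled_path_equiv unfolding equiv_def trans_def by blast
    then have "Q = doubled_path_equiv `` {K}"
      using G(2) equiv_class_eq[OF equiv_doubled_path_equiv] by simp
    then show "Q \<in> (\<lambda>H. doubled_path_equiv `` {H}) ` standard_graphs m n" using K by blast
  qed
qed (simp add: finite_standard_graphs)

section \<open>Reduced graphs\<close>

text \<open>Connectivity is assumed for components, so the cut is restricted to the component of an
  edge in it. Fewer than three edges there could be removed without disconnecting the two ends, yet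
  no remaining edge leaves \<open>S\<close>.\<close>

lemma reduced_three_edge_connected:
  assumes "multigraph G" "reduced G" "\<not> single_vertex G" "cut G S \<noteq> {}"
  shows "3 \<le> card (cut G S)"
proof (rule ccontr)
  assume small: "\<not> 3 \<le> card (cut G S)"
  have fin: "finite (cut G S)" using assms(1) by (auto simp: multigraph_def cut_def)
  obtain e where e: "e \<in> edges G" "ends G e \<inter> S \<noteq> {}" "\<not> ends G e \<subseteq> S" using assms(4) by (auto simp: cut_def)
  then obtain u w where uw: "u \<in> ends G e" "u \<in> S" "w \<in> ends G e" "w \<notin> S" by blast
  have "ends G e = {u, w}"
  proof -
    have "card (ends G e) \<in> {1, 2}" using assms(1) e(1) unfolding multigraph_def by blast
    then have "card (ends G e) \<le> 2" "finite (ends G e)" by (auto intro: card_ge_0_finite)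
    then have "card (ends G e) \<le> card {u, w}" using uw by (cases "u = w") auto
    then show ?thesis using uw card_seteq[OF \<open>finite (ends G e)\<close>, of "{u, w}"] by auto
  qed
  then have r: "reachable G u w" using reachable_step[of G u u e w] e(1) by (simp add: reachable_def)
  have V: "u \<in> verts G" "w \<in> verts G" using uw e(1) assms(1) unfolding multigraph_def by auto
  let ?C = "component_of G u" and ?F = "cut G S \<inter> edges (component_of G u)"
  have "k_edge_connected 3 ?C" using assms(2,3) V unfolding reduced_def by blast
  moreover have "?F \<subseteq> edges ?C" "finite ?F" "card ?F < 3"
    using small fin card_mono[OF fin, of ?F] by auto
  ultimately have "connected_graph (delete_edges ?C ?F)"
    unfolding k_edge_connected_def by (metis (no_types))
  moreover have "u \<in> verts (delete_edges ?C ?F)" "w \<in> verts (delete_edges ?C ?F)"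
    using V r by (auto simp: delete_edges_def component_of_def Let_def reachable_def)
  ultimately have "reachable (delete_edges ?C ?F) u w" unfolding connected_graph_def by blast
  then have "w \<in> S"
    unfolding reachable_def
  proof (induction rule: rtranclp_induct)
    case (step b c)
    then obtain f where f: "f \<in> edges (delete_edges ?C ?F)" "ends (delete_edges ?C ?F) f = {b, c}" by blast
    then have "f \<notin> cut G S" "f \<in> edges G" "ends G f = {b, c}"
      by (auto simp: delete_edges_def component_of_def Let_def)
    then show ?case using step.IH by (auto simp: cut_def)
  qed (use uw in simp)
  then show False using uw by simp
qed

text \<open>Alternating components and circles of the diagram give isolated vertices. Excluding
  these ensures that every vertex of \<open>G\<close> comes from a decomposition curve.\<close>

lemma reduced_no_isolated_vertex:
  assumes "multigraph G" "reduced G" "\<not> single_vertex G" "v \<in> verts G"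
  shows "\<exists>e\<in>edges G. v \<in> ends G e"
proof (rule ccontr)
  assume iso: "\<not> (\<exists>e\<in>edges G. v \<in> ends G e)"
  have only: "y = v" if "reachable G v y" for y
    using that unfolding reachable_def
  proof (induction rule: rtranclp_induct)
    case (step y z)
    then show ?case using iso by auto
  qed simp
  have W: "{w \<in> verts G. reachable G v w} = {v}" using only assms(4) by (auto simp: reachable_def)
  have "{e \<in> edges G. ends G e \<subseteq> {v}} = {}"
  proof -
    have "\<not> ends G e \<subseteq> {v}" if "e \<in> edges G" for e
    proof
      assume "ends G e \<subseteq> {v}"
      then have "ends G e = {}" using iso that by blast
      then show False using assms(1) that unfolding multigraph_def by force
    qed
    then show ?thesis by blast
  qed
  then have "single_vertex (component_of G v)"
    unfolding component_of_def Let_def W single_vertex_def by simp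
  then show False using assms(2-4) unfolding reduced_def by blast
qed

section \<open>The map of an alternating decomposition graph\<close>

context diagram_map
begin

lemma adg_simps:
  "verts (adg D) = Curve ` decomposition_curves D \<union> Alternating_Component ` alternating_components D \<union> Circle ` {..<circles D}"
  "edges (adg D) = (\<lambda>p. {p, opp D p}) ` M"
  by (auto simp: adg_def)

abbreviation curve :: "'d \<Rightarrow> 'd set" where
  "curve \<equiv> cls M (orb next_point)"

lemma ends_adg:
  assumes "p \<in> M"
  shows "ends (adg D) {p, opp D p} = {Curve (curve p), Curve (curve (opp D p))}"
proof -
  have o: "opp D p \<in> M" using assms MX opp_in_M by auto
  have "C \<in> decomposition_curves D \<and> C \<inter> {p, opp D p} \<noteq> {} \<longleftrightarrow> C = curve p \<or> C = curve (opp D p)" for C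
  proof
    assume C: "C \<in> decomposition_curves D \<and> C \<inter> {p, opp D p} \<noteq> {}"
    then have "C \<in> classes_generated M (orb next_point)" by (simp add: decomposition_curves_eq)
    then show "C = curve p \<or> C = curve (opp D p)"
      using C class_eq_cls[of C M "orb next_point" p] class_eq_cls[of C M "orb next_point" "opp D p"] by blast
  next
    assume "C = curve p \<or> C = curve (opp D p)"
    then show "C \<in> decomposition_curves D \<and> C \<inter> {p, opp D p} \<noteq> {}"
      using assms o cls_self[of p M "orb next_point"] cls_self[of "opp D p" M "orb next_point"]
      by (auto simp: decomposition_curves_eq classes_generated_eq)
  qed
  then have "{C \<in> decomposition_curves D. C \<inter> {p, opp D p} \<noteq> {}} = {curve p, curve (opp D p)}" by auto
  then show ?thesis by (simp add: adg_def)
qed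

lemma multigraph_adg: "multigraph (adg D)"
  unfolding multigraph_def
proof (intro conjI ballI)
  have "finite (crossing_components D)"
    unfolding crossing_components_def by (rule finite_classes_generated[OF finX])
  then have "finite (alternating_components D)"
    unfolding alternating_components_def by simp
  moreover have "finite (decomposition_curves D)"
    unfolding decomposition_curves_eq by (rule finite_classes_generated[OF finM])
  ultimately show "finite (verts (adg D))" unfolding adg_simps by simp
  show "finite (edges (adg D))" unfolding adg_simps using finM by simp
  fix e assume "e \<in> edges (adg D)"
  then obtain p where p: "p \<in> M" "e = {p, opp D p}" by (auto simp: adg_simps)
  have "opp D p \<in> M" using p MX opp_in_M by auto
  then show "ends (adg D) e \<subseteq> verts (adg D)"
    using p ends_adg[OF p(1)] by (auto simp: adg_simps decomposition_curves_eq classes_generated_eq)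
  show "card (ends (adg D) e) \<in> {1, 2}" using p ends_adg[OF p(1)] by (simp add: card_insert_if)
qed

lemma adg_doubled_outside:
  fixes G :: "('v, 'e) multigraph"
  assumes iso: "graph_iso (adg D) G" and red: "reduced G" "\<not> single_vertex G"
    and genus: "turaev_genus D = real k"
  shows "\<exists>W. doubled_outside G W (580 * k)"
proof -
  obtain f g where f: "bij_betw f (verts (adg D)) (verts G)" and g: "bij_betw g (edges (adg D)) (edges G)"
    and fg: "\<forall>e\<in>edges (adg D). ends G (g e) = f ` ends (adg D) e"
    using iso unfolding graph_iso_def by blast
  have mg: "multigraph G" using multigraph_adg iso by (rule multigraph_iso)
  define vt where "vt p = f (Curve (curve p))" for p
  define ed where "ed p = g {p, opp D p}" for p
  have oM: "opp D p \<in> M" if "p \<in> M" for p using that MX opp_in_M by auto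
  have edge: "{p, opp D p} \<in> edges (adg D)" if "p \<in> M" for p using that by (auto simp: adg_simps)
  have cv: "Curve (curve p) \<in> verts (adg D)" if "p \<in> M" for p
    using that by (simp add: adg_simps decomposition_curves_eq classes_generated_eq)
  have inj: "inj_on f (verts (adg D))" "inj_on g (edges (adg D))" using f g by (auto simp: bij_betw_def)
  have ends_ed: "ends G (ed p) = {vt p, vt (opp D p)}" if "p \<in> M" for p
    using fg edge[OF that] ends_adg[OF that] by (simp add: ed_def vt_def)
  have edges_eq: "edges G = ed ` M"
  proof -
    have "edges G = g ` edges (adg D)" using g by (simp add: bij_betw_def)
    then show ?thesis by (simp add: adg_simps image_image ed_def)
  qed
  have verts_eq: "verts G = vt ` M"
  proof (intro equalityI subsetI)
    fix v assume v: "v \<in> verts G"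
    then obtain e where "e \<in> edges G" "v \<in> ends G e" using reduced_no_isolated_vertex[OF mg red] by blast
    then show "v \<in> vt ` M" using ends_ed oM by (auto simp: edges_eq)
  next
    fix v assume "v \<in> vt ` M"
    then show "v \<in> verts G" using cv f by (auto simp: vt_def bij_betw_def)
  qed
  interpret signed_map M next_point "opp D" "over D" G vt ed k
  proof unfold_locales
    show "finite M" by (rule finM)
    show "bij_betw next_point M M" by (rule bij_next_point)
    show "verts G = vt ` M" "edges G = ed ` M" by (rule verts_eq edges_eq)+
    show "2 * real (ncl M (\<lambda>x y. y = next_point x \<or> y = opp D x)) + real (card M) / 2
      \<le> 2 * real k + real (ncl M (orb next_point))
        + real (ncl M (\<lambda>x y. y = opp D x \<or> over D x = False \<and> y = next_point x))
        + real (ncl M (\<lambda>x y. y = opp D x \<or> over D x = True \<and> y = next_point x))"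
      using genus_bound unfolding genus .
    fix p assume p: "p \<in> M"
    then have pX: "p \<in> X" using MX by blast
    show "opp D p \<in> M" by (rule oM[OF p])
    show "opp D p \<noteq> p" "opp D (opp D p) = p" using pX by (rule opp_neq opp_opp)+
    show "over D (opp D p) = over D p" using over_opp[OF pX] p by simp
    show "over D (next_point p) = (\<not> over D p)" using p by (rule over_next_point)
    show "ends G (ed p) = {vt p, vt (opp D p)}" using p by (rule ends_ed)
    fix q assume q: "q \<in> M"
    have "vt p = vt q \<longleftrightarrow> curve p = curve q"
      unfolding vt_def using inj(1) cv[OF p] cv[OF q] by (auto simp: inj_on_eq_iff)
    then show "(vt p = vt q) = conn M (orb next_point) p q" using p q by (simp add: cls_eq_iff)
    have "ed p = ed q \<longleftrightarrow> {p, opp D p} = {q, opp D q}"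
      unfolding ed_def using inj(2) edge[OF p] edge[OF q] by (auto simp: inj_on_eq_iff)
    then show "(ed p = ed q) = (q = p \<or> q = opp D p)"
      using opp_opp[OF pX] by (auto simp: doubleton_eq_iff)
  next
    fix C b
    assume C: "C \<subseteq> M" "\<And>p. p \<in> M \<Longrightarrow> opp D p \<in> C \<longleftrightarrow> p \<in> C"
      "\<And>p. p \<in> M \<Longrightarrow> over D p = b \<Longrightarrow> next_point p \<in> C \<longleftrightarrow> p \<in> C"
    show "\<exists>h :: 'd \<Rightarrow> bool. (\<forall>p\<in>M. h (next_point p) = h p) \<and> (\<forall>p\<in>M. (h (opp D p) \<noteq> h p) \<longleftrightarrow> p \<in> C)"
      by (rule cut_function[OF C]) (assumption | blast)+
  next
    fix S assume "cut G S \<noteq> {}"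
    then show "3 \<le> card (cut G S)" by (rule reduced_three_edge_connected[OF mg red])
  qed
  show ?thesis by (rule doubled_outside_G)
qed

end

theorem theorem1p5:
  fixes k :: nat
  shows "finite ({G :: (nat, nat) multigraph.
            alternating_decomposition_graph G \<and> reduced G \<and> graph_turaev_genus G = real k}
          // doubled_path_equiv)"
proof (rule finite_quotient_bounded)
  fix G :: "(nat, nat) multigraph"
  let ?N = "580 * k"
  assume "G \<in> {G. alternating_decomposition_graph G \<and> reduced G \<and> graph_turaev_genus G = real k}"
  then have G: "alternating_decomposition_graph G" "reduced G" "graph_turaev_genus G = real k" by auto
  \<comment> \<open>The same choice as in \<open>graph_turaev_genus\<close>, so that the genus in
    the hypothesis is that of \<open>D\<close>.\<close>
  define D :: "nat diagram" where "D = (SOME D. link_diagram D \<and> graph_iso (adg D) G)"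
  have diagram: "link_diagram D" "graph_iso (adg D) G"
    using someI_ex[OF G(1)[unfolded alternating_decomposition_graph_def]] by (simp_all add: D_def)
  have genus: "turaev_genus D = real k" using G(3) by (simp add: graph_turaev_genus_def D_def)
  interpret diagram_map D by unfold_locales (rule diagram)
  \<comment> \<open>The successor makes room for the single vertex, since \<open>?N\<close> is 0 for
    \<open>k = 0\<close>.\<close>
  show "\<exists>H. (G, H) \<in> doubled_path_equiv \<and> multigraph H \<and> card (verts H) \<le> Suc (3 * ?N) \<and> card (edges H) \<le> ?N"
  proof (cases "single_vertex G")
    case True
    then have "multigraph G" "card (verts G) = 1" "card (edges G) = 0"
      by (auto simp: single_vertex_def multigraph_def)
    moreover have "(G, G) \<in> doubled_path_equiv"
      using equiv_doubled_path_equiv unfolding equiv_def refl_on_def by blast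
    ultimately show ?thesis by auto
  next
    case False
    then obtain W where "doubled_outside G W ?N"
      using adg_doubled_outside[OF diagram(2) G(2) _ genus] by blast
    then show ?thesis using doubled_path_equiv_bounded by (meson le_SucI)
  qed
qed

end
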